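(* There is an absolute constant $C$ (depending only on the choice of the cutoff $\chi$) such that for every divergence-free vector field $u\in L^2(\mathbb R^3)$ and every $Q\in\mathbb N$, the energy flux satisfies $$|\Pi_Q|\le C\,(K\ast d^2)^{3/2}(Q),\qquad (K\ast d^2)(Q)=\sum_{q\ge-1}K(Q-q)\,d_q^2,$$ where $d_q=\lambda_q^{1/3}\|\Delta_qu\|_{L^3}$ and $K(q)=\lambda_q^{2/3}$ for $q\le0$, $K(q)=\lambda_q^{-4/3}$ for $q>0$.
   Context: Littlewood-Paley notation. $\lambda_q=2^q$. Fix a nonnegative radial $\chi\in C_0^\infty(B(0,1))$ on $\mathbb R^3$ with $\chi(\xi)=1$ for $|\xi|\le 1/2$, and let $\varphi(\xi)=\chi(\xi/2)-\chi(\xi)$. With $\mathcal F$ the Fourier transform, $\Delta_q u=\mathcal F^{-1}(\varphi(\lambda_q^{-1}\xi)\mathcal F u)$ for $q\ge 0$, $\Delta_{-1}u=\mathcal F^{-1}(\chi(\xi)\mathcal F u)$, and $S_Q=\sum_{q=-1}^{Q}\Delta_q$, so $S_Qu=\mathcal F^{-1}(\chi(\lambda_{Q+1}^{-1}\xi)\mathcal F u)$. Energy flux at wave number $\lambda_Q$ of a divergence-free $u\in L^2(\mathbb R^3)$: $\Pi_Q=\int_{\mathbb R^3}\mathrm{Tr}[S_Q(u\otimes u)\cdot\nabla S_Qu]\,dx=\int_{\mathbb R^3}\sum_{i,j}S_Q(u_iu_j)\,\partial_i S_Qu_j\,dx$. The right-hand side of the estimate is allowed to be $+\infty$. *)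

theory Defs
  imports "HOL-Analysis.Analysis"
begin

definition partial :: "3 \<Rightarrow> (real^3 \<Rightarrow> 'b::real_normed_vector) \<Rightarrow> real^3 \<Rightarrow> 'b" where
  "partial i f x = frechet_derivative f (at x) (axis i 1)"

definition partials :: "3 list \<Rightarrow> (real^3 \<Rightarrow> 'b::real_normed_vector) \<Rightarrow> real^3 \<Rightarrow> 'b" where
  "partials is f = foldr partial is f"

text \<open>Class $C^\infty$: every iterated partial derivative exists and is itself (Frechet)
  differentiable everywhere; in particular every one of them is continuous.\<close>
definition smooth :: "(real^3 \<Rightarrow> 'b::real_normed_vector) \<Rightarrow> bool" where
  "smooth f \<longleftrightarrow> (\<forall>is x. partials is f differentiable (at x))"

definition test_function :: "(real^3 \<Rightarrow> real) \<Rightarrow> bool" where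
  "test_function \<psi> \<longleftrightarrow> smooth \<psi> \<and> compact (closure {x. \<psi> x \<noteq> 0})"

definition schwartz :: "(real^3 \<Rightarrow> complex) \<Rightarrow> bool" where
  "schwartz \<psi> \<longleftrightarrow> smooth \<psi> \<and> (\<forall>is k. \<exists>B. \<forall>x. norm x ^ k * norm (partials is \<psi> x) \<le> B)"

definition fourier :: "(real^3 \<Rightarrow> complex) \<Rightarrow> real^3 \<Rightarrow> complex" where
  "fourier f \<xi> = (\<integral>x. cis (- (x \<bullet> \<xi>)) * f x \<partial>lebesgue)"

definition inv_fourier :: "(real^3 \<Rightarrow> complex) \<Rightarrow> real^3 \<Rightarrow> complex" where
  "inv_fourier f x = complex_of_real (1 / (2 * pi) ^ 3) * (\<integral>\<xi>. cis (x \<bullet> \<xi>) * f \<xi> \<partial>lebesgue)"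

text \<open>Tempered distributions are represented by their action on Schwartz functions; what such
  a functional does to other arguments is never used. The Fourier transform, its inverse and
  multiplication by a function are defined on distributions by duality.\<close>
type_synonym distribution = "(real^3 \<Rightarrow> complex) \<Rightarrow> complex"

definition dist_of :: "(real^3 \<Rightarrow> real) \<Rightarrow> distribution" where
  "dist_of f \<psi> = (\<integral>x. complex_of_real (f x) * \<psi> x \<partial>lebesgue)"

definition dist_fourier :: "distribution \<Rightarrow> distribution" where
  "dist_fourier T \<psi> = T (fourier \<psi>)"

definition dist_inv_fourier :: "distribution \<Rightarrow> distribution" where
  "dist_inv_fourier T \<psi> = T (inv_fourier \<psi>)"

definition dist_mult :: "(real^3 \<Rightarrow> real) \<Rightarrow> distribution \<Rightarrow> distribution" where
  "dist_mult m T \<psi> = T (\<lambda>\<xi>. complex_of_real (m \<xi>) * \<psi> \<xi>)"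

definition represents :: "(real^3 \<Rightarrow> real) \<Rightarrow> distribution \<Rightarrow> bool" where
  "represents v T \<longleftrightarrow> (\<forall>\<psi>. schwartz \<psi> \<longrightarrow>
     integrable lebesgue (\<lambda>x. complex_of_real (v x) * \<psi> x) \<and> dist_of v \<psi> = T \<psi>)"

text \<open>The function $\mathcal F^{-1}(m\,\mathcal F f)$. If $m$ is smooth with compact support, the
  distribution on the right is a smooth function, and we take its (unique) continuous
  representative. That representative is real-valued when $m$ is real and even, which is the case
  for the radial symbols below; hence the real codomain.\<close>
definition fourier_multiplier ::
  "(real^3 \<Rightarrow> real) \<Rightarrow> (real^3 \<Rightarrow> real) \<Rightarrow> real^3 \<Rightarrow> real" where
  "fourier_multiplier m f = (THE v. continuous_on UNIV v \<and>
     represents v (dist_inv_fourier (dist_mult m (dist_fourier (dist_of f)))))"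

definition cutoff :: "(real^3 \<Rightarrow> real) \<Rightarrow> bool" where
  "cutoff chi \<longleftrightarrow> smooth chi \<and> closure {\<xi>. chi \<xi> \<noteq> 0} \<subseteq> ball 0 1 \<and> (\<forall>\<xi>. 0 \<le> chi \<xi>) \<and>
     (\<forall>\<xi> \<eta>. norm \<xi> = norm \<eta> \<longrightarrow> chi \<xi> = chi \<eta>) \<and> (\<forall>\<xi>. norm \<xi> \<le> 1/2 \<longrightarrow> chi \<xi> = 1)"

definition lam :: "int \<Rightarrow> real" where
  "lam q = 2 powr real_of_int q"

definition phi :: "(real^3 \<Rightarrow> real) \<Rightarrow> real^3 \<Rightarrow> real" where
  "phi chi \<xi> = chi ((1/2) *\<^sub>R \<xi>) - chi \<xi>"

text \<open>Only the indices $q \ge -1$ are meaningful; the value for $q < -1$ is a dummy.\<close>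
definition LP_symbol :: "(real^3 \<Rightarrow> real) \<Rightarrow> int \<Rightarrow> real^3 \<Rightarrow> real" where
  "LP_symbol chi q \<xi> =
     (if q \<ge> 0 then phi chi (inverse (lam q) *\<^sub>R \<xi>) else if q = -1 then chi \<xi> else 0)"

definition LP_block :: "(real^3 \<Rightarrow> real) \<Rightarrow> int \<Rightarrow> (real^3 \<Rightarrow> real) \<Rightarrow> real^3 \<Rightarrow> real" where
  "LP_block chi q f = fourier_multiplier (LP_symbol chi q) f"

definition LP_block_vec :: "(real^3 \<Rightarrow> real) \<Rightarrow> int \<Rightarrow> (real^3 \<Rightarrow> real^3) \<Rightarrow> real^3 \<Rightarrow> real^3" where
  "LP_block_vec chi q u x = (\<chi> j. LP_block chi q (\<lambda>y. u y $ j) x)"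

definition LP_sum :: "(real^3 \<Rightarrow> real) \<Rightarrow> int \<Rightarrow> (real^3 \<Rightarrow> real) \<Rightarrow> real^3 \<Rightarrow> real" where
  "LP_sum chi Q f x = (\<Sum>q\<in>{-1..Q}. LP_block chi q f x)"

definition L2_field :: "(real^3 \<Rightarrow> real^3) \<Rightarrow> bool" where
  "L2_field u \<longleftrightarrow> u \<in> borel_measurable lebesgue \<and> integrable lebesgue (\<lambda>x. (norm (u x))\<^sup>2)"

text \<open>In the sense of distributions.\<close>
definition divergence_free :: "(real^3 \<Rightarrow> real^3) \<Rightarrow> bool" where
  "divergence_free u \<longleftrightarrow> (\<forall>\<psi>. test_function \<psi> \<longrightarrow>
     (\<integral>x. (\<Sum>i\<in>UNIV. u x $ i * partial i \<psi> x) \<partial>lebesgue) = 0)"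

definition energy_flux :: "(real^3 \<Rightarrow> real) \<Rightarrow> int \<Rightarrow> (real^3 \<Rightarrow> real^3) \<Rightarrow> real" where
  "energy_flux chi Q u = (\<integral>x. (\<Sum>i\<in>UNIV. \<Sum>j\<in>UNIV.
     LP_sum chi Q (\<lambda>y. u y $ i * u y $ j) x * partial i (LP_sum chi Q (\<lambda>y. u y $ j)) x) \<partial>lebesgue)"

text \<open>Real powers of extended nonnegative reals; used with positive exponents $p$ only.\<close>
definition epowr :: "ennreal \<Rightarrow> real \<Rightarrow> ennreal" where
  "epowr a p = (if a = \<infinity> then \<infinity> else ennreal (enn2real a powr p))"

definition L3_norm :: "(real^3 \<Rightarrow> real^3) \<Rightarrow> ennreal" where
  "L3_norm v = epowr (\<integral>\<^sup>+x. ennreal (norm (v x) ^ 3) \<partial>lebesgue) (1/3)"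

definition d :: "(real^3 \<Rightarrow> real) \<Rightarrow> (real^3 \<Rightarrow> real^3) \<Rightarrow> int \<Rightarrow> ennreal" where
  "d chi u q = ennreal (lam q powr (1/3)) * L3_norm (LP_block_vec chi q u)"

definition K :: "int \<Rightarrow> real" where
  "K q = (if q \<le> 0 then lam q powr (2/3) else lam q powr (- 4/3))"

definition K_conv_d2 :: "(real^3 \<Rightarrow> real) \<Rightarrow> (real^3 \<Rightarrow> real^3) \<Rightarrow> int \<Rightarrow> ennreal" where
  "K_conv_d2 chi u Q = (\<Sum>\<^sub>\<infinity>q\<in>{-1..}. ennreal (K (Q - q)) * (d chi u q)\<^sup>2)"

end

theory Submission
  imports Defs "HOL-Probability.Probability"
begin

text \<open>Write \<open>u\<^sub>q\<close> for the blocks of u and split the flux, following Constantin, E and Titi, by the pointwise identity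
  \<open>S\<^sub>Q(u\<^sub>i u\<^sub>j) = r - (u - S\<^sub>Q u)\<^sub>i (u - S\<^sub>Q u)\<^sub>j + (S\<^sub>Q u)\<^sub>i (S\<^sub>Q u)\<^sub>j\<close>, where r is the kernel average of products of
  increments \<open>u(x - y) - u(x)\<close>. The last term does not contribute, since \<open>S\<^sub>Q u\<close> is divergence free. By Hoelder the other two
  are controlled by the third-power norms of increments of u, of \<open>u - S\<^sub>Q u\<close> and of the gradient of \<open>S\<^sub>Q u\<close>. Each of these has to be
  bounded by the square root of a weighted sum of \<open>\<parallel>u\<^sub>q\<parallel>\<^sup>2\<close>; the triangle inequality alone would only give a sum of norms.

  The needed embedding is proved without Calderon-Zygmund theory: the third power of the norm of the
  partial sums F is telescoped, and the first-order term \<open>\<integral>|F| F u\<^sub>q\<close> is small because the kernel reproducing \<open>u\<^sub>q\<close> has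
  mean zero and F varies only on larger scales. The blocks are convolutions with explicit rapidly decaying kernels, and
  the reproducing property of these kernels follows from Fourier inversion.\<close>

section \<open>Affine substitutions and the third-power norm\<close>

text \<open>The kernel K dictates the shape of every estimate. With a_q the L^3 norm of u_q, the
  term K(Q - q) d_q^2 is lambda_Q^(2/3) times (lambda_q / lambda_Q)^2 a_q^2 for q <= Q, and times
  a_q^2 for q >= Q. Let A^2 be the sum of these weighted squares. After Hoelder both remaining terms
  are products of three factors of sizes A, A and lambda_Q A: in an increment over a distance 1 /
  lambda_Q a block below Q enters with the factor lambda_q / lambda_Q, one above Q with a constant.
  The product lambda_Q A^3 is then exactly the right-hand side. The obstacle is that these factors
  match the weights without any margin: on neither side of Q is decay left over with which
  Cauchy-Schwarz could turn a sum of norms into a sum of squares. Orthogonality between different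
  scales has to supply the gain, for the blocks beyond Q and again for the increments of the blocks
  up to Q. Blocks are numbered from 0 in most of the proof, n = q + 1, so S_Q has index Q +
  1.\<close>

lemma lborel_nn_integral_affine:
  fixes f :: "'a::euclidean_space \<Rightarrow> ennreal"
  assumes [measurable]: "f \<in> borel_measurable borel" and c: "c \<noteq> 0"
  shows "(\<integral>\<^sup>+x. f x \<partial>lborel) = ennreal (\<bar>c\<bar> ^ DIM('a)) * (\<integral>\<^sup>+x. f (t + c *\<^sub>R x) \<partial>lborel)"
  by (subst lborel_affine[OF c, of t])
     (simp add: nn_integral_density nn_integral_distr nn_integral_cmult)

lemma lborel_integral_affine:
  fixes f :: "'a::euclidean_space \<Rightarrow> 'b::{banach, second_countable_topology}"
  assumes [measurable]: "f \<in> borel_measurable borel" and c: "c \<noteq> 0"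
  shows "(\<integral>x. f x \<partial>lborel) = (\<bar>c\<bar> ^ DIM('a)) *\<^sub>R (\<integral>x. f (t + c *\<^sub>R x) \<partial>lborel)"
  by (subst lborel_affine[OF c, of t])
     (simp add: integral_density integral_distr)

lemma lborel_integrable_affine:
  fixes f :: "'a::euclidean_space \<Rightarrow> 'b::{banach, second_countable_topology}"
  assumes f: "integrable lborel f" and c: "c \<noteq> 0"
  shows "integrable lborel (\<lambda>x. f (t + c *\<^sub>R x))"
proof -
  have [measurable]: "f \<in> borel_measurable borel"
    using f by auto
  have "ennreal (\<bar>c\<bar> ^ DIM('a)) * (\<integral>\<^sup>+x. norm (f (t + c *\<^sub>R x)) \<partial>lborel) < \<infinity>"
    using f lborel_nn_integral_affine[of "\<lambda>x. ennreal (norm (f x))" c t] c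
    by (simp add: integrable_iff_bounded)
  then show ?thesis
    using c by (auto simp: integrable_iff_bounded ennreal_mult_less_top)
qed

lemma nn_integral_shift:
  fixes f :: "'a::euclidean_space \<Rightarrow> ennreal"
  assumes "f \<in> borel_measurable borel"
  shows "(\<integral>\<^sup>+x. f (x + a) \<partial>lborel) = (\<integral>\<^sup>+x. f x \<partial>lborel)"
  using lborel_nn_integral_affine[OF assms, of 1 a] by (simp add: add.commute)

lemma lborel_integral_shift:
  fixes f :: "'a::euclidean_space \<Rightarrow> 'b::{banach, second_countable_topology}"
  assumes "f \<in> borel_measurable borel"
  shows "(\<integral>x. f (x + a) \<partial>lborel) = (\<integral>x. f x \<partial>lborel)"
  using lborel_integral_affine[OF assms, of 1 a] by (simp add: add.commute)

lemma lborel_integral_reflect: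
  fixes f :: "'a::euclidean_space \<Rightarrow> 'b::{banach, second_countable_topology}"
  assumes "f \<in> borel_measurable borel"
  shows "(\<integral>x. f (a - x) \<partial>lborel) = (\<integral>x. f x \<partial>lborel)"
  using lborel_integral_affine[OF assms, of "-1" a] by simp

lemma lborel_integrable_shift:
  fixes f :: "'a::euclidean_space \<Rightarrow> 'b::{banach, second_countable_topology}"
  assumes "integrable lborel f"
  shows "integrable lborel (\<lambda>x. f (x + a))"
  using lborel_integrable_affine[OF assms, of 1 a] by (simp add: add.commute)

lemma lborel_integrable_reflect:
  fixes f :: "'a::euclidean_space \<Rightarrow> 'b::{banach, second_countable_topology}"
  assumes "integrable lborel f"
  shows "integrable lborel (\<lambda>x. f (a - x))"
  using lborel_integrable_affine[OF assms, of "-1" a] by simp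

text \<open>Removes positivity assumptions: estimates that divide by a bound are proved for the
  bound plus e, and e is then sent to 0.\<close>

lemma ennreal_le_of_le_add_eps:
  fixes g :: "real \<Rightarrow> real"
  assumes "\<And>e. e > 0 \<Longrightarrow> X \<le> ennreal (g e)" and "isCont g 0"
  shows "X \<le> ennreal (g 0)"
proof (rule tendsto_lowerbound)
  have "(g \<longlongrightarrow> g 0) (at_right 0)"
    using assms(2) unfolding isCont_def by (rule filterlim_mono) (auto simp: at_le)
  then show "((\<lambda>e. ennreal (g e)) \<longlongrightarrow> ennreal (g 0)) (at_right 0)"
    by (rule tendsto_ennrealI)
  show "\<forall>\<^sub>F e in at_right 0. X \<le> ennreal (g e)"
    using assms(1) by (auto simp: eventually_at_right_less intro: eventually_mono[OF eventually_at_right_less])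
qed simp

text \<open>A real upper bound in place of the norm itself: comparing cubes avoids the cube root,
  and finiteness is part of the predicate.\<close>

definition L3_bound :: "'a measure \<Rightarrow> ('a \<Rightarrow> real) \<Rightarrow> real \<Rightarrow> bool" where
  "L3_bound M f a \<longleftrightarrow> f \<in> borel_measurable M \<and> 0 \<le> a \<and> (\<integral>\<^sup>+x. ennreal (\<bar>f x\<bar> ^ 3) \<partial>M) \<le> ennreal (a ^ 3)"

section \<open>Calculus of third-power bounds: domination, Hoelder, Minkowski, Fatou\<close>

lemma L3_boundD:
  assumes "L3_bound M f a"
  shows "f \<in> borel_measurable M" "0 \<le> a" "(\<integral>\<^sup>+x. ennreal (\<bar>f x\<bar> ^ 3) \<partial>M) \<le> ennreal (a ^ 3)"
  using assms by (auto simp: L3_bound_def)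

lemma L3_bound_mono: "L3_bound M f a \<Longrightarrow> a \<le> b \<Longrightarrow> L3_bound M f b"
  unfolding L3_bound_def by (meson ennreal_leI order_trans power_mono)

lemma L3_bound_dominated:
  assumes "L3_bound M g a" "f \<in> borel_measurable M" "\<And>x. \<bar>f x\<bar> \<le> \<bar>g x\<bar>"
  shows "L3_bound M f a"
proof -
  have "(\<integral>\<^sup>+x. ennreal (\<bar>f x\<bar> ^ 3) \<partial>M) \<le> (\<integral>\<^sup>+x. ennreal (\<bar>g x\<bar> ^ 3) \<partial>M)"
    using assms(3) by (intro nn_integral_mono ennreal_leI power_mono) auto
  with assms show ?thesis
    by (auto simp: L3_bound_def)
qed

lemma L3_bound_cmult:
  assumes "L3_bound M f a"
  shows "L3_bound M (\<lambda>x. c * f x) (\<bar>c\<bar> * a)"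
proof -
  note [measurable] = L3_boundD(1)[OF assms]
  have "(\<integral>\<^sup>+x. ennreal (\<bar>c * f x\<bar> ^ 3) \<partial>M) = ennreal (\<bar>c\<bar>^3) * (\<integral>\<^sup>+x. ennreal (\<bar>f x\<bar> ^ 3) \<partial>M)"
    by (subst nn_integral_cmult[symmetric]) (auto simp: abs_mult power_mult_distrib ennreal_mult)
  also have "\<dots> \<le> ennreal (\<bar>c\<bar>^3) * ennreal (a^3)"
    by (intro mult_left_mono L3_boundD(3)[OF assms]) auto
  finally show ?thesis
    using L3_boundD(2)[OF assms] by (auto simp: L3_bound_def power_mult_distrib ennreal_mult)
qed

lemma L3_bound_integrable:
  assumes "L3_bound M f a"
  shows "integrable M (\<lambda>x. \<bar>f x\<bar> ^ 3)" "(\<integral>x. \<bar>f x\<bar> ^ 3 \<partial>M) \<le> a ^ 3"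
proof -
  note [measurable] = L3_boundD(1)[OF assms]
  note b = L3_boundD(2,3)[OF assms]
  show i: "integrable M (\<lambda>x. \<bar>f x\<bar> ^ 3)"
    using b by (auto simp: integrable_iff_bounded top_unique less_top[symmetric])
  show "(\<integral>x. \<bar>f x\<bar> ^ 3 \<partial>M) \<le> a ^ 3"
    using b nn_integral_eq_integral[OF i] by auto
qed

lemma L3_boundI:
  assumes "f \<in> borel_measurable M" "0 \<le> a" "integrable M (\<lambda>x. \<bar>f x\<bar> ^ 3)" "(\<integral>x. \<bar>f x\<bar> ^ 3 \<partial>M) \<le> a ^ 3"
  shows "L3_bound M f a"
  using assms nn_integral_eq_integral[OF assms(3)] by (auto simp: L3_bound_def)

text \<open>x^3 + y^3 + z^3 - 3xyz is half of (x + y + z) times the sum of the squared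
  differences.\<close>

lemma AM_GM3: "0 \<le> x \<Longrightarrow> 0 \<le> y \<Longrightarrow> 0 \<le> z \<Longrightarrow> x * y * z \<le> (x^3 + y^3 + z^3) / (3::real)"
proof -
  assume "0 \<le> x" "0 \<le> y" "0 \<le> z"
  then have "0 \<le> (x + y + z) * ((x-y)^2 + (y-z)^2 + (z-x)^2)"
    by (intro mult_nonneg_nonneg add_nonneg_nonneg) auto
  then show ?thesis
    by (simp add: power2_eq_square power3_eq_cube algebra_simps)
qed

text \<open>Normalise each function by its bound and apply \<open>AM_GM3\<close> pointwise; each
  normalised cube has integral at most 1, hence so does the average of the three. The division
  requires positive bounds, which explains the detour through \<open>pos\<close> and a perturbation
  e.\<close>

lemma L3_Holder:
  assumes f: "L3_bound M f a" and g: "L3_bound M g b" and h: "L3_bound M h c"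
  shows "(\<integral>\<^sup>+x. ennreal (\<bar>f x\<bar> * \<bar>g x\<bar> * \<bar>h x\<bar>) \<partial>M) \<le> ennreal (a * b * c)"
proof -
  note [measurable] = L3_boundD(1)[OF f] L3_boundD(1)[OF g] L3_boundD(1)[OF h]
  have pos: "(\<integral>\<^sup>+x. ennreal (\<bar>f x\<bar> * \<bar>g x\<bar> * \<bar>h x\<bar>) \<partial>M) \<le> ennreal (a * b * c)"
    if f: "L3_bound M f a" and g: "L3_bound M g b" and h: "L3_bound M h c" and p: "a > 0" "b > 0" "c > 0"
    for a b c
  proof -
    note i = L3_bound_integrable[OF f] L3_bound_integrable[OF g] L3_bound_integrable[OF h]
    let ?R = "\<lambda>x. (a * b * c / 3) * (\<bar>f x\<bar>^3 / a^3 + \<bar>g x\<bar>^3 / b^3 + \<bar>h x\<bar>^3 / c^3)"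
    have "(\<integral>\<^sup>+x. ennreal (\<bar>f x\<bar> * \<bar>g x\<bar> * \<bar>h x\<bar>) \<partial>M) \<le> (\<integral>\<^sup>+x. ennreal (?R x) \<partial>M)"
    proof (intro nn_integral_mono ennreal_leI)
      fix x
      have "(\<bar>f x\<bar>/a) * (\<bar>g x\<bar>/b) * (\<bar>h x\<bar>/c) \<le> ((\<bar>f x\<bar>/a)^3 + (\<bar>g x\<bar>/b)^3 + (\<bar>h x\<bar>/c)^3) / 3"
        using p by (intro AM_GM3) auto
      from mult_left_mono[OF this, of "a * b * c"] p
      show "\<bar>f x\<bar> * \<bar>g x\<bar> * \<bar>h x\<bar> \<le> ?R x"
        by (simp add: power_divide)
    qed
    also have "\<dots> = ennreal (\<integral>x. ?R x \<partial>M)"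
      using i p by (intro nn_integral_eq_integral) auto
    also have "(\<integral>x. ?R x \<partial>M) = (a * b * c / 3) * ((\<integral>x. \<bar>f x\<bar>^3 \<partial>M) / a^3 + (\<integral>x. \<bar>g x\<bar>^3 \<partial>M) / b^3 + (\<integral>x. \<bar>h x\<bar>^3 \<partial>M) / c^3)"
      using i by simp
    also have "\<dots> \<le> (a * b * c / 3) * (1 + 1 + 1)"
      using i p by (intro mult_left_mono add_mono) auto
    finally show ?thesis
      using p by (simp add: ennreal_leI)
  qed
  have "(\<integral>\<^sup>+x. ennreal (\<bar>f x\<bar> * \<bar>g x\<bar> * \<bar>h x\<bar>) \<partial>M) \<le> ennreal ((\<lambda>e. (a + e) * (b + e) * (c + e)) 0)"
  proof (rule ennreal_le_of_le_add_eps)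
    fix e :: real assume "e > 0"
    then show "(\<integral>\<^sup>+x. ennreal (\<bar>f x\<bar> * \<bar>g x\<bar> * \<bar>h x\<bar>) \<partial>M) \<le> ennreal ((a + e) * (b + e) * (c + e))"
      using L3_boundD(2)[OF f] L3_boundD(2)[OF g] L3_boundD(2)[OF h]
      by (intro pos L3_bound_mono[OF f] L3_bound_mono[OF g] L3_bound_mono[OF h]) auto
  qed (intro continuous_intros)
  then show ?thesis by simp
qed

lemma L3_Holder_integrable:
  assumes f: "L3_bound M f a" and g: "L3_bound M g b" and h: "L3_bound M h c"
  shows "integrable M (\<lambda>x. f x * g x * h x)" "integrable M (\<lambda>x. \<bar>f x\<bar> * \<bar>g x\<bar> * \<bar>h x\<bar>)"
    "(\<integral>x. \<bar>f x\<bar> * \<bar>g x\<bar> * \<bar>h x\<bar> \<partial>M) \<le> a * b * c"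
proof -
  note [measurable] = L3_boundD(1)[OF f] L3_boundD(1)[OF g] L3_boundD(1)[OF h]
  note H = L3_Holder[OF f g h]
  have fin: "(\<integral>\<^sup>+x. ennreal (\<bar>f x\<bar> * \<bar>g x\<bar> * \<bar>h x\<bar>) \<partial>M) < \<infinity>"
    using H by (auto simp: top_unique less_top[symmetric])
  then show "integrable M (\<lambda>x. f x * g x * h x)"
    by (auto simp: integrable_iff_bounded abs_mult)
  show i: "integrable M (\<lambda>x. \<bar>f x\<bar> * \<bar>g x\<bar> * \<bar>h x\<bar>)"
    using fin by (auto simp: integrable_iff_bounded abs_mult)
  show "(\<integral>x. \<bar>f x\<bar> * \<bar>g x\<bar> * \<bar>h x\<bar> \<partial>M) \<le> a * b * c"
    using H nn_integral_eq_integral[OF i] L3_boundD(2)[OF f] L3_boundD(2)[OF g] L3_boundD(2)[OF h] by auto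
qed

text \<open>Minkowski from convexity of the cube: |f| + |g| is a + b times the convex combination of
  |f| / a and |g| / b with weights a / (a + b) and b / (a + b).\<close>

lemma L3_bound_add:
  assumes f: "L3_bound M f a" and g: "L3_bound M g b"
  shows "L3_bound M (\<lambda>x. f x + g x) (a + b)"
proof -
  note [measurable] = L3_boundD(1)[OF f] L3_boundD(1)[OF g]
  have pos: "(\<integral>\<^sup>+x. ennreal (\<bar>f x + g x\<bar> ^ 3) \<partial>M) \<le> ennreal ((a + b)^3)"
    if f: "L3_bound M f a" and g: "L3_bound M g b" and p: "a > 0" "b > 0" for a b
  proof -
    note i = L3_bound_integrable[OF f] L3_bound_integrable[OF g]
    let ?R = "\<lambda>x. (a + b)^2 * (\<bar>f x\<bar>^3 / a^2 + \<bar>g x\<bar>^3 / b^2)"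
    have "(\<integral>\<^sup>+x. ennreal (\<bar>f x + g x\<bar> ^ 3) \<partial>M) \<le> (\<integral>\<^sup>+x. ennreal (?R x) \<partial>M)"
    proof (intro nn_integral_mono ennreal_leI)
      fix x
      have "(\<bar>f x\<bar> + \<bar>g x\<bar>)^3 = (a+b)^3 * (a/(a+b) * (\<bar>f x\<bar>/a) + b/(a+b) * (\<bar>g x\<bar>/b)) ^ 3"
        using p by (simp add: add_divide_distrib[symmetric] power_divide)
      also have "\<dots> \<le> (a+b)^3 * (a/(a+b) * (\<bar>f x\<bar>/a)^3 + b/(a+b) * (\<bar>g x\<bar>/b)^3)"
      proof (intro mult_left_mono)
        have "1 - b/(a+b) = a/(a+b)"
          using p by (simp add: field_simps)
        then show "(a/(a+b) * (\<bar>f x\<bar>/a) + b/(a+b) * (\<bar>g x\<bar>/b)) ^ 3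
            \<le> a/(a+b) * (\<bar>f x\<bar>/a)^3 + b/(a+b) * (\<bar>g x\<bar>/b)^3"
          using p convex_onD[OF convex_power_odd, of 3 "b/(a+b)" "\<bar>f x\<bar>/a" "\<bar>g x\<bar>/b"] by simp
      qed (use p in auto)
      also have "\<dots> = ?R x"
        using p by (simp add: power_divide divide_simps) (simp add: power2_eq_square power3_eq_cube algebra_simps)
      finally show "\<bar>f x + g x\<bar>^3 \<le> ?R x"
        by (rule order_trans[rotated]) (auto intro!: power_mono)
    qed
    also have "\<dots> = ennreal (\<integral>x. ?R x \<partial>M)"
      using i p by (intro nn_integral_eq_integral) auto
    also have "(\<integral>x. ?R x \<partial>M) = (a + b)^2 * ((\<integral>x. \<bar>f x\<bar>^3 \<partial>M) / a^2 + (\<integral>x. \<bar>g x\<bar>^3 \<partial>M) / b^2)"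
      using i by simp
    also have "\<dots> \<le> (a + b)^2 * (a^3 / a^2 + b^3 / b^2)"
      using i p by (intro mult_left_mono add_mono divide_right_mono) auto
    also have "\<dots> = (a + b)^3"
      using p by (simp add: power2_eq_square power3_eq_cube)
    finally show ?thesis
      by (simp add: ennreal_leI)
  qed
  have "(\<integral>\<^sup>+x. ennreal (\<bar>f x + g x\<bar> ^ 3) \<partial>M) \<le> ennreal ((\<lambda>e. ((a + e) + (b + e))^3) 0)"
  proof (rule ennreal_le_of_le_add_eps)
    fix e :: real assume "e > 0"
    then show "(\<integral>\<^sup>+x. ennreal (\<bar>f x + g x\<bar> ^ 3) \<partial>M) \<le> ennreal (((a + e) + (b + e))^3)"
      using L3_boundD(2)[OF f] L3_boundD(2)[OF g]
      by (intro pos L3_bound_mono[OF f] L3_bound_mono[OF g]) auto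
  qed (intro continuous_intros)
  then show ?thesis
    using L3_boundD(2)[OF f] L3_boundD(2)[OF g] by (auto simp: L3_bound_def)
qed

lemma L3_bound_diff:
  assumes f: "L3_bound M f a" and g: "L3_bound M g b"
  shows "L3_bound M (\<lambda>x. f x - g x) (a + b)"
  using L3_bound_add[OF f L3_bound_cmult[OF g, of "-1"]] by simp

text \<open>Fatou's lemma. It carries bounds from partial sums to the full field and from difference
  quotients to partial derivatives.\<close>

lemma L3_bound_AE_limit:
  assumes f: "\<And>n. L3_bound M (f n) a" and g[measurable]: "g \<in> borel_measurable M"
    and lim: "AE x in M. (\<lambda>n. f n x) \<longlonglongrightarrow> g x"
  shows "L3_bound M g a"
proof -
  note [measurable] = L3_boundD(1)[OF f]
  have "(\<integral>\<^sup>+x. ennreal (\<bar>g x\<bar> ^ 3) \<partial>M) = (\<integral>\<^sup>+x. liminf (\<lambda>n. ennreal (\<bar>f n x\<bar> ^ 3)) \<partial>M)"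
  proof (rule nn_integral_cong_AE, use lim in eventually_elim)
    fix x assume "(\<lambda>n. f n x) \<longlonglongrightarrow> g x"
    then have "(\<lambda>n. ennreal (\<bar>f n x\<bar> ^ 3)) \<longlonglongrightarrow> ennreal (\<bar>g x\<bar> ^ 3)"
      by (intro tendsto_ennrealI tendsto_intros)
    then show "ennreal (\<bar>g x\<bar> ^ 3) = liminf (\<lambda>n. ennreal (\<bar>f n x\<bar> ^ 3))"
      by (rule lim_imp_Liminf[symmetric, rotated]) simp
  qed
  also have "\<dots> \<le> liminf (\<lambda>n. \<integral>\<^sup>+x. ennreal (\<bar>f n x\<bar> ^ 3) \<partial>M)"
    by (rule nn_integral_liminf) simp
  also have "\<dots> \<le> limsup (\<lambda>n. \<integral>\<^sup>+x. ennreal (\<bar>f n x\<bar> ^ 3) \<partial>M)"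
    by (rule Liminf_le_Limsup) simp
  also have "\<dots> \<le> ennreal (a ^ 3)"
    using L3_boundD(3)[OF f] by (intro Limsup_bounded) auto
  finally show ?thesis
    using L3_boundD(2)[OF f] by (simp add: L3_bound_def)
qed

lemma L3_bound_shift:
  fixes f :: "'a::euclidean_space \<Rightarrow> real"
  assumes "L3_bound lborel f a"
  shows "L3_bound lborel (\<lambda>x. f (x + y)) a"
proof -
  have [measurable]: "f \<in> borel_measurable borel"
    using L3_boundD(1)[OF assms] by simp
  show ?thesis
    using assms nn_integral_shift[of "\<lambda>x. ennreal (\<bar>f x\<bar> ^ 3)" y] by (simp add: L3_bound_def)
qed

section \<open>Square-function bound\<close>

text \<open>The Jensen step is pointwise: with \<open>t = \<bar>g x\<bar> / L\<close> the tangent-line inequality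
  \<open>3 t\<^sup>2 s \<le> 2 t\<^sup>3 + s\<^sup>3\<close> integrates to the desired bound without optimising afterwards.\<close>
lemma L3_bound_convolution:
  fixes f g H :: "'a::euclidean_space \<Rightarrow> real"
  assumes f: "L3_bound lborel f a" and H[measurable]: "H \<in> borel_measurable borel"
    and L: "L > 0" "(\<integral>\<^sup>+y. ennreal \<bar>H y\<bar> \<partial>lborel) \<le> ennreal L"
    and g[measurable]: "g \<in> borel_measurable borel"
    and gH: "\<And>x. ennreal \<bar>g x\<bar> \<le> (\<integral>\<^sup>+y. ennreal (\<bar>H y\<bar> * \<bar>f (x - y)\<bar>) \<partial>lborel)"
  shows "L3_bound lborel g (L * a)"
proof -
  have [measurable]: "f \<in> borel_measurable borel"
    using L3_boundD(1)[OF f] by simp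
  define X where "X x = (\<integral>\<^sup>+y. ennreal (\<bar>H y\<bar> * \<bar>f (x - y)\<bar> ^ 3) \<partial>lborel)" for x
  have [measurable]: "X \<in> borel_measurable borel"
    unfolding X_def by measurable
  have pt: "ennreal (\<bar>g x\<bar> ^ 3) \<le> ennreal (L^2) * X x" for x
  proof (cases "X x = \<infinity>")
    case True
    then show ?thesis using L by (simp add: ennreal_mult_top)
  next
    case False
    define t where "t = \<bar>g x\<bar> / L"
    have t: "t \<ge> 0" using L by (simp add: t_def)
    obtain r where r: "X x = ennreal r" "r \<ge> 0"
      using False by (cases "X x") auto
    have "ennreal (3 * t^2 * \<bar>g x\<bar>) = ennreal (3 * t^2) * ennreal \<bar>g x\<bar>"
      using t by (simp add: ennreal_mult)
    also have "\<dots> \<le> ennreal (3 * t^2) * (\<integral>\<^sup>+y. ennreal (\<bar>H y\<bar> * \<bar>f (x - y)\<bar>) \<partial>lborel)"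
      by (intro mult_left_mono gH) auto
    also have "\<dots> = (\<integral>\<^sup>+y. ennreal (3 * t^2 * (\<bar>H y\<bar> * \<bar>f (x - y)\<bar>)) \<partial>lborel)"
      by (subst nn_integral_cmult[symmetric]) (auto simp: ennreal_mult)
    also have "\<dots> \<le> (\<integral>\<^sup>+y. ennreal (2 * t^3) * ennreal \<bar>H y\<bar> + ennreal (\<bar>H y\<bar> * \<bar>f (x - y)\<bar> ^ 3) \<partial>lborel)"
    proof (rule nn_integral_mono)
      fix y
      have "3 * t^2 * \<bar>f (x - y)\<bar> \<le> 2 * t^3 + \<bar>f (x - y)\<bar>^3"
        using AM_GM3[OF t t, of "\<bar>f (x - y)\<bar>"] by (simp add: power2_eq_square power3_eq_cube)
      from mult_left_mono[OF this, of "\<bar>H y\<bar>"]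
      show "ennreal (3 * t^2 * (\<bar>H y\<bar> * \<bar>f (x - y)\<bar>)) \<le> ennreal (2 * t^3) * ennreal \<bar>H y\<bar> + ennreal (\<bar>H y\<bar> * \<bar>f (x - y)\<bar> ^ 3)"
        using t by (simp add: ennreal_mult[symmetric] ennreal_plus[symmetric] ennreal_leI algebra_simps del: ennreal_plus)
    qed
    also have "\<dots> = ennreal (2 * t^3) * (\<integral>\<^sup>+y. ennreal \<bar>H y\<bar> \<partial>lborel) + X x"
      by (simp add: nn_integral_add nn_integral_cmult X_def)
    also have "\<dots> \<le> ennreal (2 * t^3) * ennreal L + X x"
      by (intro add_mono mult_left_mono L) auto
    also have "\<dots> = ennreal (2 * t^3 * L + r)"
      using t L r by (simp add: ennreal_mult ennreal_plus)
    finally have "3 * t^2 * \<bar>g x\<bar> \<le> 2 * t^3 * L + r"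
      using r t L by (simp add: ennreal_plus[symmetric] del: ennreal_plus)
    \<comment> \<open>With t = |g x| / L the left side is 3 |g x|^3 / L^2 and the first term on the
      right is 2 |g x|^3 / L^2.\<close>
    then have "\<bar>g x\<bar> ^ 3 \<le> L^2 * r"
      using L by (simp add: t_def field_simps power2_eq_square power3_eq_cube)
    then show ?thesis
      using r L by (simp add: ennreal_mult[symmetric] ennreal_leI)
  qed
  have "(\<integral>\<^sup>+x. ennreal (\<bar>g x\<bar> ^ 3) \<partial>lborel) \<le> (\<integral>\<^sup>+x. ennreal (L^2) * X x \<partial>lborel)"
    by (intro nn_integral_mono pt)
  also have "\<dots> = ennreal (L^2) * (\<integral>\<^sup>+x. X x \<partial>lborel)"
    by (simp add: nn_integral_cmult)
  also have "(\<integral>\<^sup>+x. X x \<partial>lborel) = (\<integral>\<^sup>+y. \<integral>\<^sup>+x. ennreal (\<bar>H y\<bar> * \<bar>f (x - y)\<bar> ^ 3) \<partial>lborel \<partial>lborel)"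
    unfolding X_def by (rule lborel_pair.Fubini') measurable
  also have "\<dots> = (\<integral>\<^sup>+y. ennreal \<bar>H y\<bar> * (\<integral>\<^sup>+x. ennreal (\<bar>f x\<bar> ^ 3) \<partial>lborel) \<partial>lborel)"
  proof (rule nn_integral_cong)
    fix y
    have "(\<integral>\<^sup>+x. ennreal (\<bar>H y\<bar> * \<bar>f (x - y)\<bar> ^ 3) \<partial>lborel) = ennreal \<bar>H y\<bar> * (\<integral>\<^sup>+x. ennreal (\<bar>f (x - y)\<bar> ^ 3) \<partial>lborel)"
      by (subst nn_integral_cmult[symmetric]) (auto simp: ennreal_mult)
    then show "(\<integral>\<^sup>+x. ennreal (\<bar>H y\<bar> * \<bar>f (x - y)\<bar> ^ 3) \<partial>lborel) = ennreal \<bar>H y\<bar> * (\<integral>\<^sup>+x. ennreal (\<bar>f x\<bar> ^ 3) \<partial>lborel)"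
      using nn_integral_shift[of "\<lambda>x. ennreal (\<bar>f x\<bar> ^ 3)" "- y"] by simp
  qed
  also have "\<dots> = (\<integral>\<^sup>+y. ennreal \<bar>H y\<bar> \<partial>lborel) * (\<integral>\<^sup>+x. ennreal (\<bar>f x\<bar> ^ 3) \<partial>lborel)"
    by (simp add: nn_integral_multc)
  also have "\<dots> \<le> ennreal L * ennreal (a^3)"
    by (intro mult_mono L L3_boundD(3)[OF f]) auto
  finally have "(\<integral>\<^sup>+x. ennreal (\<bar>g x\<bar> ^ 3) \<partial>lborel) \<le> ennreal (L^2) * (ennreal L * ennreal (a^3))"
    by (simp add: mult_left_mono)
  also have "\<dots> = ennreal ((L * a)^3)"
    using L L3_boundD(2)[OF f]
    by (simp add: ennreal_mult[symmetric] power_mult_distrib power2_eq_square power3_eq_cube mult.assoc)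
  finally show ?thesis
    using L L3_boundD(2)[OF f] by (simp add: L3_bound_def)
qed

text \<open>For a function that is not integrable the Bochner integral is 0 by convention, so the
  bound holds for every measurable function.\<close>

lemma abs_integral_le_nn:
  fixes f :: "'a \<Rightarrow> real"
  assumes "f \<in> borel_measurable M"
  shows "ennreal \<bar>\<integral>x. f x \<partial>M\<bar> \<le> (\<integral>\<^sup>+x. ennreal \<bar>f x\<bar> \<partial>M)"
proof (cases "integrable M f")
  case True
  then show ?thesis
    using nn_integral_eq_integral[OF integrable_abs[OF True]] integral_abs_bound[of M f]
    by (simp add: ennreal_leI)
qed (simp add: not_integrable_integral_eq)

text \<open>The translation is moved onto the kernel: f(x + z) - f(x) is the integral of (H(y + z) -
  H(y)) f(x - y), and \<open>L3_bound_convolution\<close> applies. That lemma asks for a positive L,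
  whereas here L may vanish, for instance at z = 0; the bound is therefore proved for L + e.\<close>

lemma L3_bound_difference_of_convolution:
  fixes f H :: "'a::euclidean_space \<Rightarrow> real"
  assumes f: "L3_bound lborel f a" and H[measurable]: "H \<in> borel_measurable borel"
    and L: "L \<ge> 0" "(\<integral>\<^sup>+y. ennreal \<bar>H (y + z) - H y\<bar> \<partial>lborel) \<le> ennreal L"
    and int: "\<And>x. integrable lborel (\<lambda>y. H y * f (x - y))"
    and repro: "\<And>x. f x = (\<integral>y. H y * f (x - y) \<partial>lborel)"
  shows "L3_bound lborel (\<lambda>x. f (x + z) - f x) (L * a)"
proof -
  have [measurable]: "f \<in> borel_measurable borel"
    using L3_boundD(1)[OF f] by simp
  have *: "L3_bound lborel (\<lambda>x. f (x + z) - f x) ((L + e) * a)" if e: "e > 0" for e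
  proof (rule L3_bound_convolution[OF f, of "\<lambda>y. H (y + z) - H y"])
    show "L + e > 0" using e L by simp
    show "(\<integral>\<^sup>+y. ennreal \<bar>H (y + z) - H y\<bar> \<partial>lborel) \<le> ennreal (L + e)"
      using L e by (intro order_trans[OF L(2)] ennreal_leI) simp
    fix x
    have i: "integrable lborel (\<lambda>y. H (y + z) * f (x - y))"
      using lborel_integrable_shift[OF int[of "x + z"], of z] by simp
    have "f (x + z) = (\<integral>y. H (y + z) * f (x - y) \<partial>lborel)"
      using lborel_integral_shift[of "\<lambda>y. H y * f (x + z - y)" z] repro[of "x + z"] by simp
    then have "f (x + z) - f x = (\<integral>y. (H (y + z) - H y) * f (x - y) \<partial>lborel)"
      using repro[of x] int[of x] i by (simp add: left_diff_distrib)
    then show "ennreal \<bar>f (x + z) - f x\<bar> \<le> (\<integral>\<^sup>+y. ennreal (\<bar>H (y + z) - H y\<bar> * \<bar>f (x - y)\<bar>) \<partial>lborel)"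
      using abs_integral_le_nn[of "\<lambda>y. (H (y + z) - H y) * f (x - y)" lborel] by (simp add: abs_mult)
  qed measurable
  have "(\<integral>\<^sup>+x. ennreal (\<bar>f (x + z) - f x\<bar> ^ 3) \<partial>lborel) \<le> ennreal ((\<lambda>e. ((L + e) * a)^3) 0)"
    by (rule ennreal_le_of_le_add_eps) (auto intro!: continuous_intros L3_boundD(3)[OF *])
  then show ?thesis
    using L L3_boundD(2)[OF f] by (simp add: L3_bound_def)
qed

text \<open>Lipschitz estimate for s |-> |s| s, which is one third of the derivative of |s|^3 and so
  the weight of the first-order term in the cubic expansion.\<close>

lemma abs_mult_self_diff_le: "\<bar>\<bar>a\<bar> * a - \<bar>b\<bar> * b\<bar> \<le> (\<bar>a\<bar> + \<bar>b\<bar>) * \<bar>a - b::real\<bar>"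
proof -
  have "\<bar>a\<bar> * a - \<bar>b\<bar> * b = \<bar>a\<bar> * (a - b) + (\<bar>a\<bar> - \<bar>b\<bar>) * b"
    by (simp add: algebra_simps)
  also have "\<bar>\<dots>\<bar> \<le> \<bar>a\<bar> * \<bar>a - b\<bar> + \<bar>\<bar>a\<bar> - \<bar>b\<bar>\<bar> * \<bar>b\<bar>"
    by (metis abs_mult abs_abs abs_triangle_ineq)
  also have "\<dots> \<le> \<bar>a\<bar> * \<bar>a - b\<bar> + \<bar>a - b\<bar> * \<bar>b\<bar>"
    by (intro add_left_mono mult_right_mono) auto
  finally show ?thesis by (simp add: algebra_simps)
qed

text \<open>A frequency-localised f is almost orthogonal to \<open>\<bar>F\<bar> F\<close> when F has lower frequency:
  the mean-zero kernel of f is moved onto \<open>\<bar>F\<bar> F\<close>, where it produces differences of F.\<close>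
lemma first_order_term:
  fixes f F H :: "'a::euclidean_space \<Rightarrow> real"
  assumes F: "L3_bound lborel F M" and DF: "\<And>z. L3_bound lborel (\<lambda>x. F (x + z) - F x) (D * norm z)"
    and f: "L3_bound lborel f a" and H: "integrable lborel H" "(\<integral>y. H y \<partial>lborel) = 0"
    and E: "0 \<le> E" "(\<integral>\<^sup>+y. ennreal (\<bar>H y\<bar> * norm y) \<partial>lborel) \<le> ennreal E" and D: "0 \<le> D"
    and repro: "\<And>x. f x = (\<integral>y. H y * f (x - y) \<partial>lborel)"
  shows "\<bar>\<integral>x. \<bar>F x\<bar> * F x * f x \<partial>lborel\<bar> \<le> 2 * M * D * E * a"
proof -
  have [measurable]: "f \<in> borel_measurable borel" "F \<in> borel_measurable borel" "H \<in> borel_measurable borel"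
    using L3_boundD(1)[OF f] L3_boundD(1)[OF F] H by auto
  note nonneg = L3_boundD(2)[OF f] L3_boundD(2)[OF F]
  define G where "G x = \<bar>F x\<bar> * F x" for x
  have [measurable]: "G \<in> borel_measurable borel"
    unfolding G_def by measurable
  have absF: "L3_bound lborel (\<lambda>x. \<bar>F x\<bar>) M"
    by (rule L3_bound_dominated[OF F]) auto
  have Gf: "integrable lborel (\<lambda>x. G (x + z) * f x)" 
           "(\<integral>\<^sup>+x. ennreal (\<bar>G (x + z)\<bar> * \<bar>f x\<bar>) \<partial>lborel) \<le> ennreal (M * M * a)" for z
    using L3_Holder_integrable(1)[OF L3_bound_shift[OF absF] L3_bound_shift[OF F] f, of z z]
      L3_Holder[OF L3_bound_shift[OF absF] L3_bound_shift[OF F] f, of z z]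
    by (auto simp: G_def abs_mult)
  have diff: "\<bar>(\<integral>x. G (x + y) * f x \<partial>lborel) - (\<integral>x. G x * f x \<partial>lborel)\<bar> \<le> 2 * M * D * a * norm y" for y
  proof -
    have "(\<integral>x. G (x + y) * f x \<partial>lborel) - (\<integral>x. G x * f x \<partial>lborel) = (\<integral>x. (G (x + y) - G x) * f x \<partial>lborel)"
      using Gf(1)[of y] Gf(1)[of 0] by (simp add: left_diff_distrib)
    also have "\<bar>\<dots>\<bar> \<le> (\<integral>x. \<bar>(G (x + y) - G x) * f x\<bar> \<partial>lborel)"
      by (rule integral_abs_bound)
    also have "\<dots> \<le> (\<integral>x. \<bar>\<bar>F (x + y)\<bar> + \<bar>F x\<bar>\<bar> * \<bar>F (x + y) - F x\<bar> * \<bar>f x\<bar> \<partial>lborel)"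
    proof (rule integral_mono)
      show "integrable lborel (\<lambda>x. \<bar>(G (x + y) - G x) * f x\<bar>)"
        using Gf(1)[of y] Gf(1)[of 0] by (simp add: left_diff_distrib)
      show "integrable lborel (\<lambda>x. \<bar>\<bar>F (x + y)\<bar> + \<bar>F x\<bar>\<bar> * \<bar>F (x + y) - F x\<bar> * \<bar>f x\<bar>)"
        using L3_Holder_integrable(2)[OF L3_bound_add[OF L3_bound_shift[OF absF] absF] DF f] .
      show "\<bar>(G (x + y) - G x) * f x\<bar> \<le> \<bar>\<bar>F (x + y)\<bar> + \<bar>F x\<bar>\<bar> * \<bar>F (x + y) - F x\<bar> * \<bar>f x\<bar>" for x
        using abs_mult_self_diff_le[of "F (x + y)" "F x"]
        by (auto simp: abs_mult G_def intro!: mult_right_mono)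
    qed
    also have "\<dots> \<le> (M + M) * (D * norm y) * a"
      by (rule L3_Holder_integrable(3)[OF L3_bound_add[OF L3_bound_shift[OF absF] absF] DF f])
    finally show ?thesis by (simp add: algebra_simps)
  qed
  \<comment> \<open>Joint integrability for the exchange below: for each y Hoelder bounds the
    integral over x by |H y| M^2 a, and H is integrable.\<close>
  have fub: "integrable (lborel \<Otimes>\<^sub>M lborel) (\<lambda>(x, y). G x * (H y * f (x - y)))"
  proof -
    have "(\<integral>\<^sup>+y. \<integral>\<^sup>+x. ennreal (\<bar>G x\<bar> * (\<bar>H y\<bar> * \<bar>f (x - y)\<bar>)) \<partial>lborel \<partial>lborel)
        \<le> (\<integral>\<^sup>+y. ennreal \<bar>H y\<bar> * ennreal (M * M * a) \<partial>lborel)"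
    proof (rule nn_integral_mono)
      fix y
      have "(\<integral>\<^sup>+x. ennreal (\<bar>G x\<bar> * (\<bar>H y\<bar> * \<bar>f (x - y)\<bar>)) \<partial>lborel)
          = ennreal \<bar>H y\<bar> * (\<integral>\<^sup>+x. ennreal (\<bar>G x\<bar> * \<bar>f (x - y)\<bar>) \<partial>lborel)"
        by (subst nn_integral_cmult[symmetric]) (auto simp: ennreal_mult mult_ac)
      also have "(\<integral>\<^sup>+x. ennreal (\<bar>G x\<bar> * \<bar>f (x - y)\<bar>) \<partial>lborel) = (\<integral>\<^sup>+x. ennreal (\<bar>G (x + y)\<bar> * \<bar>f x\<bar>) \<partial>lborel)"
        using nn_integral_shift[of "\<lambda>x. ennreal (\<bar>G x\<bar> * \<bar>f (x - y)\<bar>)" y] by simp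
      finally show "(\<integral>\<^sup>+x. ennreal (\<bar>G x\<bar> * (\<bar>H y\<bar> * \<bar>f (x - y)\<bar>)) \<partial>lborel) \<le> ennreal \<bar>H y\<bar> * ennreal (M * M * a)"
        using Gf(2)[of y] by (simp add: mult_left_mono)
    qed
    also have "\<dots> = (\<integral>\<^sup>+y. ennreal \<bar>H y\<bar> \<partial>lborel) * ennreal (M * M * a)"
      by (simp add: nn_integral_multc)
    also have "\<dots> < \<infinity>"
      using H(1) by (auto simp: integrable_iff_bounded ennreal_mult_less_top)
    also have "(\<integral>\<^sup>+y. \<integral>\<^sup>+x. ennreal (\<bar>G x\<bar> * (\<bar>H y\<bar> * \<bar>f (x - y)\<bar>)) \<partial>lborel \<partial>lborel)
       = (\<integral>\<^sup>+x. \<integral>\<^sup>+y. ennreal (\<bar>G x\<bar> * (\<bar>H y\<bar> * \<bar>f (x - y)\<bar>)) \<partial>lborel \<partial>lborel)"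
      by (rule lborel_pair.Fubini') measurable
    also have "\<dots> = (\<integral>\<^sup>+p. ennreal (norm (case p of (x, y) \<Rightarrow> G x * (H y * f (x - y)))) \<partial>(lborel \<Otimes>\<^sub>M lborel))"
      by (subst lborel.nn_integral_fst[symmetric]) (auto simp: abs_mult)
    finally show ?thesis
      by (intro integrableI_bounded) measurable
  qed
  have "(\<integral>x. G x * f x \<partial>lborel) = (\<integral>x. (\<integral>y. G x * (H y * f (x - y)) \<partial>lborel) \<partial>lborel)"
    by (subst (1) repro) simp
  also have "\<dots> = (\<integral>y. (\<integral>x. G x * (H y * f (x - y)) \<partial>lborel) \<partial>lborel)"
    using lborel_pair.Fubini_integral[OF fub] by simp
  also have "\<dots> = (\<integral>y. H y * (\<integral>x. G (x + y) * f x \<partial>lborel) \<partial>lborel)"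
  proof (rule Bochner_Integration.integral_cong[OF refl])
    fix y
    have "(\<integral>x. G x * (H y * f (x - y)) \<partial>lborel) = H y * (\<integral>x. G x * f (x - y) \<partial>lborel)"
      by (subst integral_mult_right_zero[symmetric]) (simp add: mult_ac)
    also have "(\<integral>x. G x * f (x - y) \<partial>lborel) = (\<integral>x. G (x + y) * f x \<partial>lborel)"
      using lborel_integral_shift[of "\<lambda>x. G x * f (x - y)" y] by simp
    finally show "(\<integral>x. G x * (H y * f (x - y)) \<partial>lborel) = H y * (\<integral>x. G (x + y) * f x \<partial>lborel)" .
  qed
  finally have eq: "(\<integral>x. G x * f x \<partial>lborel) = (\<integral>y. H y * (\<integral>x. G (x + y) * f x \<partial>lborel) \<partial>lborel)" .
  have iH: "integrable lborel (\<lambda>y. H y * (\<integral>x. G (x + y) * f x \<partial>lborel))"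
  proof (rule Bochner_Integration.integrable_bound[of lborel "\<lambda>y. H y * (M * M * a)"])
    show "AE y in lborel. norm (H y * (\<integral>x. G (x + y) * f x \<partial>lborel)) \<le> norm (H y * (M * M * a))"
    proof (rule AE_I2)
      fix y
      have "ennreal \<bar>\<integral>x. G (x + y) * f x \<partial>lborel\<bar> \<le> ennreal (M * M * a)"
        using abs_integral_le_nn[of "\<lambda>x. G (x + y) * f x" lborel] Gf(2)[of y] by (simp add: abs_mult)
      then have "\<bar>\<integral>x. G (x + y) * f x \<partial>lborel\<bar> \<le> M * M * a"
        using nonneg by simp
      then show "norm (H y * (\<integral>x. G (x + y) * f x \<partial>lborel)) \<le> norm (H y * (M * M * a))"
        using nonneg by (simp add: abs_mult mult_left_mono)
    qed
  qed (use H in auto)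
  \<comment> \<open>Since H has integral 0, the value of the inner integral at y = 0 can be
    subtracted, which turns shifted integrals into differences.\<close>
  have "(\<integral>x. G x * f x \<partial>lborel) = (\<integral>y. H y * ((\<integral>x. G (x + y) * f x \<partial>lborel) - (\<integral>x. G x * f x \<partial>lborel)) \<partial>lborel)"
    using iH H by (simp add: right_diff_distrib eq[symmetric])
  also have "ennreal \<bar>\<dots>\<bar> \<le> (\<integral>\<^sup>+y. ennreal \<bar>H y * ((\<integral>x. G (x + y) * f x \<partial>lborel) - (\<integral>x. G x * f x \<partial>lborel))\<bar> \<partial>lborel)"
    by (rule abs_integral_le_nn) measurable
  also have "\<dots> \<le> (\<integral>\<^sup>+y. ennreal (2 * M * D * a) * ennreal (\<bar>H y\<bar> * norm y) \<partial>lborel)"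
  proof (rule nn_integral_mono)
    fix y
    show "ennreal \<bar>H y * ((\<integral>x. G (x + y) * f x \<partial>lborel) - (\<integral>x. G x * f x \<partial>lborel))\<bar>
        \<le> ennreal (2 * M * D * a) * ennreal (\<bar>H y\<bar> * norm y)"
      using mult_left_mono[OF diff[of y], of "\<bar>H y\<bar>"] nonneg D
      by (auto simp: ennreal_mult[symmetric] abs_mult mult_ac intro!: ennreal_leI)
  qed
  also have "\<dots> = ennreal (2 * M * D * a) * (\<integral>\<^sup>+y. ennreal (\<bar>H y\<bar> * norm y) \<partial>lborel)"
    by (simp add: nn_integral_cmult)
  also have "\<dots> \<le> ennreal (2 * M * D * a) * ennreal E"
    by (intro mult_left_mono E) auto
  also have "\<dots> = ennreal (2 * M * D * E * a)"
    using nonneg D E by (simp add: ennreal_mult[symmetric] mult_ac)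
  finally show ?thesis
    using nonneg D E by (simp add: G_def)
qed

text \<open>Expansion of the cube with the first-order term kept signed, so that its integral can
  later profit from cancellation. By symmetry a >= 0; if moreover a + b < 0, the two sides differ by
  a ((2a + 3b)^2 + 3 b^2) / 2.\<close>

lemma abs_add_cube_le: "\<bar>a + b\<bar> ^ 3 \<le> \<bar>a\<bar> ^ 3 + 3 * (\<bar>a\<bar> * a * b) + 3 * (\<bar>a\<bar> * b\<^sup>2) + \<bar>b::real\<bar> ^ 3"
proof -
  have *: "\<bar>a + b\<bar> ^ 3 \<le> \<bar>a\<bar> ^ 3 + 3 * (\<bar>a\<bar> * a * b) + 3 * (\<bar>a\<bar> * b\<^sup>2) + \<bar>b\<bar> ^ 3" if a: "a \<ge> 0" for a b :: real
  proof (cases "b \<ge> 0 \<or> a + b \<ge> 0")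
    case True
    then show ?thesis
    proof (cases "b \<ge> 0")
      case False
      then have "b ^ 3 \<le> 0" by (simp add: power3_eq_cube mult_nonneg_nonpos mult_nonpos_nonpos)
      then show ?thesis using a True False by (simp add: power2_eq_square power3_eq_cube algebra_simps)
    qed (use a in \<open>simp add: power2_eq_square power3_eq_cube algebra_simps\<close>)
  next
    case False
    have "0 \<le> a * ((2*a + 3*b)^2 + 3 * b^2) / 2"
      using a by simp
    then show ?thesis
      using False a by (simp add: power2_eq_square power3_eq_cube algebra_simps)
  qed
  show ?thesis
  proof (cases "a \<ge> 0")
    case False
    have "\<bar>- a + - b\<bar> = \<bar>a + b\<bar>"
      by (metis abs_minus_cancel minus_add_distrib)
    then show ?thesis using False *[of "-a" "-b"] by simp
  qed (rule *)
qed


text \<open>The embedding of the Besov space with indices 0, 3, 2 into the third-power integrable functions. In the proof,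
  \<open>b n = (\<Sum>k\<le>n. 2 ^ k * a k) / 2 ^ (n + 1)\<close> controls the increments of the partial sum \<open>F n\<close>, and carrying
  \<open>b\<^sup>2\<close> in the induction absorbs the first-order terms.\<close>
lemma square_function_bound:
  fixes f H :: "nat \<Rightarrow> 'a::euclidean_space \<Rightarrow> real" and B \<mu> :: real
  assumes f: "\<And>n. L3_bound lborel (f n) (a n)"
    and H: "\<And>n. integrable lborel (H n)" "\<And>n. n > 0 \<Longrightarrow> (\<integral>y. H n y \<partial>lborel) = 0"
    and B: "0 \<le> B" and \<mu>: "0 < \<mu>"
    and moment: "\<And>n. n > 0 \<Longrightarrow> (\<integral>\<^sup>+y. ennreal (\<bar>H n y\<bar> * norm y) \<partial>lborel) \<le> ennreal (B / (\<mu> * 2 ^ n))"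
    and diff: "\<And>n z. (\<integral>\<^sup>+y. ennreal \<bar>H n (y + z) - H n y\<bar> \<partial>lborel) \<le> ennreal (B * \<mu> * 2 ^ n * norm z)"
    and int: "\<And>n x. integrable lborel (\<lambda>y. H n y * f n (x - y))"
    and repro: "\<And>n x. f n x = (\<integral>y. H n y * f n (x - y) \<partial>lborel)"
  shows "L3_bound lborel (\<lambda>x. \<Sum>n\<le>N. f n x) ((6 * B\<^sup>2 + 4) * sqrt (\<Sum>n\<le>N. (a n)\<^sup>2))"
proof -
  define S where "S = sqrt (\<Sum>n\<le>N. (a n)\<^sup>2)"
  \<comment> \<open>This R satisfies 6 R B^2 + 3 R + 1 <= R^2, which is what closing the induction
    through \<open>WR\<close> requires.\<close>
  define R where "R = 6 * B\<^sup>2 + 4"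
  define F where "F n x = (\<Sum>k\<le>n. f k x)" for n x
  define b where "b = rec_nat (a 0 / 2) (\<lambda>n r. (r + a (Suc n)) / 2)"
  have b0: "b 0 = a 0 / 2" and bS: "b (Suc n) = (b n + a (Suc n)) / 2" for n
    by (simp_all add: b_def)
  have a0: "0 \<le> a n" for n using L3_boundD(2)[OF f] .
  have b_nn: "0 \<le> b n" for n
    by (induction n) (auto simp: b0 bS a0)
  have S0: "0 \<le> S" by (simp add: S_def sum_nonneg)
  have R4: "R \<ge> 4" by (simp add: R_def)
  have aS: "a n \<le> S" if "n \<le> N" for n
    unfolding S_def using that a0 by (intro real_le_rsqrt member_le_sum) auto
  \<comment> \<open>2^(n+1) b(n) is the sum of 2^k a(k) over k <= n, so this is the triangle
    inequality over the increments of the single functions.\<close>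
  have DF: "L3_bound lborel (\<lambda>x. F n (x + z) - F n x) (B * \<mu> * 2 ^ (Suc n) * b n * norm z)" for n z
  proof (induction n)
    case 0
    show ?case
      using L3_bound_difference_of_convolution[OF f[of 0] _ _ diff[of 0 z] int repro] H(1)[of 0] B \<mu>
      by (auto simp: F_def b0 mult_ac)
  next
    case (Suc n)
    have "L3_bound lborel (\<lambda>x. f (Suc n) (x + z) - f (Suc n) x) (B * \<mu> * 2 ^ Suc n * norm z * a (Suc n))"
      using L3_bound_difference_of_convolution[OF f[of "Suc n"] _ _ diff[of "Suc n" z] int repro] H(1)[of "Suc n"] B \<mu>
      by auto
    from L3_bound_add[OF Suc.IH this] show ?case
      by (simp add: F_def bS algebra_simps add_divide_distrib)
  qed
  define I where "I n = (\<integral>x. \<bar>F n x\<bar> ^ 3 \<partial>lborel)" for n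
  \<comment> \<open>Three times the first-order term will be at most \<open>\<kappa>\<close> times
    b(n)^2 + a(n+1)^2. W adds up all coefficients with which a(n+1)^2 occurs in one step;
    \<open>\<kappa>\<close> occurs twice, once for that term and once for the growth of b.\<close>
  define \<kappa> where "\<kappa> = 3 * R * S * B\<^sup>2"
  define W where "W = 2 * \<kappa> + 3 * R * S + S"
  have \<kappa>0: "\<kappa> \<ge> 0" and W0: "W \<ge> 0"
    using S0 R4 by (auto simp: \<kappa>_def W_def)
  have WR: "W * S\<^sup>2 \<le> (R * S) ^ 3"
  proof -
    have "6 * R * B\<^sup>2 + 3 * R + 1 \<le> R * R"
      using R4 by (simp add: R_def algebra_simps)
    also have "\<dots> \<le> R * R * R"
      using R4 mult_left_mono[of 1 R "R * R"] by simp
    finally have "(6 * R * B\<^sup>2 + 3 * R + 1) * S^3 \<le> R * R * R * S^3"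
      using S0 by (intro mult_right_mono) auto
    then show ?thesis
      by (simp add: W_def \<kappa>_def power2_eq_square power3_eq_cube algebra_simps)
  qed
  have Sn: "(\<Sum>k\<le>n. (a k)\<^sup>2) \<le> S\<^sup>2" if "n \<le> N" for n
    unfolding S_def using that by (auto simp: sum_nonneg intro!: sum_mono2)
  \<comment> \<open>The bound R S on the norm of F n is carried along because the error terms of the
    next step are estimated with it; the bound on the integral gives it back through
    \<open>WR\<close>.\<close>
  have inv: "I n + 2 * \<kappa> * (b n)\<^sup>2 \<le> W * (\<Sum>k\<le>n. (a k)\<^sup>2) \<and> L3_bound lborel (F n) (R * S)" if "n \<le> N" for n
    using that
  proof (induction n)
    case 0
    have F0: "F 0 = f 0" by (simp add: F_def fun_eq_iff)
    have "I 0 \<le> a 0 ^ 3"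
      unfolding I_def F0 by (rule L3_bound_integrable[OF f])
    also have "\<dots> \<le> S * (a 0)\<^sup>2"
      using mult_right_mono[OF aS[of 0], of "(a 0)\<^sup>2"] by (simp add: power2_eq_square power3_eq_cube mult.assoc)
    also have "S * (a 0)\<^sup>2 + 2 * \<kappa> * (b 0)\<^sup>2 \<le> W * (a 0)\<^sup>2"
      using \<kappa>0 S0 R4 unfolding b0 W_def by (simp add: algebra_simps power2_eq_square)
    finally have "I 0 + 2 * \<kappa> * (b 0)\<^sup>2 \<le> W * (a 0)\<^sup>2" by simp
    moreover have "a 0 \<le> R * S"
      using aS[of 0] R4 S0 mult_right_mono[of 1 R S] by simp
    ultimately show ?case
      using L3_bound_mono[OF f[of 0]] by (simp add: F0)
  next
    case (Suc n)
    let ?A = "a (Suc n)" and ?f = "f (Suc n)"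
    from Suc have IH: "I n + 2 * \<kappa> * (b n)\<^sup>2 \<le> W * (\<Sum>k\<le>n. (a k)\<^sup>2)" and M: "L3_bound lborel (F n) (R * S)"
      by auto
    have FS: "F (Suc n) x = F n x + ?f x" for x by (simp add: F_def)
    have Fb: "L3_bound lborel (F (Suc n)) (R * S + ?A)"
      unfolding FS[abs_def] by (rule L3_bound_add[OF M f])
    have M': "L3_bound lborel (\<lambda>x. \<bar>F n x\<bar>) (R * S)"
      using L3_boundD(1)[OF M] by (intro L3_bound_dominated[OF M]) auto
    \<comment> \<open>The increments of F n grow like 2^(n+1) and the first moment of the kernel
      decays like 2^-(n+1), so \<open>\<mu>\<close> and the powers of 2 cancel.\<close>
    have first: "\<bar>\<integral>x. \<bar>F n x\<bar> * F n x * ?f x \<partial>lborel\<bar> \<le> 2 * (R * S) * (B * \<mu> * 2 ^ (Suc n) * b n) * (B / (\<mu> * 2 ^ Suc n)) * ?A"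
      using B \<mu> b_nn[of n]
      by (intro first_order_term[OF M DF f H(1) H(2) _ moment _ repro]) auto
    also have "\<dots> = 2 * R * S * B\<^sup>2 * (b n * ?A)"
      using \<mu> by (simp add: power2_eq_square)
    also have "\<dots> \<le> 2 * R * S * B\<^sup>2 * (((b n)\<^sup>2 + ?A\<^sup>2) / 2)"
      using S0 R4 sum_squares_bound[of "b n" ?A] by (intro mult_left_mono) (auto simp: algebra_simps)
    finally have first: "3 * (\<integral>x. \<bar>F n x\<bar> * F n x * ?f x \<partial>lborel) \<le> \<kappa> * ((b n)\<^sup>2 + ?A\<^sup>2)"
      by (simp add: \<kappa>_def)
    note i = L3_bound_integrable[OF Fb] L3_bound_integrable[OF M] L3_bound_integrable[OF f[of "Suc n"]]
      L3_Holder_integrable[OF M' M f[of "Suc n"]] L3_Holder_integrable[OF M' f[of "Suc n"] f[of "Suc n"]]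
    have "I (Suc n) \<le> (\<integral>x. \<bar>F n x\<bar> ^ 3 + 3 * (\<bar>F n x\<bar> * F n x * ?f x) + 3 * (\<bar>\<bar>F n x\<bar>\<bar> * \<bar>?f x\<bar> * \<bar>?f x\<bar>) + \<bar>?f x\<bar> ^ 3 \<partial>lborel)"
      unfolding I_def
    proof (rule integral_mono)
      show "\<bar>F (Suc n) x\<bar> ^ 3 \<le> \<bar>F n x\<bar> ^ 3 + 3 * (\<bar>F n x\<bar> * F n x * ?f x) + 3 * (\<bar>\<bar>F n x\<bar>\<bar> * \<bar>?f x\<bar> * \<bar>?f x\<bar>) + \<bar>?f x\<bar> ^ 3" for x
        using abs_add_cube_le[of "F n x" "?f x"] by (simp add: FS power2_eq_square mult.assoc)
    qed (intro i Bochner_Integration.integrable_add integrable_mult_right)+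
    also have "\<dots> = I n + 3 * (\<integral>x. \<bar>F n x\<bar> * F n x * ?f x \<partial>lborel) + 3 * (\<integral>x. \<bar>\<bar>F n x\<bar>\<bar> * \<bar>?f x\<bar> * \<bar>?f x\<bar> \<partial>lborel) + (\<integral>x. \<bar>?f x\<bar> ^ 3 \<partial>lborel)"
      unfolding I_def using i by (simp del: abs_abs abs_mult_self_eq)
    also have "\<dots> \<le> I n + \<kappa> * ((b n)\<^sup>2 + ?A\<^sup>2) + 3 * (R * S * ?A * ?A) + ?A ^ 3"
      by (intro add_mono mult_left_mono i first) auto
    also have "?A ^ 3 \<le> S * ?A\<^sup>2"
      using mult_right_mono[OF aS[of "Suc n"], of "?A\<^sup>2"] Suc.prems by (simp add: power2_eq_square power3_eq_cube mult.assoc)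
    finally have step: "I (Suc n) \<le> I n + \<kappa> * ((b n)\<^sup>2 + ?A\<^sup>2) + 3 * R * S * ?A\<^sup>2 + S * ?A\<^sup>2"
      by (simp add: power2_eq_square mult_ac)
    \<comment> \<open>The factor 1/2 in the recursion for b leaves half of the stored 2
      \<open>\<kappa>\<close> b(n)^2 free to pay for the first-order term.\<close>
    have "2 * (b (Suc n))\<^sup>2 \<le> (b n)\<^sup>2 + ?A\<^sup>2"
      using sum_squares_bound[of "b n" ?A] unfolding bS by (simp add: power2_eq_square field_simps)
    then have "2 * \<kappa> * (b (Suc n))\<^sup>2 \<le> \<kappa> * ((b n)\<^sup>2 + ?A\<^sup>2)"
      using mult_left_mono[OF _ \<kappa>0] by fastforce
    with step have "I (Suc n) + 2 * \<kappa> * (b (Suc n))\<^sup>2 \<le> (I n + 2 * \<kappa> * (b n)\<^sup>2) + W * ?A\<^sup>2"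
      by (simp add: W_def algebra_simps)
    also have "\<dots> \<le> W * (\<Sum>k\<le>Suc n. (a k)\<^sup>2)"
      using IH by (simp add: algebra_simps)
    finally have 1: "I (Suc n) + 2 * \<kappa> * (b (Suc n))\<^sup>2 \<le> W * (\<Sum>k\<le>Suc n. (a k)\<^sup>2)" .
    have "I (Suc n) \<le> W * (\<Sum>k\<le>Suc n. (a k)\<^sup>2)"
      using 1 \<kappa>0 by (smt (verit) mult_nonneg_nonneg zero_le_power2)
    also have "\<dots> \<le> W * S\<^sup>2"
      using Sn[OF Suc.prems] W0 by (rule mult_left_mono)
    finally have "I (Suc n) \<le> (R * S) ^ 3" using WR by simp
    then have "L3_bound lborel (F (Suc n)) (R * S)"
      using i R4 S0 L3_boundD(1)[OF Fb] by (intro L3_boundI) (auto simp: I_def)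
    with 1 show ?case by simp
  qed
  from inv[of N] show ?thesis
    by (simp add: F_def[abs_def] R_def S_def)
qed

section \<open>Smooth functions and partial derivatives\<close>

text \<open>Dyadic decomposition: where 2^n <= 1 + |x| < 2^(n+1), the integrand is at most 2^(-nk),
  and such points lie in a ball of volume of order 2^(nD), D being the dimension. As k > D, the
  products are summable.\<close>

lemma integrable_inverse_norm_power:
  fixes k :: nat
  assumes k: "DIM('a::euclidean_space) < k"
  shows "integrable lborel (\<lambda>x::'a. 1 / (1 + norm x) ^ k)"
proof (rule integrableI_bounded)
  let ?D = "DIM('a)"
  let ?V = "unit_ball_vol ?D"
  have pt: "ennreal (norm (1 / (1 + norm x) ^ k)) \<le> (\<Sum>n. ennreal (1 / 2^(n * k)) * indicator (ball 0 (2 ^ Suc n)) x)" for x :: 'a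
  proof -
    define n where "n = (LEAST n. 1 + norm x < 2 ^ Suc n)"
    obtain m where "1 + norm x < 2 ^ m"
      using real_arch_pow[of 2 "1 + norm x"] by auto
    then have "1 + norm x < 2 ^ Suc m"
      using power_increasing[of m "Suc m" "2::real"] by linarith
    then have n: "1 + norm x < 2 ^ Suc n"
      unfolding n_def by (rule LeastI)
    have lower: "2 ^ n \<le> 1 + norm x"
    proof (cases n)
      case (Suc j)
      then have "\<not> 1 + norm x < 2 ^ Suc j"
        using not_less_Least[of j "\<lambda>n. 1 + norm x < 2 ^ Suc n"] by (simp add: n_def)
      then show ?thesis using Suc by simp
    qed simp
    have "1 / (1 + norm x) ^ k \<le> 1 / 2 ^ (n * k)"
      unfolding power_mult using lower by (intro divide_left_mono power_mono mult_pos_pos zero_less_power) (auto intro: add_pos_nonneg)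
    then have "ennreal (norm (1 / (1 + norm x) ^ k)) \<le> ennreal (1 / 2^(n * k)) * indicator (ball 0 (2 ^ Suc n)) x"
      using n by (auto simp: ennreal_leI)
    also have "\<dots> = (\<Sum>i\<in>{n}. ennreal (1 / 2^(i * k)) * indicator (ball 0 (2 ^ Suc i)) x)"
      by (simp only: sum.insert sum.empty finite.emptyI empty_iff add_0_right not_False_eq_True)
    also have "\<dots> \<le> (\<Sum>i. ennreal (1 / 2^(i * k)) * indicator (ball 0 (2 ^ Suc i)) x)"
      by (intro sum_le_suminf) auto
    finally show ?thesis .
  qed
  have "(\<integral>\<^sup>+(x::'a). ennreal (norm (1 / (1 + norm x) ^ k)) \<partial>lborel)
      \<le> (\<integral>\<^sup>+(x::'a). (\<Sum>n. ennreal (1 / 2^(n * k)) * indicator (ball 0 (2 ^ Suc n)) x) \<partial>lborel)"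
    by (intro nn_integral_mono pt)
  also have "\<dots> = (\<Sum>n. ennreal (1 / 2^(n * k)) * emeasure lborel (ball (0::'a) (2 ^ Suc n)))"
  proof (subst nn_integral_suminf)
    show "(\<Sum>n. \<integral>\<^sup>+x\<in>ball (0::'a) (2 ^ Suc n). ennreal (1 / 2^(n * k)) \<partial>lborel)
        = (\<Sum>n. ennreal (1 / 2^(n * k)) * emeasure lborel (ball (0::'a) (2 ^ Suc n)))"
      by (intro suminf_cong nn_integral_cmult_indicator) simp
  qed (auto intro!: borel_measurable_times_ennreal borel_measurable_indicator)
  also have "\<dots> \<le> (\<Sum>n. ennreal (?V * 2 ^ ?D * (1/2) ^ n))"
  proof (intro suminf_le summableI)
    fix n
    have "ennreal (1 / 2^(n * k)) * emeasure lborel (ball (0::'a) (2 ^ Suc n)) = ennreal (1 / 2^(n * k) * (?V * (2 ^ Suc n) ^ ?D))"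
      by (subst emeasure_ball) (auto simp: ennreal_mult[symmetric])
    also have "(1 / 2^(n * k) * (?V * (2 ^ Suc n) ^ ?D) :: real) = ?V * 2 ^ ?D * (2 ^ (n * ?D) / 2 ^ (n * k))"
      by (simp add: power_mult power_mult_distrib)
    also have "\<dots> \<le> ?V * 2 ^ ?D * (1/2)^n"
    proof (intro mult_left_mono)
      have "n + n * ?D \<le> n * k"
        using k mult_le_mono2[of "Suc ?D" k n] by simp
      then have "(2::real) ^ (n + n * ?D) \<le> 2 ^ (n * k)"
        by (intro power_increasing) auto
      then show "(2::real) ^ (n * ?D) / 2 ^ (n * k) \<le> (1/2)^n"
        by (simp add: power_add field_simps)
    qed auto
    finally show "ennreal (1 / 2^(n * k)) * emeasure lborel (ball (0::'a) (2 ^ Suc n)) \<le> ennreal (?V * 2 ^ ?D * (1/2) ^ n)"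
      by (simp add: ennreal_leI)
  qed
  also have "\<dots> = ennreal (\<Sum>n. ?V * 2 ^ ?D * (1/2) ^ n)"
    by (intro suminf_ennreal2 summable_mult summable_geometric) auto
  finally show "(\<integral>\<^sup>+(x::'a). ennreal (norm (1 / (1 + norm x) ^ k)) \<partial>lborel) < \<infinity>"
    by (auto simp: top_unique less_top[symmetric])
qed measurable

section \<open>Partial derivatives and closure properties of smooth functions\<close>

lemma partial_eq:
  "(f has_derivative D) (at x) \<Longrightarrow> partial i f x = D (axis i 1)"
  unfolding partial_def by (metis frechet_derivative_at)

lemma has_derivative_partial:
  fixes f :: "real^3 \<Rightarrow> 'b::real_normed_vector"
  assumes "f differentiable (at x)"
  shows "(f has_derivative (\<lambda>v. \<Sum>i\<in>UNIV. v $ i *\<^sub>R partial i f x)) (at x)"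
proof -
  define D where "D = frechet_derivative f (at x)"
  have D: "(f has_derivative D) (at x)"
    using assms by (simp add: D_def frechet_derivative_works)
  then have lin: "linear D" by (simp add: has_derivative_linear)
  have "D v = (\<Sum>i\<in>UNIV. v $ i *\<^sub>R partial i f x)" for v
  proof -
    have "v = (\<Sum>i\<in>UNIV. v $ i *\<^sub>R axis i 1)"
      by (simp add: vec_eq_iff axis_def if_distrib[of "\<lambda>x. _ * x"] cong: if_cong)
    then have "D v = D (\<Sum>i\<in>UNIV. v $ i *\<^sub>R axis i 1)" by simp
    also have "\<dots> = (\<Sum>i\<in>UNIV. v $ i *\<^sub>R partial i f x)"
      unfolding partial_def D_def[symmetric] by (simp add: linear_sum[OF lin] linear_scale[OF lin])
    finally show ?thesis .
  qed
  then have "D = (\<lambda>v. \<Sum>i\<in>UNIV. v $ i *\<^sub>R partial i f x)" by (rule ext)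
  then show ?thesis using D by simp
qed

text \<open>Spares explicit formulas for iterated derivatives: any class of differentiable functions
  that is stable under \<open>partial\<close> consists of smooth functions.\<close>

lemma smooth_coinduct:
  assumes "P f" and "\<And>g. P g \<Longrightarrow> \<forall>x. g differentiable (at x)" and "\<And>g i. P g \<Longrightarrow> P (partial i g)"
  shows "smooth f"
proof -
  have "P (partials is f)" for "is"
    by (induction "is") (auto simp: partials_def assms)
  then show ?thesis by (auto simp: smooth_def assms)
qed

text \<open>The recursion of \<open>partials\<close> strips the outermost derivative; this strips
  the innermost one, which is what passing from f to \<open>partial i f\<close> needs.\<close>

lemma partials_snoc: "partials (is @ [i]) f = partials is (partial i f)"
  by (simp add: partials_def)

lemma partials_Nil [simp]: "partials [] f = f" and partials_Cons: "partials (i # is) f = partial i (partials is f)"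
  by (simp_all add: partials_def)

lemma smooth_partial: "smooth f \<Longrightarrow> smooth (partial i f)"
  by (metis partials_snoc smooth_def)

lemma smooth_partials: "smooth f \<Longrightarrow> smooth (partials is f)"
  by (induction "is") (auto simp: partials_Cons smooth_partial)

lemma smooth_differentiable: "smooth f \<Longrightarrow> f differentiable (at x)"
  by (metis partials_Nil smooth_def)

lemma smooth_continuous: "smooth f \<Longrightarrow> continuous_on UNIV f"
  by (metis continuous_at_imp_continuous_on differentiable_imp_continuous_within smooth_differentiable)

lemma partial_bounded_linear:
  assumes "bounded_linear L" "f differentiable (at x)"
  shows "partial i (\<lambda>x. L (f x)) x = L (partial i f x)"
proof -
  have "((\<lambda>x. L (f x)) has_derivative (\<lambda>v. L (frechet_derivative f (at x) v))) (at x)"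
    using bounded_linear.has_derivative[OF assms(1)] assms(2) by (simp add: frechet_derivative_works)
  from partial_eq[OF this] show ?thesis by (simp add: partial_def)
qed

lemma partials_bounded_linear:
  assumes "bounded_linear L" "smooth f"
  shows "partials is (\<lambda>x. L (f x)) = (\<lambda>x. L (partials is f x))"
proof (induction "is")
  case (Cons i "is")
  show ?case
    unfolding partials_Cons Cons fun_eq_iff
    using partial_bounded_linear[OF assms(1) smooth_differentiable[OF smooth_partials[OF assms(2)]]] by blast
qed simp

lemma smooth_bounded_linear:
  assumes "bounded_linear L" "smooth f"
  shows "smooth (\<lambda>x. L (f x))"
proof -
  have "(\<lambda>x. L (partials is f x)) differentiable (at x)" for "is" x
    using differentiable_chain_at[of "partials is f" x L] bounded_linear_imp_differentiable[OF assms(1)]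
      smooth_differentiable[OF smooth_partials[OF assms(2)]] by (simp add: o_def)
  then show ?thesis
    by (simp add: smooth_def partials_bounded_linear[OF assms])
qed

lemma partial_affine:
  assumes "f differentiable (at (t + c *\<^sub>R x))"
  shows "partial i (\<lambda>x. f (t + c *\<^sub>R x)) x = c *\<^sub>R partial i f (t + c *\<^sub>R x)"
proof -
  have D: "(f has_derivative frechet_derivative f (at (t + c *\<^sub>R x))) (at (t + c *\<^sub>R x))"
    using assms by (simp add: frechet_derivative_works)
  have "((\<lambda>x. f (t + c *\<^sub>R x)) has_derivative (\<lambda>v. frechet_derivative f (at (t + c *\<^sub>R x)) (c *\<^sub>R v))) (at x)"
    by (rule has_derivative_compose[where f="\<lambda>x. t + c *\<^sub>R x" and g=f, OF _ D]) (auto intro!: derivative_eq_intros)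
  from partial_eq[OF this] show ?thesis
    using has_derivative_linear[OF D] by (simp add: partial_def linear_scale)
qed

lemma partials_affine:
  assumes "smooth f"
  shows "partials is (\<lambda>x. f (t + c *\<^sub>R x)) = (\<lambda>x. c ^ length is *\<^sub>R partials is f (t + c *\<^sub>R x))"
proof (induction "is")
  case (Cons i "is")
  let ?g = "partials is f"
  have g: "?g differentiable (at y)" for y
    by (rule smooth_differentiable[OF smooth_partials[OF assms]])
  have "(\<lambda>x. ?g (t + c *\<^sub>R x)) differentiable (at x)" for x
    using differentiable_chain_at[of "\<lambda>x. t + c *\<^sub>R x" x ?g] g by (simp add: o_def)
  from partial_bounded_linear[OF bounded_linear_scaleR_right this, of i "c ^ length is"]
  show ?case
    unfolding partials_Cons Cons fun_eq_iff by (simp add: partial_affine[OF g])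
qed simp

lemma smooth_affine:
  assumes "smooth f"
  shows "smooth (\<lambda>x. f (t + c *\<^sub>R x))"
proof -
  have "(\<lambda>x. partials is f (t + c *\<^sub>R x)) differentiable (at x)" for "is" x
    using differentiable_chain_at[of "\<lambda>x. t + c *\<^sub>R x" x "partials is f"]
      smooth_differentiable[OF smooth_partials[OF assms]] by (simp add: o_def)
  then show ?thesis
    unfolding smooth_def partials_affine[OF assms] by (auto intro!: derivative_intros)
qed

lemma partial_add:
  assumes "f differentiable (at x)" "g differentiable (at x)"
  shows "partial i (\<lambda>x. f x + g x) x = partial i f x + partial i g x"
  using partial_eq[OF has_derivative_add] assms by (simp add: partial_def frechet_derivative_works)

lemma partial_diff:
  assumes "f differentiable (at x)" "g differentiable (at x)"
  shows "partial i (\<lambda>x. f x - g x) x = partial i f x - partial i g x"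
  using partial_eq[OF has_derivative_diff] assms by (simp add: partial_def frechet_derivative_works)

lemma partial_mult:
  fixes f g :: "real^3 \<Rightarrow> 'b::real_normed_algebra"
  assumes "f differentiable (at x)" "g differentiable (at x)"
  shows "partial i (\<lambda>x. f x * g x) x = f x * partial i g x + partial i f x * g x"
  using partial_eq[OF has_derivative_mult] assms by (simp add: partial_def frechet_derivative_works)

lemma partials_diff:
  assumes "smooth f" "smooth g"
  shows "partials is (\<lambda>x. f x - g x) = (\<lambda>x. partials is f x - partials is g x)"
proof (induction "is")
  case (Cons i "is")
  then show ?case
    unfolding partials_Cons Cons fun_eq_iff
    by (simp add: partial_diff smooth_differentiable smooth_partials assms)
qed simp

lemma smooth_diff:
  assumes "smooth f" "smooth g"
  shows "smooth (\<lambda>x. f x - g x)"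
  unfolding smooth_def partials_diff[OF assms]
  by (intro allI differentiable_diff smooth_differentiable smooth_partials assms)

text \<open>The class generated by the smooth functions under sums and products. By the Leibniz rule
  it is stable under \<open>partial\<close>, so \<open>smooth_coinduct\<close> yields smoothness of
  products.\<close>

inductive smooth_algebra :: "(real^3 \<Rightarrow> 'b::real_normed_algebra) \<Rightarrow> bool" where
  base: "smooth f \<Longrightarrow> smooth_algebra f"
| add: "smooth_algebra f \<Longrightarrow> smooth_algebra g \<Longrightarrow> smooth_algebra (\<lambda>x. f x + g x)"
| mult: "smooth_algebra f \<Longrightarrow> smooth_algebra g \<Longrightarrow> smooth_algebra (\<lambda>x. f x * g x)"

lemma smooth_algebra_differentiable: "smooth_algebra f \<Longrightarrow> f differentiable (at x)"
  by (induction rule: smooth_algebra.induct) (auto intro: smooth_differentiable)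

lemma smooth_algebra_partial: "smooth_algebra f \<Longrightarrow> smooth_algebra (partial i f)"
proof (induction rule: smooth_algebra.induct)
  case (add f g)
  then have "partial i (\<lambda>x. f x + g x) = (\<lambda>x. partial i f x + partial i g x)"
    by (simp add: fun_eq_iff partial_add smooth_algebra_differentiable)
  then show ?case using add by (simp add: smooth_algebra.add)
next
  case (mult f g)
  then have "partial i (\<lambda>x. f x * g x) = (\<lambda>x. f x * partial i g x + partial i f x * g x)"
    by (simp add: fun_eq_iff partial_mult smooth_algebra_differentiable)
  then show ?case using mult by (simp add: smooth_algebra.add smooth_algebra.mult)
qed (auto intro: smooth_algebra.base smooth_partial)

lemma smooth_mult:
  fixes f g :: "real^3 \<Rightarrow> 'b::real_normed_algebra"
  assumes "smooth f" "smooth g"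
  shows "smooth (\<lambda>x. f x * g x)"
  by (rule smooth_coinduct[of smooth_algebra])
    (use assms in \<open>auto intro: smooth_algebra.intros smooth_algebra_partial smooth_algebra_differentiable\<close>)

lemma smooth_const: "smooth (\<lambda>x. c)"
proof (rule smooth_coinduct[of "\<lambda>f. \<exists>c. f = (\<lambda>x. c)"])
  fix g :: "real^3 \<Rightarrow> 'a" and i assume "\<exists>c. g = (\<lambda>x. c)"
  then show "\<exists>c. partial i g = (\<lambda>x. c)"
    by (auto simp: fun_eq_iff[of "partial i _"] partial_eq[OF has_derivative_const])
qed auto

lemma smooth_linear:
  assumes L: "bounded_linear L"
  shows "smooth L"
proof (rule smooth_coinduct[of "\<lambda>f. f = L \<or> smooth f"])
  fix g i assume "g = L \<or> smooth g"
  moreover have "partial i L = (\<lambda>x. L (axis i 1))"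
    by (auto simp: fun_eq_iff partial_eq[OF bounded_linear_imp_has_derivative[OF L]])
  ultimately show "partial i g = L \<or> smooth (partial i g)"
    by (auto simp: smooth_const smooth_partial)
qed (use L in \<open>auto simp: smooth_differentiable bounded_linear_imp_differentiable\<close>)

definition bounded_support :: "('a::real_normed_vector \<Rightarrow> 'b::zero) \<Rightarrow> bool" where
  "bounded_support f \<longleftrightarrow> (\<exists>R>0. \<forall>x. norm x \<ge> R \<longrightarrow> f x = 0)"

lemma bounded_support_partial:
  assumes "bounded_support f"
  shows "bounded_support (partial i f)"
proof -
  obtain R where R: "R > 0" "\<And>x. norm x \<ge> R \<Longrightarrow> f x = 0"
    using assms by (auto simp: bounded_support_def)
  \<comment> \<open>On the sphere of radius R the function may be nonzero arbitrarily close by; at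
    radius R + 1 it vanishes on a whole neighbourhood.\<close>
  have "partial i f x = 0" if "norm x \<ge> R + 1" for x
  proof -
    have "(f has_derivative (\<lambda>v. 0)) (at x)"
    proof (rule has_derivative_transform_within_open[of "\<lambda>x. 0" _ _ _ "{x. R < norm x}"])
      show "open {x::real^3. R < norm x}" by (intro open_Collect_less continuous_intros)
    qed (use that R in auto)
    from partial_eq[OF this] show ?thesis .
  qed
  then show ?thesis using R by (auto simp: bounded_support_def intro!: exI[of _ "R + 1"])
qed

lemma bounded_support_mult:
  fixes f g :: "'a::real_normed_vector \<Rightarrow> 'b::mult_zero"
  shows "bounded_support f \<Longrightarrow> bounded_support (\<lambda>x. g x * f x)"
    "bounded_support f \<Longrightarrow> bounded_support (\<lambda>x. f x * g x)"
  by (auto simp: bounded_support_def)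

lemma continuous_bounded_support:
  fixes f :: "'a::euclidean_space \<Rightarrow> 'b::{banach, second_countable_topology}"
  assumes c: "continuous_on UNIV f" and s: "bounded_support f"
  shows "\<exists>B. \<forall>x. norm (f x) \<le> B" "integrable lborel f"
proof -
  obtain R where R: "R > 0" "\<And>x. norm x \<ge> R \<Longrightarrow> f x = 0"
    using s by (auto simp: bounded_support_def)
  have "compact (f ` cball 0 R)"
    using c by (intro compact_continuous_image) (auto intro: continuous_on_subset)
  then obtain B where B: "\<And>x. norm x \<le> R \<Longrightarrow> norm (f x) \<le> B"
    using compact_imp_bounded bounded_iff by (metis imageI mem_cball_0)
  have B0: "0 \<le> B"
    using B[of 0] R norm_ge_zero[of "f 0"] by (auto intro: order_trans simp del: norm_ge_zero)
  show "\<exists>B. \<forall>x. norm (f x) \<le> B"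
    using B R B0 by (intro exI[of _ B]) (metis linear norm_zero)
  have [measurable]: "f \<in> borel_measurable borel"
    using c by (rule borel_measurable_continuous_onI)
  show "integrable lborel f"
  proof (rule Bochner_Integration.integrable_bound[of lborel "\<lambda>x. B * indicator (cball 0 R) x"])
    show "integrable lborel (\<lambda>x. B * indicator (cball (0::'a) R) x)"
      by (intro integrable_mult_right integrable_real_indicator) (use emeasure_lborel_cball_finite in \<open>auto simp: less_top[symmetric]\<close>)
    show "AE x in lborel. norm (f x) \<le> norm (B * indicator (cball 0 R) x)"
      using B B0 R by (auto simp: indicator_def)
  qed auto
qed

section \<open>Derivatives along coordinate lines and the integral of a partial derivative\<close>

lemma has_vector_derivative_line:
  fixes f :: "real^3 \<Rightarrow> 'b::real_normed_vector"
  assumes f: "f differentiable (at (x + t *\<^sub>R axis i 1))"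
  shows "((\<lambda>t. f (x + t *\<^sub>R axis i 1)) has_vector_derivative partial i f (x + t *\<^sub>R axis i 1)) (at t within A)"
proof -
  define e :: "real^3" where "e = axis i 1"
  have D: "(f has_derivative frechet_derivative f (at (x + t *\<^sub>R e))) (at (x + t *\<^sub>R e))"
    using f by (simp add: frechet_derivative_works e_def)
  have "((\<lambda>t. f (x + t *\<^sub>R e)) has_derivative (\<lambda>s. frechet_derivative f (at (x + t *\<^sub>R e)) (s *\<^sub>R e))) (at t within A)"
    by (rule has_derivative_compose[where f="\<lambda>t. x + t *\<^sub>R e" and g=f, OF _ D]) (auto intro!: derivative_eq_intros)
  then show ?thesis
    using has_derivative_linear[OF D] by (simp add: has_vector_derivative_def partial_def linear_scale e_def)
qed

text \<open>Stated along the sequence 1 / (n + 1) because dominated convergence and Fatou's lemma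
  are applied to it.\<close>

lemma partial_difference_quotient:
  fixes f :: "real^3 \<Rightarrow> 'b::real_normed_vector"
  assumes f: "f differentiable (at x)"
  shows "(\<lambda>n. real (Suc n) *\<^sub>R (f (x + (1 / real (Suc n)) *\<^sub>R axis i 1) - f x)) \<longlonglongrightarrow> partial i f x"
proof -
  define e :: "real^3" where "e = axis i 1"
  have "((\<lambda>t. f (x + t *\<^sub>R e)) has_vector_derivative partial i f x) (at 0)"
    using has_vector_derivative_line[of f x 0 i UNIV] f by (simp add: e_def)
  then have "((\<lambda>t. norm (f (x + t *\<^sub>R e) - f x - t *\<^sub>R partial i f x) / norm t) \<longlongrightarrow> 0) (at 0)"
    by (simp add: has_vector_derivative_def has_derivative_at)
  moreover have "\<forall>\<^sub>F t in at 0. norm (f (x + t *\<^sub>R e) - f x - t *\<^sub>R partial i f x) / norm t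
      = norm ((f (x + t *\<^sub>R e) - f x) /\<^sub>R t - partial i f x)"
  proof (rule eventually_at_filter[THEN iffD2], rule always_eventually, intro allI impI)
    fix t :: real assume "t \<noteq> 0"
    then have "(f (x + t *\<^sub>R e) - f x) /\<^sub>R t - partial i f x = (f (x + t *\<^sub>R e) - f x - t *\<^sub>R partial i f x) /\<^sub>R t"
      by (simp add: scaleR_diff_right)
    then show "norm (f (x + t *\<^sub>R e) - f x - t *\<^sub>R partial i f x) / norm t
      = norm ((f (x + t *\<^sub>R e) - f x) /\<^sub>R t - partial i f x)"
      by (simp add: divide_inverse)
  qed
  ultimately have "((\<lambda>t. norm ((f (x + t *\<^sub>R e) - f x) /\<^sub>R t - partial i f x)) \<longlongrightarrow> 0) (at 0)"
    by (simp add: tendsto_cong)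
  then have "((\<lambda>t. (f (x + t *\<^sub>R e) - f x) /\<^sub>R t) \<longlongrightarrow> partial i f x) (at 0)"
    by (rule LIM_zero_iff[THEN iffD1, OF tendsto_norm_zero_iff[THEN iffD1]])
  moreover have "filterlim (\<lambda>n. 1 / real (Suc n)) (at 0) sequentially"
    using LIMSEQ_inverse_real_of_nat by (auto simp: filterlim_at inverse_eq_divide simp del: of_nat_Suc)
  ultimately have "(\<lambda>n. (f (x + (1 / real (Suc n)) *\<^sub>R e) - f x) /\<^sub>R (1 / real (Suc n))) \<longlonglongrightarrow> partial i f x"
    by (rule filterlim_compose)
  then show ?thesis by (simp add: e_def del: of_nat_Suc)
qed

text \<open>The difference quotients have integral zero by translation invariance.\<close>
lemma integral_partial_eq_0:
  fixes f :: "real^3 \<Rightarrow> 'b::{banach, second_countable_topology}"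
  assumes f: "\<And>x. f differentiable (at x)" and s: "bounded_support f"
    and B: "\<And>x. norm (partial i f x) \<le> B" 
  shows "(\<integral>x. partial i f x \<partial>lborel) = 0"
proof -
  obtain R where R: "R > 0" "\<And>x. norm x \<ge> R \<Longrightarrow> f x = 0"
    using s by (auto simp: bounded_support_def)
  define e :: "real^3" where "e = axis i 1"
  have e: "norm e = 1" by (simp add: e_def norm_axis_1)
  have c: "continuous_on UNIV f"
    by (metis continuous_at_imp_continuous_on differentiable_imp_continuous_within f)
  have [measurable]: "f \<in> borel_measurable borel"
    using c by (rule borel_measurable_continuous_onI)
  have line: "((\<lambda>t. f (x + t *\<^sub>R e)) has_vector_derivative partial i f (x + t *\<^sub>R e)) (at t within A)" for x t A
    unfolding e_def by (rule has_vector_derivative_line[OF f])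
  define g where "g n x = real (Suc n) *\<^sub>R (f (x + (1 / real (Suc n)) *\<^sub>R e) - f x)" for n x
  have lim: "(\<lambda>n. g n x) \<longlonglongrightarrow> partial i f x" for x
    unfolding g_def e_def by (rule partial_difference_quotient[OF f])
  \<comment> \<open>The quotient is at most B by the mean value inequality; its step is at most 1,
    so enlarging the radius of the support by 1 covers every n.\<close>
  have bound: "norm (g n x) \<le> B * indicator (cball 0 (R + 1)) x" for n x
  proof (cases "norm x \<le> R + 1")
    case True
    have "norm (f (x + (1 / real (Suc n)) *\<^sub>R e) - f (x + 0 *\<^sub>R e)) \<le> B * norm (1 / real (Suc n) - 0)"
    proof (rule differentiable_bound[of UNIV, OF _ line[unfolded has_vector_derivative_def]])
      fix t :: real
      show "onorm (\<lambda>s. s *\<^sub>R partial i f (x + t *\<^sub>R e)) \<le> B"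
        using B by (intro onorm_le) (simp add: mult.commute[of B] mult_left_mono)
    qed auto
    then have "norm (g n x) \<le> real (Suc n) * (B * (1 / real (Suc n)))"
      unfolding g_def norm_scaleR by (intro mult_mono) (auto simp del: of_nat_Suc)
    then show ?thesis using True by (simp del: of_nat_Suc)
  next
    case False
    have "norm x - norm ((1 / real (Suc n)) *\<^sub>R e) \<le> norm (x + (1 / real (Suc n)) *\<^sub>R e)"
      by (rule norm_diff_ineq)
    moreover have "norm ((1 / real (Suc n)) *\<^sub>R e) \<le> 1" by (simp add: e)
    ultimately have "R \<le> norm (x + (1 / real (Suc n)) *\<^sub>R e)" "R \<le> norm x"
      using False by linarith+
    then show ?thesis using False R(2) by (simp add: g_def del: of_nat_Suc)
  qed
  have "(\<lambda>n. \<integral>x. g n x \<partial>lborel) \<longlonglongrightarrow> (\<integral>x. partial i f x \<partial>lborel)"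
  proof (rule integral_dominated_convergence[where w = "\<lambda>x. B * indicator (cball 0 (R + 1)) x"])
    have [measurable]: "g n \<in> borel_measurable borel" for n
      unfolding g_def by measurable
    show "partial i f \<in> borel_measurable lborel"
      by (rule borel_measurable_LIMSEQ_metric[of g, OF _ lim]) simp
    show "integrable lborel (\<lambda>x::real^3. B * indicator (cball 0 (R + 1)) x)"
      by (intro integrable_mult_right integrable_real_indicator) (use emeasure_lborel_cball_finite in \<open>auto simp: less_top[symmetric]\<close>)
    show "g n \<in> borel_measurable lborel" for n by simp
  qed (use lim bound in auto)
  moreover have "(\<integral>x. g n x \<partial>lborel) = 0" for n
  proof -
    have i: "integrable lborel f" by (rule continuous_bounded_support[OF c s])
    show ?thesis
      unfolding g_def using i lborel_integrable_shift[OF i] lborel_integral_shift[of f] by simp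
  qed
  ultimately show ?thesis by (simp add: LIMSEQ_const_iff)
qed

section \<open>Rapidly decaying functions\<close>

text \<open>Schwartz functions with values in any normed space. The weight 1 + |x| lets a single
  constant control both size and decay; \<open>schwartz_iff_rapid\<close> links this to the
  prescribed class.\<close>

definition rapid :: "(real^3 \<Rightarrow> 'b::real_normed_vector) \<Rightarrow> bool" where
  "rapid f \<longleftrightarrow> smooth f \<and> (\<forall>is k. \<exists>B. \<forall>x. (1 + norm x) ^ k * norm (partials is f x) \<le> B)"

lemma rapid_smooth: "rapid f \<Longrightarrow> smooth f"
  by (simp add: rapid_def)

lemma rapid_decay:
  assumes "rapid f"
  obtains B where "B > 0" "\<And>x. norm (f x) \<le> B / (1 + norm x) ^ k"
proof -
  obtain B where B: "\<And>x. (1 + norm x) ^ k * norm (partials [] f x) \<le> B"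
    using assms unfolding rapid_def by blast
  have pos: "(1 + norm x) ^ k > 0" for x :: "real^3"
    by (intro zero_less_power add_pos_nonneg) auto
  have "norm (f x) \<le> max B 1 / (1 + norm x) ^ k" for x
  proof -
    have "norm (f x) * (1 + norm x) ^ k \<le> max B 1"
      using B[of x] by (simp add: mult.commute le_max_iff_disj)
    then show ?thesis using pos[of x] by (simp add: pos_le_divide_eq)
  qed
  then show thesis by (intro that[of "max B 1"]) auto
qed

lemma one_plus_power_le: "0 \<le> x \<Longrightarrow> (1 + x) ^ k \<le> 2 ^ k * (1 + x ^ k)" for x :: real
proof (cases "x \<le> 1")
  case True
  assume "0 \<le> x"
  then have "(1 + x) ^ k \<le> 2 ^ k * 1"
    using True by (simp add: power_mono)
  also have "\<dots> \<le> 2 ^ k * (1 + x ^ k)"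
    using \<open>0 \<le> x\<close> by (intro mult_left_mono) auto
  finally show ?thesis .
next
  case False
  assume "0 \<le> x"
  then have "(1 + x) ^ k \<le> (2 * x) ^ k"
    using False by (intro power_mono) auto
  also have "\<dots> \<le> 2 ^ k * (1 + x ^ k)"
    by (simp add: power_mult_distrib)
  finally show ?thesis .
qed

lemma schwartz_iff_rapid: "schwartz f \<longleftrightarrow> rapid f"
proof
  assume f: "schwartz f"
  show "rapid f"
    unfolding rapid_def
  proof (intro conjI allI)
    show "smooth f" using f by (simp add: schwartz_def)
    fix "is" k
    obtain B where B: "\<And>x. norm x ^ k * norm (partials is f x) \<le> B"
      using f unfolding schwartz_def by blast
    obtain B0 where B0: "\<And>x. norm x ^ 0 * norm (partials is f x) \<le> B0"
      using f unfolding schwartz_def by blast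
    have "(1 + norm x) ^ k * norm (partials is f x) \<le> 2 ^ k * (B0 + B)" for x
    proof -
      have "(1 + norm x) ^ k * norm (partials is f x) \<le> (2 ^ k * (1 + norm x ^ k)) * norm (partials is f x)"
        by (intro mult_right_mono one_plus_power_le) auto
      also have "\<dots> = 2 ^ k * (norm (partials is f x) + norm x ^ k * norm (partials is f x))"
        by (simp add: algebra_simps)
      also have "\<dots> \<le> 2 ^ k * (B0 + B)"
        using B[of x] B0[of x] by (intro mult_left_mono add_mono) auto
      finally show ?thesis .
    qed
    then show "\<exists>B. \<forall>x. (1 + norm x) ^ k * norm (partials is f x) \<le> B" by blast
  qed
next
  assume f: "rapid f"
  show "schwartz f"
    unfolding schwartz_def
  proof (intro conjI allI)
    show "smooth f" using f by (simp add: rapid_def)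
    fix "is" k
    obtain B where B: "\<And>x. (1 + norm x) ^ k * norm (partials is f x) \<le> B"
      using f unfolding rapid_def by blast
    have "norm x ^ k * norm (partials is f x) \<le> B" for x
      by (rule order_trans[OF _ B[of x]]) (intro mult_right_mono power_mono, auto)
    then show "\<exists>B. \<forall>x. norm x ^ k * norm (partials is f x) \<le> B" by blast
  qed
qed

lemma bounded_support_partials: "bounded_support f \<Longrightarrow> bounded_support (partials is f)"
  by (induction "is") (auto simp: partials_Cons bounded_support_partial)

lemma rapid_bounded_support:
  fixes f :: "real^3 \<Rightarrow> 'b::{banach, second_countable_topology}"
  assumes f: "smooth f" and s: "bounded_support f"
  shows "rapid f"
  unfolding rapid_def
proof (intro conjI allI f)
  fix "is" k
  have "continuous_on UNIV (\<lambda>x. (1 + norm x) ^ k *\<^sub>R partials is f x)"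
    by (intro continuous_intros smooth_continuous smooth_partials f)
  moreover have "bounded_support (\<lambda>x. (1 + norm x) ^ k *\<^sub>R partials is f x)"
    using bounded_support_partials[OF s, of "is"] by (auto simp: bounded_support_def)
  ultimately obtain B where "\<And>x. norm ((1 + norm x) ^ k *\<^sub>R partials is f x) \<le> B"
    using continuous_bounded_support(1) by blast
  then show "\<exists>B. \<forall>x. (1 + norm x) ^ k * norm (partials is f x) \<le> B"
    by (intro exI[of _ B]) auto
qed

lemma rapid_partial: "rapid f \<Longrightarrow> rapid (partial i f)"
  unfolding rapid_def by (metis partials_snoc smooth_partial)

lemma rapid_bounded_linear:
  assumes L: "bounded_linear L" and f: "rapid f"
  shows "rapid (\<lambda>x. L (f x))"
  unfolding rapid_def
proof (intro conjI allI)
  show "smooth (\<lambda>x. L (f x))"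
    using L f by (simp add: smooth_bounded_linear rapid_smooth)
  fix "is" k
  obtain B where B: "\<And>x. (1 + norm x) ^ k * norm (partials is f x) \<le> B"
    using f unfolding rapid_def by blast
  obtain K where K: "K > 0" "\<And>x. norm (L x) \<le> norm x * K"
    using bounded_linear.pos_bounded[OF L] by blast
  have "(1 + norm x) ^ k * norm (partials is (\<lambda>x. L (f x)) x) \<le> B * K" for x
  proof -
    have "(1 + norm x) ^ k * norm (L (partials is f x)) \<le> (1 + norm x) ^ k * (norm (partials is f x) * K)"
      by (intro mult_left_mono K) auto
    also have "\<dots> \<le> B * K"
      using mult_right_mono[OF B[of x], of K] K by (simp add: mult.assoc)
    finally show ?thesis by (simp add: partials_bounded_linear[OF L rapid_smooth[OF f]])
  qed
  then show "\<exists>B. \<forall>x. (1 + norm x) ^ k * norm (partials is (\<lambda>x. L (f x)) x) \<le> B" by blast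
qed

lemma rapid_affine:
  assumes f: "rapid f" and c: "c \<noteq> 0"
  shows "rapid (\<lambda>x. f (t + c *\<^sub>R x))"
  unfolding rapid_def
proof (intro conjI allI)
  show "smooth (\<lambda>x. f (t + c *\<^sub>R x))"
    using f by (simp add: smooth_affine rapid_smooth)
  fix "is" :: "3 list" and k
  obtain B where B: "\<And>x. (1 + norm x) ^ k * norm (partials is f x) \<le> B"
    using f unfolding rapid_def by blast
  \<comment> \<open>Chosen so that 1 + |x| <= C (1 + |t + c x|), which follows from |x| <= (|t + c
    x| + |t|) / |c|.\<close>
  define C where "C = 1 + (1 + norm t) / \<bar>c\<bar>"
  have C: "1 + norm x \<le> C * (1 + norm (t + c *\<^sub>R x))" for x
  proof -
    have "norm (c *\<^sub>R x) \<le> norm (t + c *\<^sub>R x) + norm t"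
      using norm_triangle_ineq4[of "t + c *\<^sub>R x" t] by simp
    then have "norm x \<le> (norm (t + c *\<^sub>R x) + norm t) / \<bar>c\<bar>"
      using c by (simp add: field_simps)
    also have "\<dots> \<le> (1 + norm t) * (1 + norm (t + c *\<^sub>R x)) / \<bar>c\<bar>"
      by (intro divide_right_mono) (auto simp: algebra_simps)
    finally have "norm x \<le> (1 + norm t) * (1 + norm (t + c *\<^sub>R x)) / \<bar>c\<bar>" .
    moreover have "C * (1 + norm (t + c *\<^sub>R x)) = 1 + norm (t + c *\<^sub>R x) + (1 + norm t) * (1 + norm (t + c *\<^sub>R x)) / \<bar>c\<bar>"
      by (simp add: C_def distrib_right)
    ultimately show ?thesis
      using norm_ge_zero[of "t + c *\<^sub>R x"] by linarith
  qed
  have "(1 + norm x) ^ k * norm (partials is (\<lambda>x. f (t + c *\<^sub>R x)) x) \<le> \<bar>c\<bar> ^ length is * C ^ k * B" for x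
  proof -
    have "(1 + norm x) ^ k * norm (c ^ length is *\<^sub>R partials is f (t + c *\<^sub>R x))
        \<le> (C * (1 + norm (t + c *\<^sub>R x))) ^ k * norm (c ^ length is *\<^sub>R partials is f (t + c *\<^sub>R x))"
      by (intro mult_right_mono power_mono C) auto
    also have "\<dots> = \<bar>c\<bar> ^ length is * C ^ k * ((1 + norm (t + c *\<^sub>R x)) ^ k * norm (partials is f (t + c *\<^sub>R x)))"
      by (simp add: power_mult_distrib power_abs)
    also have "\<dots> \<le> \<bar>c\<bar> ^ length is * C ^ k * B"
      by (intro mult_left_mono B) (auto simp: C_def intro!: mult_nonneg_nonneg zero_le_power add_nonneg_nonneg divide_nonneg_nonneg)
    finally show ?thesis by (simp add: partials_affine[OF rapid_smooth[OF f]])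
  qed
  then show "\<exists>B. \<forall>x. (1 + norm x) ^ k * norm (partials is (\<lambda>x. f (t + c *\<^sub>R x)) x) \<le> B" by blast
qed

lemma rapid_diff:
  assumes f: "rapid f" and g: "rapid g"
  shows "rapid (\<lambda>x. f x - g x)"
  unfolding rapid_def
proof (intro conjI allI)
  show "smooth (\<lambda>x. f x - g x)"
    using f g by (simp add: smooth_diff rapid_smooth)
  fix "is" k
  obtain B where B: "\<And>x. (1 + norm x) ^ k * norm (partials is f x) \<le> B"
    using f unfolding rapid_def by blast
  obtain B' where B': "\<And>x. (1 + norm x) ^ k * norm (partials is g x) \<le> B'"
    using g unfolding rapid_def by blast
  have "(1 + norm x) ^ k * norm (partials is (\<lambda>x. f x - g x) x) \<le> B + B'" for x
  proof -
    have "(1 + norm x) ^ k * norm (partials is f x - partials is g x)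
      \<le> (1 + norm x) ^ k * (norm (partials is f x) + norm (partials is g x))"
      by (intro mult_left_mono norm_triangle_ineq4) auto
    also have "\<dots> \<le> B + B'"
      using B[of x] B'[of x] by (simp add: algebra_simps)
    finally show ?thesis by (simp add: partials_diff[OF rapid_smooth[OF f] rapid_smooth[OF g]])
  qed
  then show "\<exists>B. \<forall>x. (1 + norm x) ^ k * norm (partials is (\<lambda>x. f x - g x) x) \<le> B" by blast
qed

lemma rapid_measurable [measurable_dest]: "rapid f \<Longrightarrow> f \<in> borel_measurable borel"
  using smooth_continuous[OF rapid_smooth] by (rule borel_measurable_continuous_onI)

text \<open>The exponent 4 is the least natural number above the dimension 3; it is the standard
  weight from here on.\<close>

lemma integrable_inverse_norm_power4: "integrable lborel (\<lambda>x::real^3. c / (1 + norm x) ^ 4)"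
  using integrable_mult_right[OF integrable_inverse_norm_power[where 'a="real^3", of 4], of c] by simp

lemma rapid_moment_integrable:
  fixes f :: "real^3 \<Rightarrow> 'b::{banach, second_countable_topology}"
  assumes f: "rapid f"
  shows "integrable lborel (\<lambda>x. norm x ^ j * norm (f x))"
proof -
  note [measurable] = rapid_measurable[OF f]
  obtain B where B: "B > 0" "\<And>x. norm (f x) \<le> B / (1 + norm x) ^ (4 + j)"
    using rapid_decay[OF f] by blast
  show ?thesis
  proof (rule Bochner_Integration.integrable_bound[OF integrable_inverse_norm_power4[of B]])
    show "AE x in lborel. norm (norm x ^ j * norm (f x)) \<le> norm (B / (1 + norm x) ^ 4)"
    proof (rule AE_I2)
      fix x :: "real^3"
      have "norm x ^ j * norm (f x) \<le> (1 + norm x) ^ j * (B / (1 + norm x) ^ (4 + j))"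
        by (intro mult_mono power_mono B) auto
      also have "\<dots> = B / (1 + norm x) ^ 4"
        using norm_ge_zero[of x] by (simp add: power_add add_nonneg_eq_0_iff)
      finally show "norm (norm x ^ j * norm (f x)) \<le> norm (B / (1 + norm x) ^ 4)"
        using B by simp
    qed
  qed measurable
qed

lemma rapid_integrable:
  fixes f :: "real^3 \<Rightarrow> 'b::{banach, second_countable_topology}"
  assumes "rapid f"
  shows "integrable lborel f"
proof (rule integrable_norm_cancel)
  show "integrable lborel (\<lambda>x. norm (f x))"
    using rapid_moment_integrable[OF assms, of 0] by simp
qed (use rapid_measurable[OF assms] in simp)

section \<open>Differences and Taylor remainders of rapidly decaying functions\<close>

lemma inverse_norm_power_shift:
  fixes y w :: "'a::real_normed_vector"
  assumes "norm w \<le> 1"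
  shows "1 / (1 + norm (y + w)) ^ k \<le> 2 ^ k / (1 + norm y) ^ k"
proof -
  have "1 + norm y \<le> 2 * (1 + norm (y + w))"
    using norm_triangle_ineq4[of "y + w" w] assms norm_ge_zero[of "y + w"] by (simp del: norm_ge_zero)
  then have "(1 + norm y) ^ k \<le> 2 ^ k * (1 + norm (y + w)) ^ k"
    using power_mono[of "1 + norm y" "2 * (1 + norm (y + w))" k] by (simp only: power_mult_distrib) simp
  moreover have "0 < (1 + norm y) ^ k" "0 < (1 + norm (y + w)) ^ k"
    by (auto intro!: zero_less_power add_pos_nonneg)
  ultimately show ?thesis by (simp add: field_simps)
qed

lemma onorm_partials_le:
  fixes p :: "3 \<Rightarrow> 'b::real_normed_vector"
  shows "onorm (\<lambda>v::real^3. \<Sum>i\<in>UNIV. v $ i *\<^sub>R p i) \<le> (\<Sum>i\<in>UNIV. norm (p i))"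
proof (rule onorm_le)
  fix v :: "real^3"
  have "norm (\<Sum>i\<in>UNIV. v $ i *\<^sub>R p i) \<le> (\<Sum>i\<in>UNIV. norm (v $ i *\<^sub>R p i))"
    by (rule norm_sum)
  also have "\<dots> \<le> (\<Sum>i\<in>UNIV. norm v * norm (p i))"
    by (intro sum_mono) (auto intro!: mult_right_mono component_le_norm_cart)
  finally show "norm (\<Sum>i\<in>UNIV. v $ i *\<^sub>R p i) \<le> (\<Sum>i\<in>UNIV. norm (p i)) * norm v"
    by (simp add: sum_distrib_left mult.commute)
qed

text \<open>Mean value inequality on the segment from y to y + z. The restriction |z| <= 1 keeps the
  weights along the segment comparable to the weight at y.\<close>

lemma rapid_difference_decay:
  assumes f: "rapid f"
  obtains C where "C \<ge> 0" "\<And>y z. norm z \<le> 1 \<Longrightarrow> norm (f (y + z) - f y) \<le> C * norm z / (1 + norm y) ^ k"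
proof -
  have "\<forall>i. \<exists>B. B > 0 \<and> (\<forall>x. norm (partial i f x) \<le> B / (1 + norm x) ^ k)"
    using rapid_decay[OF rapid_partial[OF f]] by metis
  then obtain B where B: "\<And>i. B i > 0" "\<And>i x. norm (partial i f x) \<le> B i / (1 + norm x) ^ k"
    by metis
  define C where "C = (\<Sum>i\<in>UNIV. B i * 2 ^ k)"
  have "norm (f (y + z) - f y) \<le> C * norm z / (1 + norm y) ^ k" if z: "norm z \<le> 1" for y z
  proof -
    have "norm (f (y + z) - f y) \<le> (C / (1 + norm y) ^ k) * norm (y + z - y)"
    proof (rule differentiable_bound[of "closed_segment y (y + z)" f])
      fix x assume "x \<in> closed_segment y (y + z)"
      then obtain t where t: "0 \<le> t" "t \<le> 1" "x = y + t *\<^sub>R z"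
        by (auto simp: in_segment algebra_simps)
      show "(f has_derivative (\<lambda>v. \<Sum>i\<in>UNIV. v $ i *\<^sub>R partial i f x)) (at x within closed_segment y (y + z))"
        using has_derivative_partial[OF smooth_differentiable[OF rapid_smooth[OF f]]] by (rule has_derivative_at_withinI)
      have tz: "norm (t *\<^sub>R z) \<le> 1"
        using t z mult_mono[of t 1 "norm z" 1] by simp
      have "(\<Sum>i\<in>UNIV. norm (partial i f x)) \<le> (\<Sum>i\<in>UNIV. B i * 2 ^ k / (1 + norm y) ^ k)"
      proof (rule sum_mono)
        fix i
        have "norm (partial i f x) \<le> B i * (1 / (1 + norm x) ^ k)"
          using B(2)[of i x] by simp
        also have "\<dots> \<le> B i * (2 ^ k / (1 + norm y) ^ k)"
          unfolding t(3) using B(1)[of i] by (intro mult_left_mono inverse_norm_power_shift tz) auto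
        finally show "norm (partial i f x) \<le> B i * 2 ^ k / (1 + norm y) ^ k" by simp
      qed
      also have "\<dots> = C / (1 + norm y) ^ k"
        by (simp add: C_def sum_divide_distrib)
      finally show "onorm (\<lambda>v. \<Sum>i\<in>UNIV. v $ i *\<^sub>R partial i f x) \<le> C / (1 + norm y) ^ k"
        by (rule order_trans[OF onorm_partials_le])
    qed auto
    then show ?thesis by simp
  qed
  moreover have "C \<ge> 0"
    using less_imp_le[OF B(1)] unfolding C_def by (intro sum_nonneg mult_nonneg_nonneg) auto
  ultimately show thesis by (rule that[rotated])
qed

text \<open>The remainder is quadratic in v and still carries the decay in y, so it stays integrable
  after multiplication by a slowly growing function. It comes from linearising f at y and bounding
  the change of the derivative along the segment with \<open>rapid_difference_decay\<close>.\<close>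

lemma rapid_taylor:
  assumes f: "rapid f"
  obtains C where "C \<ge> 0"
    "\<And>y v. norm v \<le> 1 \<Longrightarrow> norm (f (y + v) - f y - (\<Sum>i\<in>UNIV. v $ i *\<^sub>R partial i f y)) \<le> C * (norm v)\<^sup>2 / (1 + norm y) ^ k"
proof -
  have "\<forall>i. \<exists>C\<ge>0. \<forall>y z. norm z \<le> 1 \<longrightarrow> norm (partial i f (y + z) - partial i f y) \<le> C * norm z / (1 + norm y) ^ k"
    using rapid_difference_decay[OF rapid_partial[OF f]] by metis
  then obtain B where B: "\<And>i. B i \<ge> 0"
    "\<And>i y z. norm z \<le> 1 \<Longrightarrow> norm (partial i f (y + z) - partial i f y) \<le> B i * norm z / (1 + norm y) ^ k"
    by metis
  define C where "C = (\<Sum>i\<in>UNIV. B i)"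
  have "norm (f (y + v) - f y - (\<Sum>i\<in>UNIV. v $ i *\<^sub>R partial i f y)) \<le> C * (norm v)\<^sup>2 / (1 + norm y) ^ k"
    if v: "norm v \<le> 1" for y v
  proof -
    have "norm (f (y + v) - f y - (\<Sum>i\<in>UNIV. (y + v - y) $ i *\<^sub>R partial i f y)) \<le> norm (y + v - y) * (C * norm v / (1 + norm y) ^ k)"
    proof (rule differentiable_bound_linearization[where S="closed_segment y (y + v)"
          and f'="\<lambda>x v. \<Sum>i\<in>UNIV. v $ i *\<^sub>R partial i f x" and ?x0.0=y])
      show "y + t *\<^sub>R (y + v - y) \<in> closed_segment y (y + v)" if "t \<in> {0..1}" for t
        using that by (auto simp: in_segment algebra_simps intro!: exI[of _ t])
      fix x assume "x \<in> closed_segment y (y + v)"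
      then obtain t where t: "0 \<le> t" "t \<le> 1" "x = y + t *\<^sub>R v"
        by (auto simp: in_segment algebra_simps)
      show "(f has_derivative (\<lambda>v. \<Sum>i\<in>UNIV. v $ i *\<^sub>R partial i f x)) (at x within closed_segment y (y + v))"
        using has_derivative_partial[OF smooth_differentiable[OF rapid_smooth[OF f]]] by (rule has_derivative_at_withinI)
      have tz: "norm (t *\<^sub>R v) \<le> norm v"
        using t mult_right_mono[of t 1 "norm v"] by simp
      have "(\<lambda>va. \<Sum>i\<in>UNIV. va $ i *\<^sub>R partial i f x) - (\<lambda>va. \<Sum>i\<in>UNIV. va $ i *\<^sub>R partial i f y)
        = (\<lambda>va. \<Sum>i\<in>UNIV. va $ i *\<^sub>R (partial i f x - partial i f y))"
        by (simp add: fun_eq_iff fun_diff_def scaleR_diff_right sum_subtractf)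
      then have "onorm ((\<lambda>va. \<Sum>i\<in>UNIV. va $ i *\<^sub>R partial i f x) - (\<lambda>va. \<Sum>i\<in>UNIV. va $ i *\<^sub>R partial i f y))
          \<le> (\<Sum>i\<in>UNIV. norm (partial i f x - partial i f y))"
        using onorm_partials_le[of "\<lambda>i. partial i f x - partial i f y"] by simp
      also have "\<dots> \<le> (\<Sum>i\<in>UNIV. B i * norm v / (1 + norm y) ^ k)"
      proof (rule sum_mono)
        fix i
        have "norm (partial i f x - partial i f y) \<le> B i * norm (t *\<^sub>R v) / (1 + norm y) ^ k"
          unfolding t(3) using tz v by (intro B(2)) auto
        also have "\<dots> \<le> B i * norm v / (1 + norm y) ^ k"
          by (intro divide_right_mono mult_left_mono tz B(1)) auto
        finally show "norm (partial i f x - partial i f y) \<le> B i * norm v / (1 + norm y) ^ k" .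
      qed
      also have "\<dots> = C * norm v / (1 + norm y) ^ k"
        by (simp add: C_def sum_divide_distrib sum_distrib_right)
      finally show "onorm ((\<lambda>va. \<Sum>i\<in>UNIV. va $ i *\<^sub>R partial i f x) - (\<lambda>va. \<Sum>i\<in>UNIV. va $ i *\<^sub>R partial i f y))
         \<le> C * norm v / (1 + norm y) ^ k" .
    qed auto
    then show ?thesis by (simp add: power2_eq_square algebra_simps)
  qed
  moreover have "C \<ge> 0"
    using B(1) by (simp add: C_def sum_nonneg)
  ultimately show thesis by (rule that[rotated])
qed

text \<open>This is how differentiation under the integral sign is done below, for oscillatory
  integrals and for convolutions alike: a remainder quadratic in v survives integration.\<close>

lemma has_derivative_quadratic_error:
  assumes L: "bounded_linear L"
    and B: "\<And>v. norm v \<le> 1 \<Longrightarrow> norm (f (x + v) - f x - L v) \<le> C * (norm v)\<^sup>2"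
  shows "(f has_derivative L) (at x)"
  unfolding has_derivative_at
proof (intro conjI L)
  have "\<forall>\<^sub>F h in at 0. norm (norm (f (x + h) - f x - L h) / norm h) \<le> C * norm h"
    unfolding eventually_at
  proof (intro exI[of _ 1] conjI ballI impI)
    fix h :: 'a assume h: "h \<noteq> 0 \<and> dist h 0 < 1"
    have "norm (f (x + h) - f x - L h) / norm h \<le> C * (norm h)\<^sup>2 / norm h"
      using h by (intro divide_right_mono B) auto
    then show "norm (norm (f (x + h) - f x - L h) / norm h) \<le> C * norm h"
      using h by (simp add: power2_eq_square)
  qed simp
  moreover have "((\<lambda>h::'a. C * norm h) \<longlongrightarrow> 0) (at 0)"
    by (rule tendsto_eq_intros refl | simp)+
  ultimately show "(\<lambda>h. norm (f (x + h) - f x - L h) / norm h) \<midarrow>0\<rightarrow> 0"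
    by (rule Lim_null_comparison)
qed

text \<open>For |z| <= 1 the pointwise bound with weight 4 is integrated; for |z| > 1 the trivial
  bound by twice the L^1 norm is at most that multiple of |z|. The summand 1 in the constant only
  makes it positive.\<close>

lemma rapid_difference_L1:
  fixes f :: "real^3 \<Rightarrow> real"
  assumes f: "rapid f"
  obtains C where "C > 0" "\<And>z. (\<integral>\<^sup>+y. ennreal \<bar>f (y + z) - f y\<bar> \<partial>lborel) \<le> ennreal (C * norm z)"
proof -
  note [measurable] = rapid_measurable[OF f]
  obtain B where B: "B \<ge> 0" "\<And>y z. norm z \<le> 1 \<Longrightarrow> norm (f (y + z) - f y) \<le> B * norm z / (1 + norm y) ^ 4"
    using rapid_difference_decay[OF f, of 4] by blast
  define J where "J = (\<integral>(x::real^3). 1 / (1 + norm x) ^ 4 \<partial>lborel)"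
  define L where "L = (\<integral>x. \<bar>f x\<bar> \<partial>lborel)"
  have J: "J \<ge> 0" and L: "L \<ge> 0"
    by (auto simp: J_def L_def intro!: integral_nonneg_AE)
  have "(\<integral>\<^sup>+y. ennreal \<bar>f (y + z) - f y\<bar> \<partial>lborel) \<le> ennreal ((B * J + 2 * L + 1) * norm z)" for z
  proof (cases "norm z \<le> 1")
    case True
    have "(\<integral>\<^sup>+y. ennreal \<bar>f (y + z) - f y\<bar> \<partial>lborel) \<le> (\<integral>\<^sup>+(y::real^3). ennreal (B * norm z / (1 + norm y) ^ 4) \<partial>lborel)"
      by (intro nn_integral_mono ennreal_leI) (use B(2)[OF True] in simp)
    also have "\<dots> = ennreal (\<integral>y. B * norm z / (1 + norm y) ^ 4 \<partial>(lborel :: (real^3) measure))"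
      using B(1) by (intro nn_integral_eq_integral integrable_inverse_norm_power4) auto
    also have "(\<integral>y. B * norm z / (1 + norm y) ^ 4 \<partial>(lborel :: (real^3) measure)) = B * norm z * J"
      unfolding J_def integral_mult_right_zero[symmetric] by simp
    also have "ennreal (B * norm z * J) \<le> ennreal ((B * J + 2 * L + 1) * norm z)"
      using J L B by (intro ennreal_leI) (auto simp: algebra_simps)
    finally show ?thesis .
  next
    case False
    have i: "integrable lborel (\<lambda>y. \<bar>f y\<bar>)" using rapid_integrable[OF f] by simp
    have "(\<integral>\<^sup>+y. ennreal \<bar>f (y + z) - f y\<bar> \<partial>lborel) \<le> (\<integral>\<^sup>+y. ennreal \<bar>f (y + z)\<bar> + ennreal \<bar>f y\<bar> \<partial>lborel)"
      by (intro nn_integral_mono) (auto simp: ennreal_plus[symmetric] simp del: ennreal_plus intro!: ennreal_leI)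
    also have "\<dots> = (\<integral>\<^sup>+y. ennreal \<bar>f y\<bar> \<partial>lborel) + (\<integral>\<^sup>+y. ennreal \<bar>f y\<bar> \<partial>lborel)"
      using nn_integral_shift[of "\<lambda>y. ennreal \<bar>f y\<bar>" z] by (simp add: nn_integral_add)
    also have "\<dots> = ennreal (2 * L)"
      using nn_integral_eq_integral[OF i] L by (simp add: L_def ennreal_plus[symmetric] del: ennreal_plus)
    also have "\<dots> \<le> ennreal ((B * J + 2 * L + 1) * norm z)"
    proof (rule ennreal_leI)
      have "2 * L * 1 \<le> (B * J + 2 * L + 1) * norm z"
        using False J L B by (intro mult_mono) auto
      then show "2 * L \<le> (B * J + 2 * L + 1) * norm z" by simp
    qed
    finally show ?thesis .
  qed
  moreover have "B * J + 2 * L + 1 > 0" using B J L by (simp add: add_nonneg_pos)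
  ultimately show thesis by (rule that[rotated])
qed

section \<open>Fourier integrals of smooth compactly supported symbols\<close>

definition symbol :: "(real^3 \<Rightarrow> complex) \<Rightarrow> bool" where
  "symbol g \<longleftrightarrow> smooth g \<and> bounded_support g"

text \<open>The inverse Fourier transform without its factor (2 pi)^-3.\<close>

definition oscint :: "(real^3 \<Rightarrow> complex) \<Rightarrow> real^3 \<Rightarrow> complex" where
  "oscint g x = (\<integral>\<xi>. cis (x \<bullet> \<xi>) * g \<xi> \<partial>lborel)"

lemma symbolD:
  assumes "symbol g"
  shows "smooth g" "bounded_support g" "integrable lborel g" "g \<in> borel_measurable borel" "\<exists>B. \<forall>x. norm (g x) \<le> B"
  using assms continuous_bounded_support[OF smooth_continuous, of g] borel_measurable_integrable[of lborel g]
  by (auto simp: symbol_def)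

lemma symbol_partial: "symbol g \<Longrightarrow> symbol (partial i g)"
  by (simp add: symbol_def smooth_partial bounded_support_partial)

lemma symbol_mult: "smooth f \<Longrightarrow> symbol g \<Longrightarrow> symbol (\<lambda>x. f x * g x)"
  by (simp add: symbol_def smooth_mult bounded_support_mult)

lemma smooth_component: "smooth (\<lambda>\<xi>. \<i> * complex_of_real (\<xi> $ i))"
proof (rule smooth_linear)
  show "bounded_linear (\<lambda>\<xi>::real^3. \<i> * complex_of_real (\<xi> $ i))"
    by (intro bounded_linear_const_mult bounded_linear_compose[OF bounded_linear_of_real] bounded_linear_vec_nth)
qed

lemma symbol_shift:
  assumes "symbol g"
  shows "symbol (\<lambda>\<xi>. g (\<eta> + \<xi>))"
proof -
  obtain R where R: "R > 0" "\<And>x. norm x \<ge> R \<Longrightarrow> g x = 0"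
    using assms by (auto simp: symbol_def bounded_support_def)
  have "g (\<eta> + \<xi>) = 0" if "norm \<xi> \<ge> R + norm \<eta>" for \<xi>
    using norm_diff_ineq[of \<xi> \<eta>] that by (intro R) (simp add: add.commute)
  then show ?thesis
    using assms R smooth_affine[of g \<eta> 1]
    by (auto simp: symbol_def bounded_support_def intro!: exI[of _ "R + norm \<eta>"] add_pos_nonneg)
qed

lemma borel_measurable_cis [measurable]:
  "f \<in> borel_measurable M \<Longrightarrow> (\<lambda>x. cis (f x)) \<in> borel_measurable M"
  by (rule measurable_compose[of f M borel cis]) (auto intro!: borel_measurable_continuous_onI continuous_intros)

lemma oscint_integrable:
  assumes "integrable lborel g"
  shows "integrable lborel (\<lambda>\<xi>. cis (x \<bullet> \<xi>) * g \<xi>)"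
  using assms borel_measurable_integrable[OF assms]
  by (intro Bochner_Integration.integrable_bound[OF assms]) (auto simp: norm_mult)

lemma oscint_bound:
  assumes "integrable lborel g"
  shows "norm (oscint g x) \<le> (\<integral>\<xi>. norm (g \<xi>) \<partial>lborel)"
  unfolding oscint_def by (rule order_trans[OF integral_norm_bound]) (simp add: norm_mult)

lemma cis_taylor: "norm (cis t - 1 - \<i> * complex_of_real t) \<le> t\<^sup>2 / 2"
  using iexp_approx1[of t 1] by (simp add: cis_conv_exp numeral_2_eq_2 diff_diff_eq)

text \<open>The bound t^2 / 2 of \<open>cis_taylor\<close> is used with t the inner product of v and
  \<open>\<xi>\<close>; the second moment of g is finite because g has bounded support.\<close>

lemma oscint_has_derivative:
  assumes g: "symbol g"
  shows "(oscint g has_derivative (\<lambda>v. \<Sum>i\<in>UNIV. v $ i *\<^sub>R oscint (\<lambda>\<xi>. \<i> * complex_of_real (\<xi> $ i) * g \<xi>) x)) (at x)"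
proof (rule has_derivative_quadratic_error)
  show "bounded_linear (\<lambda>v::real^3. \<Sum>i\<in>UNIV. v $ i *\<^sub>R oscint (\<lambda>\<xi>. \<i> * complex_of_real (\<xi> $ i) * g \<xi>) x)"
    by (intro bounded_linear_sum bounded_linear_compose[OF bounded_linear_scaleR_left] bounded_linear_vec_nth)
  note [measurable] = symbolD(4)[OF g]
  have gi: "symbol (\<lambda>\<xi>. \<i> * complex_of_real (\<xi> $ i) * g \<xi>)" for i
    by (rule symbol_mult[OF smooth_component g])
  note ig = oscint_integrable[OF symbolD(3)[OF g]] and igi = oscint_integrable[OF symbolD(3)[OF gi]]
  have cg: "continuous_on UNIV g" by (rule smooth_continuous[OF symbolD(1)[OF g]])
  have i2: "integrable lborel (\<lambda>\<xi>. (norm \<xi>)\<^sup>2 * norm (g \<xi>))"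
  proof -
    have "integrable lborel (\<lambda>\<xi>. complex_of_real ((norm \<xi>)\<^sup>2) * g \<xi>)"
      by (intro continuous_bounded_support bounded_support_mult symbolD(2)[OF g] continuous_intros cg)
    from integrable_norm[OF this] show ?thesis by (simp add: norm_mult norm_power)
  qed
  fix v :: "real^3"
  have "(\<Sum>i\<in>UNIV. v $ i *\<^sub>R oscint (\<lambda>\<xi>. \<i> * complex_of_real (\<xi> $ i) * g \<xi>) x)
      = (\<integral>\<xi>. (\<Sum>i\<in>UNIV. v $ i *\<^sub>R (cis (x \<bullet> \<xi>) * (\<i> * complex_of_real (\<xi> $ i) * g \<xi>))) \<partial>lborel)"
    unfolding oscint_def using igi by (subst Bochner_Integration.integral_sum) auto
  also have "\<dots> = (\<integral>\<xi>. cis (x \<bullet> \<xi>) * (\<i> * complex_of_real (v \<bullet> \<xi>)) * g \<xi> \<partial>lborel)"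
    by (rule Bochner_Integration.integral_cong) (auto simp: inner_vec_def scaleR_conv_of_real sum_distrib_left sum_distrib_right mult_ac)
  finally have D: "(\<Sum>i\<in>UNIV. v $ i *\<^sub>R oscint (\<lambda>\<xi>. \<i> * complex_of_real (\<xi> $ i) * g \<xi>) x)
      = (\<integral>\<xi>. cis (x \<bullet> \<xi>) * (\<i> * complex_of_real (v \<bullet> \<xi>)) * g \<xi> \<partial>lborel)" .
  have iD: "integrable lborel (\<lambda>\<xi>. cis (x \<bullet> \<xi>) * (\<i> * complex_of_real (v \<bullet> \<xi>)) * g \<xi>)"
    by (intro continuous_bounded_support bounded_support_mult symbolD(2)[OF g] continuous_intros cg)
  have "oscint g (x + v) - oscint g x - (\<integral>\<xi>. cis (x \<bullet> \<xi>) * (\<i> * complex_of_real (v \<bullet> \<xi>)) * g \<xi> \<partial>lborel)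
      = (\<integral>\<xi>. cis ((x + v) \<bullet> \<xi>) * g \<xi> - cis (x \<bullet> \<xi>) * g \<xi> - cis (x \<bullet> \<xi>) * (\<i> * complex_of_real (v \<bullet> \<xi>)) * g \<xi> \<partial>lborel)"
    unfolding oscint_def
    by (simp only: Bochner_Integration.integral_diff Bochner_Integration.integrable_diff ig iD)
  also have "\<dots> = (\<integral>\<xi>. cis (x \<bullet> \<xi>) * (cis (v \<bullet> \<xi>) - 1 - \<i> * complex_of_real (v \<bullet> \<xi>)) * g \<xi> \<partial>lborel)"
    by (rule Bochner_Integration.integral_cong) (simp_all add: inner_add_left cis_mult[symmetric] algebra_simps)
  also have "norm \<dots> \<le> (\<integral>\<xi>. (norm v)\<^sup>2 / 2 * ((norm \<xi>)\<^sup>2 * norm (g \<xi>)) \<partial>lborel)"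
  proof (rule order_trans[OF integral_norm_bound integral_mono])
    show "integrable lborel (\<lambda>\<xi>. norm (cis (x \<bullet> \<xi>) * (cis (v \<bullet> \<xi>) - 1 - \<i> * complex_of_real (v \<bullet> \<xi>)) * g \<xi>))"
      by (intro integrable_norm continuous_bounded_support bounded_support_mult symbolD(2)[OF g] continuous_intros cg)
    show "integrable lborel (\<lambda>\<xi>. (norm v)\<^sup>2 / 2 * ((norm \<xi>)\<^sup>2 * norm (g \<xi>)))"
      using i2 by simp
    fix \<xi> :: "real^3"
    have "norm (cis (v \<bullet> \<xi>) - 1 - \<i> * complex_of_real (v \<bullet> \<xi>)) \<le> (v \<bullet> \<xi>)\<^sup>2 / 2"
      by (rule cis_taylor)
    also have "\<dots> \<le> (norm v * norm \<xi>)\<^sup>2 / 2"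
      using Cauchy_Schwarz_ineq2[of v \<xi>] by (intro divide_right_mono) (auto simp: abs_le_square_iff[symmetric])
    finally show "norm (cis (x \<bullet> \<xi>) * (cis (v \<bullet> \<xi>) - 1 - \<i> * complex_of_real (v \<bullet> \<xi>)) * g \<xi>) \<le> (norm v)\<^sup>2 / 2 * ((norm \<xi>)\<^sup>2 * norm (g \<xi>))"
      using mult_right_mono[of _ _ "norm (g \<xi>)"] by (fastforce simp: norm_mult power_mult_distrib)
  qed
  also have "\<dots> = (\<integral>\<xi>. (norm \<xi>)\<^sup>2 * norm (g \<xi>) \<partial>lborel) / 2 * (norm v)\<^sup>2"
    by simp
  finally show "norm (oscint g (x + v) - oscint g x - (\<Sum>i\<in>UNIV. v $ i *\<^sub>R oscint (\<lambda>\<xi>. \<i> * complex_of_real (\<xi> $ i) * g \<xi>) x))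
     \<le> (\<integral>\<xi>. (norm \<xi>)\<^sup>2 * norm (g \<xi>) \<partial>lborel) / 2 * (norm v)\<^sup>2"
    unfolding D .
qed

lemma partial_oscint:
  assumes g: "symbol g"
  shows "partial i (oscint g) = oscint (\<lambda>\<xi>. \<i> * complex_of_real (\<xi> $ i) * g \<xi>)"
proof
  fix x
  show "partial i (oscint g) x = oscint (\<lambda>\<xi>. \<i> * complex_of_real (\<xi> $ i) * g \<xi>) x"
    using partial_eq[OF oscint_has_derivative[OF g], of i x] 
    by (simp add: axis_def if_distrib[of "\<lambda>c. c *\<^sub>R _"] cong: if_cong)
qed

lemma partials_oscint:
  assumes "symbol g"
  shows "\<exists>h. symbol h \<and> partials is (oscint g) = oscint h"
proof (induction "is")
  case (Cons i "is")
  then obtain h where "symbol h" "partials is (oscint g) = oscint h" by blast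
  then show ?case
    using symbol_mult[OF smooth_component, of h i] by (auto simp: partials_Cons partial_oscint)
qed (use assms in auto)

lemma oscint_smooth: "symbol g \<Longrightarrow> smooth (oscint g)"
  unfolding smooth_def
proof (intro allI)
  fix "is" x assume "symbol g"
  then obtain h where "symbol h" "partials is (oscint g) = oscint h"
    using partials_oscint by blast
  then show "partials is (oscint g) differentiable (at x)"
    using differentiableI[OF oscint_has_derivative] by simp
qed

text \<open>Integration by parts: the j-th partial derivative of the whole integrand has integral 0,
  and the Leibniz rule splits it into the derivative of the symbol and the factor
  \<open>x $ j\<close> from the phase.\<close>

lemma component_times_oscint:
  assumes g: "symbol g"
  shows "complex_of_real (x $ j) * oscint g x = oscint (\<lambda>\<xi>. \<i> * partial j g \<xi>) x"
proof -
  define f where "f \<xi> = cis (x \<bullet> \<xi>) * g \<xi>" for \<xi>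
  have cD: "((\<lambda>\<xi>. cis (x \<bullet> \<xi>)) has_derivative (\<lambda>v. (x \<bullet> v) *\<^sub>R (\<i> * cis (x \<bullet> \<xi>)))) (at \<xi>)" for \<xi> :: "real^3"
    by (auto intro!: derivative_eq_intros)
  have gd: "g differentiable (at \<xi>)" for \<xi>
    by (rule smooth_differentiable[OF symbolD(1)[OF g]])
  have f_diff: "f differentiable (at \<xi>)" for \<xi>
    unfolding f_def by (rule differentiable_mult[OF differentiableI[OF cD] gd])
  have pf: "partial j f \<xi> = cis (x \<bullet> \<xi>) * partial j g \<xi> + \<i> * complex_of_real (x $ j) * (cis (x \<bullet> \<xi>) * g \<xi>)" for \<xi>
    unfolding f_def[abs_def] using gd differentiableI[OF cD] partial_eq[OF cD, of j \<xi>]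
    by (subst partial_mult) (auto simp: inner_axis scaleR_conv_of_real mult_ac)
  have cont: "continuous_on UNIV (partial j f)"
    unfolding pf by (intro continuous_intros smooth_continuous smooth_partial symbolD(1)[OF g])
  have supp: "bounded_support f"
    unfolding f_def by (intro bounded_support_mult symbolD(2)[OF g])
  obtain B where "\<And>\<xi>. norm (partial j f \<xi>) \<le> B"
    using continuous_bounded_support(1)[OF cont bounded_support_partial[OF supp]] by blast
  then have "(\<integral>\<xi>. partial j f \<xi> \<partial>lborel) = 0"
    by (rule integral_partial_eq_0[OF f_diff supp])
  then have "oscint (partial j g) x + \<i> * complex_of_real (x $ j) * oscint g x = 0"
    unfolding pf oscint_def using oscint_integrable[OF symbolD(3)[OF g]] oscint_integrable[OF symbolD(3)[OF symbol_partial[OF g]]]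
    by simp
  then have "\<i> * (oscint (partial j g) x + \<i> * complex_of_real (x $ j) * oscint g x) = 0"
    by simp
  then have "complex_of_real (x $ j) * oscint g x = \<i> * oscint (partial j g) x"
    by (simp add: algebra_simps)
  also have "\<dots> = oscint (\<lambda>\<xi>. \<i> * partial j g \<xi>) x"
    unfolding oscint_def by (subst integral_mult_right_zero[symmetric]) (simp add: mult_ac)
  finally show ?thesis .
qed

text \<open>Multiplication by a coordinate becomes differentiation of the symbol, so every power of
  a coordinate times \<open>oscint g\<close> is again the transform of a symbol and hence
  bounded.\<close>

lemma oscint_decay:
  assumes g: "symbol g"
  shows "\<exists>B. \<forall>x. (1 + norm x) ^ k * norm (oscint g x) \<le> B"
proof -
  have "\<exists>h. symbol h \<and> (\<forall>x. complex_of_real (x $ j) ^ k * oscint g x = oscint h x)" for j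
  proof (induction k)
    case (Suc k)
    then obtain h where h: "symbol h" "\<And>x. complex_of_real (x $ j) ^ k * oscint g x = oscint h x"
      by blast
    have "complex_of_real (x $ j) ^ Suc k * oscint g x = oscint (\<lambda>\<xi>. \<i> * partial j h \<xi>) x" for x
      using h component_times_oscint[OF h(1), of x j] by (simp add: mult.assoc)
    then show ?case
      using symbol_mult[OF smooth_const symbol_partial[OF h(1)]] by blast
  qed (use g in auto)
  then obtain h where h: "\<And>j. symbol (h j)" "\<And>j x. complex_of_real (x $ j) ^ k * oscint g x = oscint (h j) x"
    by metis
  have b: "\<bar>x $ j\<bar> ^ k * norm (oscint g x) \<le> (\<integral>\<xi>. norm (h j \<xi>) \<partial>lborel)" for j x
    using oscint_bound[OF symbolD(3)[OF h(1)[of j]], of x] unfolding h(2)[symmetric]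
    by (simp add: norm_mult norm_power)
  have n: "norm x ^ k \<le> 3 ^ k * (\<Sum>j\<in>UNIV. \<bar>x $ j\<bar> ^ k)" for x :: "real^3"
  proof -
    define m where "m = Max ((\<lambda>j. \<bar>x $ j\<bar>) ` UNIV)"
    have m: "\<bar>x $ j\<bar> \<le> m" for j unfolding m_def by (rule Max_ge) auto
    have "m \<in> (\<lambda>j. \<bar>x $ j\<bar>) ` UNIV" unfolding m_def by (rule Max_in) auto
    then obtain j where j: "m = \<bar>x $ j\<bar>" by auto
    have "norm x \<le> (\<Sum>j\<in>UNIV. \<bar>x $ j\<bar>)" by (rule norm_le_l1_cart)
    also have "\<dots> \<le> (\<Sum>j\<in>(UNIV::3 set). m)" by (intro sum_mono m)
    finally have "norm x ^ k \<le> (3 * m) ^ k"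
      by (intro power_mono) auto
    also have "\<dots> = 3 ^ k * \<bar>x $ j\<bar> ^ k" by (simp add: power_mult_distrib j)
    also have "\<dots> \<le> 3 ^ k * (\<Sum>j\<in>UNIV. \<bar>x $ j\<bar> ^ k)"
      by (intro mult_left_mono member_le_sum) auto
    finally show ?thesis .
  qed
  have "(1 + norm x) ^ k * norm (oscint g x)
     \<le> 2 ^ k * ((\<integral>\<xi>. norm (g \<xi>) \<partial>lborel) + 3 ^ k * (\<Sum>j\<in>UNIV. (\<integral>\<xi>. norm (h j \<xi>) \<partial>lborel)))" for x
  proof -
    have "(1 + norm x) ^ k * norm (oscint g x) \<le> (2 ^ k * (1 + 3 ^ k * (\<Sum>j\<in>UNIV. \<bar>x $ j\<bar> ^ k))) * norm (oscint g x)"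
      using n[of x] by (intro mult_right_mono order_trans[OF one_plus_power_le] mult_left_mono) auto
    also have "\<dots> = 2 ^ k * (norm (oscint g x) + 3 ^ k * (\<Sum>j\<in>UNIV. \<bar>x $ j\<bar> ^ k * norm (oscint g x)))"
      unfolding sum_distrib_right[symmetric] by (simp add: algebra_simps)
    also have "\<dots> \<le> 2 ^ k * ((\<integral>\<xi>. norm (g \<xi>) \<partial>lborel) + 3 ^ k * (\<Sum>j\<in>UNIV. (\<integral>\<xi>. norm (h j \<xi>) \<partial>lborel)))"
      by (intro mult_left_mono add_mono sum_mono oscint_bound[OF symbolD(3)[OF g]] b) auto
    finally show ?thesis .
  qed
  then show ?thesis by blast
qed

lemma rapid_oscint: "symbol g \<Longrightarrow> rapid (oscint g)"
  unfolding rapid_def by (metis oscint_decay oscint_smooth partials_oscint)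

section \<open>The Gaussian and its Fourier transform\<close>

lemma lborel_integral_prod:
  fixes f :: "'a::euclidean_space \<Rightarrow> real \<Rightarrow> complex"
  assumes f: "\<And>b. b \<in> Basis \<Longrightarrow> integrable lborel (f b)"
  shows "(\<integral>x. (\<Prod>b\<in>Basis. f b (x \<bullet> b)) \<partial>lborel) = (\<Prod>b\<in>Basis. (\<integral>t. f b t \<partial>lborel))"
proof -
  have [measurable]: "f b \<in> borel_measurable borel" if "b \<in> Basis" for b
    using borel_measurable_integrable[OF f[OF that]] by simp
  interpret product_sigma_finite "\<lambda>b::'a. lborel :: real measure" ..
  show ?thesis
    unfolding lborel_eq[where 'a='a]
    by (subst integral_distr) (auto simp: product_integral_prod f)
qed

definition gaussian :: "'a::real_normed_vector \<Rightarrow> real" where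
  "gaussian x = exp (- (norm x)\<^sup>2 / 2)"

lemma gaussian_measurable [measurable]: "gaussian \<in> borel_measurable borel"
  unfolding gaussian_def[abs_def] by measurable

lemma gaussian_pos: "0 < gaussian x" and gaussian_le_1: "gaussian x \<le> 1"
  by (auto simp: gaussian_def)

text \<open>Up to the factor sqrt(2 pi) the integral is the characteristic function of the standard
  normal distribution.\<close>

lemma gaussian_real:
  "integrable lborel (\<lambda>t::real. cis (s * t) * complex_of_real (gaussian t))"
  "(\<integral>(t::real). cis (s * t) * complex_of_real (gaussian t) \<partial>lborel) = complex_of_real (sqrt (2 * pi) * gaussian s)"
proof -
  have g: "complex_of_real (gaussian t) = sqrt (2 * pi) * complex_of_real (std_normal_density t)" for t :: real
    by (simp add: gaussian_def std_normal_density_def)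
  have i: "integrable lborel (\<lambda>t. complex_of_real (std_normal_density t))"
    by (intro integrable_of_real integrable_normal_density) auto
  show "integrable lborel (\<lambda>t::real. cis (s * t) * complex_of_real (gaussian t))"
    unfolding g
    by (rule Bochner_Integration.integrable_bound[OF integrable_mult_right[OF i, of "sqrt (2 * pi)"]])
       (auto simp: norm_mult)
  have "(\<integral>(t::real). cis (s * t) * complex_of_real (gaussian t) \<partial>lborel)
    = sqrt (2 * pi) * (\<integral>t. std_normal_density t *\<^sub>R iexp (s * t) \<partial>lborel)"
    unfolding g integral_mult_right_zero[symmetric]
    by (rule Bochner_Integration.integral_cong) (auto simp: cis_conv_exp scaleR_conv_of_real mult_ac)
  also have "(\<integral>t. std_normal_density t *\<^sub>R iexp (s * t) \<partial>lborel) = char std_normal_distribution s"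
    unfolding char_def by (subst integral_density) auto
  also have "\<dots> = complex_of_real (gaussian s)"
    by (simp add: char_std_normal_distribution gaussian_def)
  finally show "(\<integral>(t::real). cis (s * t) * complex_of_real (gaussian t) \<partial>lborel) = complex_of_real (sqrt (2 * pi) * gaussian s)"
    by simp
qed

lemma gaussian_prod:
  fixes x :: "'a::euclidean_space"
  shows "gaussian x = (\<Prod>b\<in>Basis. gaussian (x \<bullet> b))"
proof -
  have "(norm x)\<^sup>2 = (\<Sum>b\<in>Basis. (x \<bullet> b)\<^sup>2)"
    by (subst norm_eq_sqrt_inner, subst euclidean_inner) (simp add: power2_eq_square sum_nonneg)
  then show ?thesis
    by (simp add: gaussian_def exp_sum[symmetric] sum_negf[symmetric] sum_divide_distrib)
qed

lemma cis_sum: "finite A \<Longrightarrow> cis (\<Sum>a\<in>A. f a) = (\<Prod>a\<in>A. cis (f a))"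
  by (induction A rule: finite_induct) (auto simp: cis_mult[symmetric])

lemma gaussian_fourier:
  fixes x :: "'a::euclidean_space"
  shows "(\<integral>(y::'a). cis (x \<bullet> y) * complex_of_real (gaussian y) \<partial>lborel) = complex_of_real (sqrt (2 * pi) ^ DIM('a) * gaussian x)"
proof -
  have "cis (x \<bullet> y) * complex_of_real (gaussian y) = (\<Prod>b\<in>Basis. cis ((x \<bullet> b) * (y \<bullet> b)) * complex_of_real (gaussian (y \<bullet> b)))" for y :: 'a
    by (subst euclidean_inner) (simp add: gaussian_prod[of y] cis_sum prod.distrib)
  then have "(\<integral>(y::'a). cis (x \<bullet> y) * complex_of_real (gaussian y) \<partial>lborel)
      = (\<integral>(y::'a). (\<Prod>b\<in>Basis. (\<lambda>b t. cis ((x \<bullet> b) * t) * complex_of_real (gaussian t)) b (y \<bullet> b)) \<partial>lborel)"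
    by simp
  also have "\<dots> = (\<Prod>b\<in>Basis. complex_of_real (sqrt (2 * pi) * gaussian (x \<bullet> b)))"
    by (subst lborel_integral_prod) (auto simp: gaussian_real simp del: of_real_mult)
  also have "\<dots> = complex_of_real (sqrt (2 * pi) ^ DIM('a) * gaussian x)"
    by (simp add: prod.distrib gaussian_prod[of x])
  finally show ?thesis .
qed

text \<open>By contraposition: a non-integrable function would have Bochner integral 0, but the
  transform at the origin has been computed to be nonzero.\<close>

lemma gaussian_integrable: "integrable lborel (gaussian :: 'a::euclidean_space \<Rightarrow> real)"
proof -
  have "complex_of_real (sqrt (2 * pi) ^ DIM('a) * gaussian (0::'a)) \<noteq> 0"
    using gaussian_pos[of "0::'a"] by auto
  then have "integrable lborel (\<lambda>y::'a. cis (0 \<bullet> y) * complex_of_real (gaussian y))"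
    using gaussian_fourier[of "0::'a"] not_integrable_integral_eq by metis
  moreover have "\<bar>gaussian x\<bar> = gaussian x" for x :: 'a
    using gaussian_pos[of x] by simp
  ultimately show ?thesis
    using integrable_norm by (fastforce simp: norm_mult)
qed

section \<open>Fourier inversion and convolution kernels\<close>

text \<open>Criterion for exchanging integrals: a majorant of product form. Oscillating factors have
  modulus 1 and so do not disturb such a majorant.\<close>

lemma integrable_kernel_product:
  fixes f :: "'a::euclidean_space \<Rightarrow> 'c::{real_normed_algebra, banach, second_countable_topology}" and g :: "'b::euclidean_space \<Rightarrow> 'c"
  assumes f: "integrable lborel f" and g: "integrable lborel g"
    and F[measurable]: "F \<in> borel_measurable (borel \<Otimes>\<^sub>M borel)" and le: "\<And>x y. norm (F (x, y)) \<le> C * (norm (f x) * norm (g y))"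
  shows "integrable (lborel \<Otimes>\<^sub>M lborel) (F :: 'a \<times> 'b \<Rightarrow> 'c)"
proof (rule integrableI_bounded)
  have [measurable]: "f \<in> borel_measurable borel" "g \<in> borel_measurable borel"
    using f g by auto
  have "(\<integral>\<^sup>+p. ennreal (norm (F p)) \<partial>(lborel \<Otimes>\<^sub>M lborel)) = (\<integral>\<^sup>+x. \<integral>\<^sup>+y. ennreal (norm (F (x, y))) \<partial>lborel \<partial>lborel)"
    by (subst lborel.nn_integral_fst[symmetric]) auto
  also have "\<dots> \<le> (\<integral>\<^sup>+x. \<integral>\<^sup>+y. ennreal \<bar>C\<bar> * (ennreal (norm (f x)) * ennreal (norm (g y))) \<partial>lborel \<partial>lborel)"
  proof (intro nn_integral_mono)
    fix x :: 'a and y :: 'b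
    have "norm (F (x, y)) \<le> \<bar>C\<bar> * (norm (f x) * norm (g y))"
      by (rule order_trans[OF le]) (intro mult_right_mono, auto)
    then show "ennreal (norm (F (x, y))) \<le> ennreal \<bar>C\<bar> * (ennreal (norm (f x)) * ennreal (norm (g y)))"
      by (simp add: ennreal_mult[symmetric] ennreal_leI)
  qed
  also have "\<dots> = ennreal \<bar>C\<bar> * ((\<integral>\<^sup>+x. ennreal (norm (f x)) \<partial>lborel) * (\<integral>\<^sup>+y. ennreal (norm (g y)) \<partial>lborel))"
    by (simp add: nn_integral_cmult nn_integral_multc)
  also have "\<dots> < \<infinity>"
    using f g by (simp add: integrable_iff_bounded ennreal_mult_less_top)
  finally show "(\<integral>\<^sup>+p. ennreal (norm (F p)) \<partial>(lborel \<Otimes>\<^sub>M lborel)) < \<infinity>" .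
qed simp

text \<open>Fourier inversion at the origin, by Gaussian regularisation.\<close>
lemma integral_oscint:
  assumes g: "symbol g"
  shows "(\<integral>y. oscint g y \<partial>lborel) = complex_of_real ((2 * pi) ^ 3) * g 0"
proof -
  note [measurable] = symbolD(4)[OF g] rapid_measurable[OF rapid_oscint[OF g]]
  define c where "c = sqrt (2 * pi)"
  define e where "e n = 1 / real (Suc n)" for n
  have e: "e n > 0" for n by (simp add: e_def)
  have e0: "e \<longlonglongrightarrow> 0"
    using LIMSEQ_inverse_real_of_nat by (simp add: e_def[abs_def] inverse_eq_divide del: of_nat_Suc)
  have cont_gauss: "continuous_on UNIV (gaussian :: real^3 \<Rightarrow> real)"
    unfolding gaussian_def[abs_def] by (intro continuous_intros) auto
  have io: "integrable lborel (oscint g)"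
    by (rule rapid_integrable[OF rapid_oscint[OF g]])
  have limg: "(\<lambda>n. F (e n *\<^sub>R y)) \<longlonglongrightarrow> F 0" if "continuous_on UNIV F" for F :: "real^3 \<Rightarrow> 'x::real_normed_vector" and y
  proof -
    have "(\<lambda>n. e n *\<^sub>R y) \<longlonglongrightarrow> 0"
      using tendsto_scaleR[OF e0 tendsto_const[of y]] by simp
    then show ?thesis
      using that by (intro continuous_on_tendsto_compose[OF that]) auto
  qed
  obtain B where B: "\<And>x. norm (g x) \<le> B" using symbolD(5)[OF g] by blast
  have lhs: "(\<lambda>n. \<integral>y. oscint g y * complex_of_real (gaussian (e n *\<^sub>R y)) \<partial>lborel) \<longlonglongrightarrow> (\<integral>y. oscint g y \<partial>lborel)"
  proof (rule integral_dominated_convergence[where w="\<lambda>y. norm (oscint g y)"])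
    have "(\<lambda>n. oscint g y * complex_of_real (gaussian (e n *\<^sub>R y))) \<longlonglongrightarrow> oscint g y * complex_of_real (gaussian (0::real^3))" for y
      by (intro tendsto_intros limg cont_gauss)
    then show "AE y in lborel. (\<lambda>n. oscint g y * complex_of_real (gaussian (e n *\<^sub>R y))) \<longlonglongrightarrow> oscint g y"
      by (simp add: gaussian_def)
    show "AE y in lborel. norm (oscint g y * complex_of_real (gaussian (e n *\<^sub>R y))) \<le> norm (oscint g y)" for n
      by (intro AE_I2) (simp add: norm_mult abs_of_pos[OF gaussian_pos] gaussian_le_1 mult_right_le_one_le less_imp_le[OF gaussian_pos])
  qed (use io in auto)
  have rhs: "(\<lambda>n. \<integral>y. g (e n *\<^sub>R y) * complex_of_real (gaussian y) \<partial>lborel) \<longlonglongrightarrow> (\<integral>(y::real^3). g 0 * complex_of_real (gaussian y) \<partial>lborel)"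
  proof (rule integral_dominated_convergence[where w="\<lambda>y. B * gaussian y"])
    show "AE y in lborel. (\<lambda>n. g (e n *\<^sub>R y) * complex_of_real (gaussian y)) \<longlonglongrightarrow> g 0 * complex_of_real (gaussian y)"
      by (intro AE_I2 tendsto_intros limg smooth_continuous symbolD(1)[OF g])
    show "AE y in lborel. norm (g (e n *\<^sub>R y) * complex_of_real (gaussian y)) \<le> B * gaussian y" for n
      by (intro AE_I2) (simp add: norm_mult abs_of_pos[OF gaussian_pos] less_imp_le[OF gaussian_pos] B mult_right_mono)
  qed (use gaussian_integrable in auto)
  \<comment> \<open>The exchange of integrals makes the Gaussian factor the one that is transformed;
    substituting \<open>\<xi>\<close> = e y afterwards cancels the powers of e produced by its
    scaling.\<close>
  have eq: "(\<integral>y. oscint g y * complex_of_real (gaussian (e n *\<^sub>R y)) \<partial>lborel) = complex_of_real (c ^ 3) * (\<integral>y. g (e n *\<^sub>R y) * complex_of_real (gaussian y) \<partial>lborel)" for n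
  proof -
    have ig: "integrable lborel (\<lambda>y::real^3. complex_of_real (gaussian (e n *\<^sub>R y)))"
      using lborel_integrable_affine[OF gaussian_integrable[where 'a="real^3"], of "e n" 0] e[of n] by simp
    have inner: "(\<integral>y. cis (y \<bullet> \<xi>) * complex_of_real (gaussian (e n *\<^sub>R y)) \<partial>lborel) = complex_of_real (c ^ 3 / e n ^ 3 * gaussian ((1 / e n) *\<^sub>R \<xi>))" for \<xi> :: "real^3"
    proof -
      have "(\<integral>y. cis ((1 / e n) *\<^sub>R \<xi> \<bullet> y) * complex_of_real (gaussian y) \<partial>lborel)
          = e n ^ 3 *\<^sub>R (\<integral>y. cis (y \<bullet> \<xi>) * complex_of_real (gaussian (e n *\<^sub>R y)) \<partial>lborel)"
        using lborel_integral_affine[of "\<lambda>y. cis ((1 / e n) *\<^sub>R \<xi> \<bullet> y) * complex_of_real (gaussian y)" "e n" 0] e[of n]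
        by (simp add: inner_commute)
      moreover have "(\<integral>y. cis ((1 / e n) *\<^sub>R \<xi> \<bullet> y) * complex_of_real (gaussian y) \<partial>lborel) = complex_of_real (c ^ 3 * gaussian ((1 / e n) *\<^sub>R \<xi>))"
        using gaussian_fourier[of "(1 / e n) *\<^sub>R \<xi>"] by (simp add: c_def)
      ultimately show ?thesis
        using e[of n] by (simp add: scaleR_conv_of_real eq_divide_eq mult_ac)
    qed
    have "(\<integral>y. oscint g y * complex_of_real (gaussian (e n *\<^sub>R y)) \<partial>lborel)
      = (\<integral>y. (\<integral>\<xi>. cis (y \<bullet> \<xi>) * g \<xi> * complex_of_real (gaussian (e n *\<^sub>R y)) \<partial>lborel) \<partial>lborel)"
      unfolding oscint_def by (simp only: integral_mult_left_zero)
    also have "\<dots> = (\<integral>\<xi>. (\<integral>y. cis (y \<bullet> \<xi>) * g \<xi> * complex_of_real (gaussian (e n *\<^sub>R y)) \<partial>lborel) \<partial>lborel)"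
    proof (rule lborel_pair.Fubini_integral[symmetric])
      show "integrable (lborel \<Otimes>\<^sub>M lborel) (\<lambda>(y, \<xi>). cis (y \<bullet> \<xi>) * g \<xi> * complex_of_real (gaussian (e n *\<^sub>R y)))"
        by (rule integrable_kernel_product[OF ig symbolD(3)[OF g], where C=1]) (auto simp: norm_mult)
    qed
    also have "\<dots> = (\<integral>\<xi>. complex_of_real (c ^ 3 / e n ^ 3) * (g \<xi> * complex_of_real (gaussian ((1 / e n) *\<^sub>R \<xi>))) \<partial>lborel)"
    proof (rule Bochner_Integration.integral_cong[OF refl])
      fix \<xi> :: "real^3"
      have "(\<integral>y. cis (y \<bullet> \<xi>) * g \<xi> * complex_of_real (gaussian (e n *\<^sub>R y)) \<partial>lborel) = g \<xi> * (\<integral>y. cis (y \<bullet> \<xi>) * complex_of_real (gaussian (e n *\<^sub>R y)) \<partial>lborel)"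
        by (subst integral_mult_right_zero[symmetric]) (simp add: mult_ac)
      then show "(\<integral>y. cis (y \<bullet> \<xi>) * g \<xi> * complex_of_real (gaussian (e n *\<^sub>R y)) \<partial>lborel) = complex_of_real (c ^ 3 / e n ^ 3) * (g \<xi> * complex_of_real (gaussian ((1 / e n) *\<^sub>R \<xi>)))"
        by (simp add: inner mult_ac)
    qed
    also have "\<dots> = complex_of_real (c ^ 3 / e n ^ 3) * (\<integral>\<xi>. g \<xi> * complex_of_real (gaussian ((1 / e n) *\<^sub>R \<xi>)) \<partial>lborel)"
      by (rule integral_mult_right_zero)
    also have "(\<integral>\<xi>. g \<xi> * complex_of_real (gaussian ((1 / e n) *\<^sub>R \<xi>)) \<partial>lborel) = e n ^ 3 *\<^sub>R (\<integral>y. g (e n *\<^sub>R y) * complex_of_real (gaussian y) \<partial>lborel)"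
      using lborel_integral_affine[of "\<lambda>\<xi>. g \<xi> * complex_of_real (gaussian ((1 / e n) *\<^sub>R \<xi>))" "e n" 0] e[of n] by simp
    finally show ?thesis
      using e[of n] by (simp add: scaleR_conv_of_real)
  qed
  have "(\<integral>(y::real^3). g 0 * complex_of_real (gaussian y) \<partial>lborel) = g 0 * complex_of_real (c ^ 3)"
    using gaussian_fourier[of "0::real^3"] by (simp add: c_def gaussian_def)
  moreover have "(\<lambda>n. \<integral>y. oscint g y * complex_of_real (gaussian (e n *\<^sub>R y)) \<partial>lborel) \<longlonglongrightarrow> complex_of_real (c ^ 3) * (\<integral>(y::real^3). g 0 * complex_of_real (gaussian y) \<partial>lborel)"
    unfolding eq by (intro tendsto_intros rhs)
  ultimately have "(\<integral>y. oscint g y \<partial>lborel) = complex_of_real (c ^ 3) * (g 0 * complex_of_real (c ^ 3))"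
    using LIMSEQ_unique[OF lhs] by simp
  \<comment> \<open>One factor c^3 comes from the transform of the Gaussian, the other from its
    total mass.\<close>
  also have "c ^ 3 * c ^ 3 = (2 * pi) ^ 3"
    unfolding c_def power_mult_distrib[symmetric] by simp
  then have "complex_of_real (c ^ 3) * (g 0 * complex_of_real (c ^ 3)) = complex_of_real ((2 * pi) ^ 3) * g 0"
    by (metis mult.assoc mult.commute of_real_mult)
  finally show ?thesis .
qed

text \<open>Inversion at a general frequency reduces to inversion at the origin, because translating
  the symbol multiplies its transform by a character.\<close>

lemma fourier_oscint:
  assumes g: "symbol g"
  shows "(\<integral>y. cis (- (y \<bullet> \<xi>)) * oscint g y \<partial>lborel) = complex_of_real ((2 * pi) ^ 3) * g \<xi>"
proof -
  note [measurable] = symbolD(4)[OF g]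
  have "oscint (\<lambda>\<eta>. g (\<xi> + \<eta>)) y = cis (- (y \<bullet> \<xi>)) * oscint g y" for y
  proof -
    have "oscint g y = (\<integral>\<eta>. cis (y \<bullet> (\<eta> + \<xi>)) * g (\<eta> + \<xi>) \<partial>lborel)"
      unfolding oscint_def by (rule lborel_integral_shift[symmetric]) measurable
    also have "\<dots> = (\<integral>\<eta>. cis (y \<bullet> \<xi>) * (cis (y \<bullet> \<eta>) * g (\<xi> + \<eta>)) \<partial>lborel)"
      by (rule Bochner_Integration.integral_cong) (auto simp: inner_add_right cis_mult[symmetric] add.commute mult_ac)
    also have "\<dots> = cis (y \<bullet> \<xi>) * oscint (\<lambda>\<eta>. g (\<xi> + \<eta>)) y"
      unfolding oscint_def by (rule integral_mult_right_zero)
    finally show ?thesis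
      by (simp add: mult.assoc[symmetric] cis_mult)
  qed
  then show ?thesis
    using integral_oscint[OF symbol_shift[OF g, of \<xi>]] by simp
qed

section \<open>Real even symbols and their convolution kernels\<close>

definition even_symbol :: "(real^3 \<Rightarrow> real) \<Rightarrow> bool" where
  "even_symbol m \<longleftrightarrow> smooth m \<and> bounded_support m \<and> (\<forall>\<xi>. m (- \<xi>) = m \<xi>)"

text \<open>The inverse Fourier transform of m. The real part makes the kernel real by construction;
  for even m it discards nothing, by \<open>oscint_even_symbol\<close>.\<close>

definition kern :: "(real^3 \<Rightarrow> real) \<Rightarrow> real^3 \<Rightarrow> real" where
  "kern m x = Re (oscint (\<lambda>\<xi>. complex_of_real (m \<xi>)) x) / (2 * pi) ^ 3"

lemma even_symbol_symbol: "even_symbol m \<Longrightarrow> symbol (\<lambda>\<xi>. complex_of_real (m \<xi>))"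
  unfolding even_symbol_def symbol_def
  using smooth_bounded_linear[OF bounded_linear_of_real] by (auto simp: bounded_support_def)

lemma even_symbol_measurable: "even_symbol m \<Longrightarrow> m \<in> borel_measurable borel"
  using smooth_continuous[of m] by (auto simp: even_symbol_def intro: borel_measurable_continuous_onI)

text \<open>Conjugation reverses the phase, and for even m the reflection of \<open>\<xi>\<close>
  undoes this, so the integral is its own conjugate.\<close>

lemma oscint_even_symbol:
  assumes m: "even_symbol m"
  shows "oscint (\<lambda>\<xi>. complex_of_real (m \<xi>)) x = complex_of_real ((2 * pi) ^ 3 * kern m x)"
proof -
  note [measurable] = even_symbol_measurable[OF m]
  let ?I = "oscint (\<lambda>\<xi>. complex_of_real (m \<xi>)) x"
  have "cnj ?I = (\<integral>\<xi>. cis (- (x \<bullet> \<xi>)) * complex_of_real (m \<xi>) \<partial>lborel)"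
    unfolding oscint_def by (simp add: cis_cnj flip: Bochner_Integration.integral_cnj)
  also have "\<dots> = ?I"
    using lborel_integral_reflect[of "\<lambda>\<xi>. cis (x \<bullet> \<xi>) * complex_of_real (m \<xi>)" 0] m
    by (simp add: oscint_def even_symbol_def)
  finally have "Im ?I = 0"
    by (metis Im_complex_of_real Reals_cnj_iff complex_is_Real_iff)
  then show ?thesis
    by (simp add: kern_def complex_eq_iff)
qed

lemma rapid_kern:
  assumes m: "even_symbol m"
  shows "rapid (kern m)"
proof -
  have "bounded_linear (\<lambda>z. Re z / (2 * pi) ^ 3)"
    by (intro bounded_linear_compose[OF bounded_linear_divide bounded_linear_Re])
  from rapid_bounded_linear[OF this rapid_oscint[OF even_symbol_symbol[OF m]]]
  show ?thesis by (simp add: kern_def[abs_def])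
qed

lemma integral_kern:
  assumes m: "even_symbol m"
  shows "(\<integral>y. kern m y \<partial>lborel) = m 0"
  using integral_oscint[OF even_symbol_symbol[OF m]]
  unfolding oscint_even_symbol[OF m] by (simp del: of_real_mult of_real_power add: of_real_mult[symmetric])

lemma even_symbol_mult: "even_symbol m \<Longrightarrow> even_symbol n \<Longrightarrow> even_symbol (\<lambda>\<xi>. m \<xi> * n \<xi>)"
  by (simp add: even_symbol_def smooth_mult bounded_support_mult)

text \<open>With the first kernel written as an oscillatory integral and the integrals exchanged,
  the inner one is the Fourier transform of the second kernel, which \<open>fourier_oscint\<close>
  identifies with its symbol.\<close>

lemma kern_convolution:
  assumes m: "even_symbol m" and n: "even_symbol n"
  shows "(\<integral>y. kern m (x - y) * kern n y \<partial>lborel) = kern (\<lambda>\<xi>. m \<xi> * n \<xi>) x"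
proof -
  let ?c = "(2 * pi) ^ 3 :: real"
  let ?m = "\<lambda>\<xi>. complex_of_real (m \<xi>)" and ?n = "\<lambda>\<xi>. complex_of_real (n \<xi>)"
  have ik: "integrable lborel (\<lambda>y. complex_of_real (kern n y))"
    by (intro integrable_of_real rapid_integrable rapid_kern n)
  note [measurable] = even_symbol_measurable[OF m] even_symbol_measurable[OF n] rapid_measurable[OF rapid_kern[OF m]] rapid_measurable[OF rapid_kern[OF n]]
  have F: "(\<integral>y. cis (- (y \<bullet> \<xi>)) * complex_of_real (kern n y) \<partial>lborel) = ?n \<xi>" for \<xi>
  proof -
    have "complex_of_real ?c * (\<integral>y. cis (- (y \<bullet> \<xi>)) * complex_of_real (kern n y) \<partial>lborel) = complex_of_real ?c * ?n \<xi>"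
      unfolding fourier_oscint[OF even_symbol_symbol[OF n], symmetric] oscint_even_symbol[OF n]
      by (subst integral_mult_right_zero[symmetric]) (simp add: mult_ac)
    then show ?thesis by simp
  qed
  have "complex_of_real (?c * (\<integral>y. kern m (x - y) * kern n y \<partial>lborel)) = (\<integral>y. complex_of_real (?c * kern m (x - y)) * complex_of_real (kern n y) \<partial>lborel)"
    by (simp flip: of_real_mult integral_mult_right_zero integral_complex_of_real add: mult.assoc)
  also have "\<dots> = (\<integral>y. (\<integral>\<xi>. cis ((x - y) \<bullet> \<xi>) * ?m \<xi> * complex_of_real (kern n y) \<partial>lborel) \<partial>lborel)"
    unfolding oscint_even_symbol[OF m, symmetric] oscint_def by (simp only: integral_mult_left_zero)
  also have "\<dots> = (\<integral>\<xi>. (\<integral>y. cis ((x - y) \<bullet> \<xi>) * ?m \<xi> * complex_of_real (kern n y) \<partial>lborel) \<partial>lborel)"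
  proof (rule lborel_pair.Fubini_integral[symmetric])
    show "integrable (lborel \<Otimes>\<^sub>M lborel) (\<lambda>(y, \<xi>). cis ((x - y) \<bullet> \<xi>) * ?m \<xi> * complex_of_real (kern n y))"
      by (rule integrable_kernel_product[OF ik symbolD(3)[OF even_symbol_symbol[OF m]], where C=1]) (auto simp: norm_mult)
  qed
  also have "\<dots> = (\<integral>\<xi>. cis (x \<bullet> \<xi>) * complex_of_real (m \<xi> * n \<xi>) \<partial>lborel)"
  proof (rule Bochner_Integration.integral_cong[OF refl])
    fix \<xi>
    have "(\<integral>y. cis ((x - y) \<bullet> \<xi>) * ?m \<xi> * complex_of_real (kern n y) \<partial>lborel)
      = (\<integral>y. (cis (x \<bullet> \<xi>) * ?m \<xi>) * (cis (- (y \<bullet> \<xi>)) * complex_of_real (kern n y)) \<partial>lborel)"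
      by (rule Bochner_Integration.integral_cong) (simp_all add: inner_diff_left cis_mult mult_ac flip: diff_conv_add_uminus)
    also have "\<dots> = (cis (x \<bullet> \<xi>) * ?m \<xi>) * ?n \<xi>"
      by (simp only: integral_mult_right_zero F)
    finally show "(\<integral>y. cis ((x - y) \<bullet> \<xi>) * ?m \<xi> * complex_of_real (kern n y) \<partial>lborel) = cis (x \<bullet> \<xi>) * complex_of_real (m \<xi> * n \<xi>)"
      by (simp add: mult.assoc)
  qed
  also have "\<dots> = complex_of_real (?c * kern (\<lambda>\<xi>. m \<xi> * n \<xi>) x)"
    using oscint_even_symbol[OF even_symbol_mult[OF m n]] by (simp add: oscint_def)
  finally show ?thesis by (simp del: of_real_mult)
qed

text \<open>Dilation normalised in L^1: for l > 0 it preserves the integral and, by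
  \<open>kern_scale\<close>, corresponds to stretching the symbol to frequency scale l.\<close>

definition dilate :: "real \<Rightarrow> (real^3 \<Rightarrow> real) \<Rightarrow> real^3 \<Rightarrow> real" where
  "dilate l h x = l ^ 3 * h (l *\<^sub>R x)"

lemma even_symbol_scale:
  assumes m: "even_symbol m" and l: "l > 0"
  shows "even_symbol (\<lambda>\<xi>. m ((1 / l) *\<^sub>R \<xi>))"
proof -
  obtain R where R: "R > 0" "\<And>x. norm x \<ge> R \<Longrightarrow> m x = 0"
    using m by (auto simp: even_symbol_def bounded_support_def)
  have "m ((1 / l) *\<^sub>R \<xi>) = 0" if "norm \<xi> \<ge> l * R" for \<xi>
    using that l by (intro R) (simp add: field_simps)
  then show ?thesis
    using m l R smooth_affine[of m 0 "1 / l"] 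
    by (auto simp: even_symbol_def bounded_support_def intro!: exI[of _ "l * R"])
qed

lemma kern_scale:
  assumes m: "even_symbol m" and l: "l > 0"
  shows "kern (\<lambda>\<xi>. m ((1 / l) *\<^sub>R \<xi>)) = dilate l (kern m)"
proof
  fix x
  note [measurable] = even_symbol_measurable[OF m]
  have "oscint (\<lambda>\<xi>. complex_of_real (m ((1 / l) *\<^sub>R \<xi>))) x = l ^ 3 *\<^sub>R oscint (\<lambda>\<xi>. complex_of_real (m \<xi>)) (l *\<^sub>R x)"
    unfolding oscint_def
    using lborel_integral_affine[of "\<lambda>\<xi>. cis (x \<bullet> \<xi>) * complex_of_real (m ((1 / l) *\<^sub>R \<xi>))" l 0] l by simp
  then show "kern (\<lambda>\<xi>. m ((1 / l) *\<^sub>R \<xi>)) x = dilate l (kern m) x"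
    by (simp add: kern_def dilate_def)
qed

lemma kern_diff:
  assumes m: "even_symbol m" and n: "even_symbol n"
  shows "kern (\<lambda>\<xi>. m \<xi> - n \<xi>) = (\<lambda>x. kern m x - kern n x)"
proof
  fix x
  have "oscint (\<lambda>\<xi>. complex_of_real (m \<xi> - n \<xi>)) x = oscint (\<lambda>\<xi>. complex_of_real (m \<xi>)) x - oscint (\<lambda>\<xi>. complex_of_real (n \<xi>)) x"
    unfolding oscint_def
    using oscint_integrable[OF symbolD(3)[OF even_symbol_symbol[OF m]]] oscint_integrable[OF symbolD(3)[OF even_symbol_symbol[OF n]]]
    by (simp add: right_diff_distrib)
  then show "kern (\<lambda>\<xi>. m \<xi> - n \<xi>) x = kern m x - kern n x"
    by (simp add: kern_def diff_divide_distrib)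
qed

lemma even_symbol_diff:
  assumes m: "even_symbol m" and n: "even_symbol n"
  shows "even_symbol (\<lambda>\<xi>. m \<xi> - n \<xi>)"
proof -
  obtain R where R: "R > 0" "\<And>x. norm x \<ge> R \<Longrightarrow> m x = 0"
    using m by (auto simp: even_symbol_def bounded_support_def)
  obtain S where S: "S > 0" "\<And>x. norm x \<ge> S \<Longrightarrow> n x = 0"
    using n by (auto simp: even_symbol_def bounded_support_def)
  show ?thesis
    using m n R S by (auto simp: even_symbol_def bounded_support_def smooth_diff intro!: exI[of _ "max R S"])
qed

section \<open>Fourier multipliers as convolutions\<close>

text \<open>A space that contains both L^1 and L^2, since multipliers act on the components of u and
  on their products. Its weight is dominated by the decay of any \<open>rapid\<close>
  kernel.\<close>

definition slow_growth :: "(real^3 \<Rightarrow> real) \<Rightarrow> bool" where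
  "slow_growth f \<longleftrightarrow> f \<in> borel_measurable borel \<and> integrable lborel (\<lambda>x. f x / (1 + norm x) ^ 4)"

definition convolve :: "(real^3 \<Rightarrow> real) \<Rightarrow> (real^3 \<Rightarrow> real) \<Rightarrow> real^3 \<Rightarrow> real" where
  "convolve h f x = (\<integral>y. h (x - y) * f y \<partial>lborel)"

lemma slow_growth_measurable: "slow_growth f \<Longrightarrow> f \<in> borel_measurable borel"
  by (simp add: slow_growth_def)

lemma one_plus_norm_power_pos: "0 < (1 + norm x) ^ k"
  by (intro zero_less_power add_pos_nonneg) auto

lemma slow_growth_integrable:
  assumes "integrable lborel f"
  shows "slow_growth f"
proof -
  have [measurable]: "f \<in> borel_measurable borel" using assms by auto
  have "1 \<le> (1 + norm x) ^ 4" for x :: "real^3" by (rule one_le_power) simp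
  then have "\<bar>f x\<bar> / (1 + norm x) ^ 4 \<le> \<bar>f x\<bar> / 1" for x
    using one_plus_norm_power_pos[of _ 4] by (intro divide_left_mono) auto
  then show ?thesis
    unfolding slow_growth_def
    by (auto intro!: Bochner_Integration.integrable_bound[OF assms])
qed

text \<open>From 2 |f| w <= f^2 + w^2 with w = (1 + |x|)^-4, where w^2 <= w and w is
  integrable.\<close>

lemma slow_growth_square_integrable:
  assumes [measurable]: "f \<in> borel_measurable borel" and f: "integrable lborel (\<lambda>x. (f x)\<^sup>2)"
  shows "slow_growth f"
proof -
  have i: "integrable lborel (\<lambda>x. (f x)\<^sup>2 + 1 / (1 + norm x) ^ 4)"
    using f integrable_inverse_norm_power4[of 1] by simp
  have "\<bar>f x\<bar> / (1 + norm x) ^ 4 \<le> (f x)\<^sup>2 + 1 / (1 + norm x) ^ 4" for x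
  proof -
    define w where "w = 1 / (1 + norm x) ^ 4"
    have w: "0 \<le> w" "w \<le> 1"
      using one_plus_norm_power_pos[of x 4] by (auto simp: w_def one_le_power)
    have "2 * (\<bar>f x\<bar> * w) \<le> (f x)\<^sup>2 + w\<^sup>2"
      using sum_squares_bound[of "\<bar>f x\<bar>" w] by simp
    also have "w\<^sup>2 \<le> w" using w by (simp add: power2_eq_square mult_left_le)
    finally have "2 * (\<bar>f x\<bar> * w) \<le> (f x)\<^sup>2 + w" by simp
    moreover have "0 \<le> \<bar>f x\<bar> * w" using w by simp
    ultimately have "\<bar>f x\<bar> * w \<le> (f x)\<^sup>2 + w" by linarith
    then show ?thesis by (simp add: w_def)
  qed
  then show ?thesis
    unfolding slow_growth_def
    by (auto intro!: Bochner_Integration.integrable_bound[OF i])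
qed

text \<open>Peetre's inequality: 1 + |y| is at most (1 + |x - y|) (1 + |x|).\<close>

lemma norm_weight_le:
  fixes x y :: "'a::real_normed_vector"
  shows "1 / (1 + norm (x - y)) ^ k \<le> (1 + norm x) ^ k / (1 + norm y) ^ k"
proof -
  have "norm y \<le> norm (x - y) + norm x"
    using norm_triangle_ineq4[of x "x - y"] by simp
  then have "1 + norm y \<le> (1 + norm (x - y)) * (1 + norm x)"
    using mult_nonneg_nonneg[OF norm_ge_zero[of "x - y"] norm_ge_zero[of x]]
    unfolding distrib_left distrib_right mult_1_left mult_1_right by linarith
  then have "(1 + norm y) ^ k \<le> (1 + norm (x - y)) ^ k * (1 + norm x) ^ k"
    using power_mono[of "1 + norm y"] by (simp add: power_mult_distrib[symmetric])
  moreover have "0 < (1 + norm y) ^ k" "0 < (1 + norm (x - y)) ^ k"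
    by (auto intro!: zero_less_power add_pos_nonneg)
  ultimately show ?thesis by (simp add: field_simps)
qed

section \<open>Convolution of a rapidly decaying kernel with a slowly growing function\<close>

lemma slow_growth_weight:
  assumes f: "slow_growth f"
  shows "integrable lborel (\<lambda>y. \<bar>f y\<bar> / (1 + norm (x - y)) ^ 4)"
proof (rule Bochner_Integration.integrable_bound)
  note [measurable] = slow_growth_measurable[OF f]
  show "integrable lborel (\<lambda>y. (1 + norm x) ^ 4 * (f y / (1 + norm y) ^ 4))"
    using f unfolding slow_growth_def by (intro integrable_mult_right) simp
  show "AE y in lborel. norm (\<bar>f y\<bar> / (1 + norm (x - y)) ^ 4) \<le> norm ((1 + norm x) ^ 4 * (f y / (1 + norm y) ^ 4))"
    using mult_left_mono[OF norm_weight_le[of x _ 4] abs_ge_zero[of "f _"]]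
    by (auto simp: abs_mult mult.commute)
qed (use slow_growth_measurable[OF f] in measurable)

lemma convolve_integrable:
  assumes h: "rapid h" and f: "slow_growth f"
  shows "integrable lborel (\<lambda>y. h (x - y) * f y)"
proof -
  note [measurable] = slow_growth_measurable[OF f] rapid_measurable[OF h]
  obtain B where B: "B > 0" "\<And>x. norm (h x) \<le> B / (1 + norm x) ^ 4"
    using rapid_decay[OF h] by blast
  show ?thesis
  proof (rule Bochner_Integration.integrable_bound[OF integrable_mult_right[OF slow_growth_weight[OF f, of x], of B]])
    show "AE y in lborel. norm (h (x - y) * f y) \<le> norm (B * (\<bar>f y\<bar> / (1 + norm (x - y)) ^ 4))"
    proof (rule AE_I2)
      fix y
      have "\<bar>h (x - y)\<bar> * \<bar>f y\<bar> \<le> (B / (1 + norm (x - y)) ^ 4) * \<bar>f y\<bar>"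
        using B(2)[of "x - y"] by (intro mult_right_mono) auto
      then show "norm (h (x - y) * f y) \<le> norm (B * (\<bar>f y\<bar> / (1 + norm (x - y)) ^ 4))"
        using B(1) by (simp add: abs_mult)
    qed
  qed measurable
qed

lemma convolve_commute:
  assumes h: "rapid h" and f: "slow_growth f"
  shows "integrable lborel (\<lambda>y. h y * f (x - y))" "convolve h f x = (\<integral>y. h y * f (x - y) \<partial>lborel)"
proof -
  note [measurable] = slow_growth_measurable[OF f] rapid_measurable[OF h]
  show "integrable lborel (\<lambda>y. h y * f (x - y))"
    using lborel_integrable_reflect[OF convolve_integrable[OF h f, of x], of x] by simp
  show "convolve h f x = (\<integral>y. h y * f (x - y) \<partial>lborel)"
    unfolding convolve_def using lborel_integral_reflect[of "\<lambda>y. h (x - y) * f y" x] by simp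
qed

text \<open>By \<open>rapid_taylor\<close> the remainder of h at x - y is quadratic in v, with a
  weight in x - y that is integrable against f.\<close>

lemma convolve_has_derivative:
  assumes h: "rapid h" and f: "slow_growth f"
  shows "(convolve h f has_derivative (\<lambda>v. \<Sum>i\<in>UNIV. v $ i *\<^sub>R convolve (partial i h) f x)) (at x)"
proof -
  note [measurable] = slow_growth_measurable[OF f] rapid_measurable[OF h] rapid_measurable[OF rapid_partial[OF h]]
  obtain C where C: "C \<ge> 0"
    "\<And>y v. norm v \<le> 1 \<Longrightarrow> norm (h (y + v) - h y - (\<Sum>i\<in>UNIV. v $ i *\<^sub>R partial i h y)) \<le> C * (norm v)\<^sup>2 / (1 + norm y) ^ 4"
    using rapid_taylor[OF h, of 4] by blast
  let ?W = "\<integral>y. \<bar>f y\<bar> / (1 + norm (x - y)) ^ 4 \<partial>lborel"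
  show ?thesis
  proof (rule has_derivative_quadratic_error)
    show "bounded_linear (\<lambda>v::real^3. \<Sum>i\<in>UNIV. v $ i *\<^sub>R convolve (partial i h) f x)"
      by (intro bounded_linear_sum bounded_linear_compose[OF bounded_linear_scaleR_left] bounded_linear_vec_nth)
    fix v :: "real^3" assume v: "norm v \<le> 1"
    note i = convolve_integrable[OF h f] convolve_integrable[OF rapid_partial[OF h] f]
    have D: "(\<Sum>i\<in>UNIV. v $ i *\<^sub>R convolve (partial i h) f x) = (\<integral>y. (\<Sum>i\<in>UNIV. v $ i * (partial i h (x - y) * f y)) \<partial>lborel)"
      unfolding convolve_def using i by (subst Bochner_Integration.integral_sum) auto
    have iD: "integrable lborel (\<lambda>y. \<Sum>i\<in>UNIV. v $ i * (partial i h (x - y) * f y))"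
      using i by auto
    have "convolve h f (x + v) - convolve h f x - (\<Sum>i\<in>UNIV. v $ i *\<^sub>R convolve (partial i h) f x)
      = (\<integral>y. h (x + v - y) * f y - h (x - y) * f y - (\<Sum>i\<in>UNIV. v $ i * (partial i h (x - y) * f y)) \<partial>lborel)"
      unfolding D unfolding convolve_def
      by (simp only: Bochner_Integration.integral_diff Bochner_Integration.integrable_diff i iD)
    also have "norm \<dots> \<le> (\<integral>y. C * (norm v)\<^sup>2 * (\<bar>f y\<bar> / (1 + norm (x - y)) ^ 4) \<partial>lborel)"
    proof (rule order_trans[OF integral_norm_bound integral_mono])
      show "integrable lborel (\<lambda>y. norm (h (x + v - y) * f y - h (x - y) * f y - (\<Sum>i\<in>UNIV. v $ i * (partial i h (x - y) * f y))))"
        by (intro integrable_norm Bochner_Integration.integrable_diff i iD)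
      show "integrable lborel (\<lambda>y. C * (norm v)\<^sup>2 * (\<bar>f y\<bar> / (1 + norm (x - y)) ^ 4))"
        by (intro integrable_mult_right slow_growth_weight f)
      fix y
      have "h (x + v - y) * f y - h (x - y) * f y - (\<Sum>i\<in>UNIV. v $ i * (partial i h (x - y) * f y))
        = (h ((x - y) + v) - h (x - y) - (\<Sum>i\<in>UNIV. v $ i *\<^sub>R partial i h (x - y))) * f y"
        by (simp add: left_diff_distrib sum_distrib_right mult.assoc add_diff_eq diff_add_eq)
      then show "norm (h (x + v - y) * f y - h (x - y) * f y - (\<Sum>i\<in>UNIV. v $ i * (partial i h (x - y) * f y)))
         \<le> C * (norm v)\<^sup>2 * (\<bar>f y\<bar> / (1 + norm (x - y)) ^ 4)"
        using mult_right_mono[OF C(2)[OF v, of "x - y"] abs_ge_zero[of "f y"]] by (simp add: abs_mult)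
    qed
    also have "\<dots> = C * ?W * (norm v)\<^sup>2"
      by (subst integral_mult_right_zero) (simp add: mult_ac)
    finally show "norm (convolve h f (x + v) - convolve h f x - (\<Sum>i\<in>UNIV. v $ i *\<^sub>R convolve (partial i h) f x)) \<le> C * ?W * (norm v)\<^sup>2" .
  qed
qed

lemma partial_convolve:
  assumes h: "rapid h" and f: "slow_growth f"
  shows "partial i (convolve h f) = convolve (partial i h) f"
proof
  fix x
  show "partial i (convolve h f) x = convolve (partial i h) f x"
    using partial_eq[OF convolve_has_derivative[OF h f], of i x]
    by (simp add: axis_def if_distrib[of "\<lambda>c. c * _"] cong: if_cong)
qed

lemma convolve_differentiable: "rapid h \<Longrightarrow> slow_growth f \<Longrightarrow> convolve h f differentiable (at x)"
  by (rule differentiableI[OF convolve_has_derivative])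

lemma convolve_continuous: "rapid h \<Longrightarrow> slow_growth f \<Longrightarrow> continuous_on UNIV (convolve h f)"
  by (metis continuous_at_imp_continuous_on differentiable_imp_continuous_within convolve_differentiable)

lemma convolve_measurable: "rapid h \<Longrightarrow> slow_growth f \<Longrightarrow> convolve h f \<in> borel_measurable borel"
  by (rule borel_measurable_continuous_onI[OF convolve_continuous])

lemma convolve_diff_left:
  assumes "rapid h" "rapid k" "slow_growth f"
  shows "convolve (\<lambda>x. h x - k x) f x = convolve h f x - convolve k f x"
  unfolding convolve_def using convolve_integrable assms by (simp add: left_diff_distrib)

lemma convolve_test_integrable:
  fixes \<psi> :: "real^3 \<Rightarrow> complex"
  assumes h: "rapid h" and f: "slow_growth f" and \<psi>: "rapid \<psi>"
  shows "integrable (lborel \<Otimes>\<^sub>M lborel) (\<lambda>(x, y). complex_of_real (f x) * (complex_of_real (h (y - x)) * \<psi> y))"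
proof -
  note [measurable] = slow_growth_measurable[OF f] rapid_measurable[OF h] rapid_measurable[OF \<psi>]
  obtain B where B: "B > 0" "\<And>x. norm (h x) \<le> B / (1 + norm x) ^ 4"
    using rapid_decay[OF h] by blast
  \<comment> \<open>Of the exponent 8, four powers absorb the growth from
    \<open>norm_weight_le\<close> and four provide integrability in y.\<close>
  obtain P where P: "P > 0" "\<And>x. norm (\<psi> x) \<le> P / (1 + norm x) ^ 8"
    using rapid_decay[OF \<psi>] by blast
  have if': "integrable lborel (\<lambda>x. complex_of_real (f x / (1 + norm x) ^ 4))"
    by (rule integrable_of_real) (use f in \<open>simp add: slow_growth_def\<close>)
  have iw: "integrable lborel (\<lambda>(y::real^3). complex_of_real (1 / (1 + norm y) ^ 4))"
    by (rule integrable_of_real) (rule integrable_inverse_norm_power4)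
  show ?thesis
  proof (rule integrable_kernel_product[OF if' iw, where C="B * P"])
    fix x y :: "real^3"
    have "\<bar>h (y - x)\<bar> \<le> B * (1 / (1 + norm (y - x)) ^ 4)"
      using B(2)[of "y - x"] by simp
    also have "\<dots> \<le> B * ((1 + norm y) ^ 4 / (1 + norm x) ^ 4)"
      using B(1) by (intro mult_left_mono norm_weight_le) auto
    finally have "\<bar>h (y - x)\<bar> * norm (\<psi> y) \<le> B * ((1 + norm y) ^ 4 / (1 + norm x) ^ 4) * (P / (1 + norm y) ^ 8)"
      using B(1) by (intro mult_mono P) auto
    also have "\<dots> = B * P * (1 / (1 + norm x) ^ 4 * (1 / (1 + norm y) ^ 4))"
    proof -
      have "B * (N / X) * (P / (N * N)) = B * P * (1 / X * (1 / N))" if "N > 0" for N X :: real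
        using that by simp
      from this[OF one_plus_norm_power_pos[of y 4], of "(1 + norm x) ^ 4"] show ?thesis
        unfolding power_add[symmetric] by simp
    qed
    finally have "\<bar>f x\<bar> * (\<bar>h (y - x)\<bar> * norm (\<psi> y)) \<le> \<bar>f x\<bar> * (B * P * (1 / (1 + norm x) ^ 4 * (1 / (1 + norm y) ^ 4)))"
      by (rule mult_left_mono) simp
    then show "norm (case (x, y) of (x, y) \<Rightarrow> complex_of_real (f x) * (complex_of_real (h (y - x)) * \<psi> y))
      \<le> B * P * (norm (complex_of_real (f x / (1 + norm x) ^ 4)) * norm (complex_of_real (1 / (1 + norm y) ^ 4)))"
      by (simp add: norm_mult norm_divide norm_power mult_ac flip: of_real_power of_real_divide of_real_add del: of_real_divide)
  qed measurable
qed

section \<open>From the distributional multiplier to a convolution\<close>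

lemma lebesgue_integral_lborel:
  fixes f :: "'a::euclidean_space \<Rightarrow> 'b::{banach, second_countable_topology}"
  assumes "f \<in> borel_measurable borel"
  shows "(\<integral>x. f x \<partial>lebesgue) = (\<integral>x. f x \<partial>lborel)" "integrable lebesgue f \<longleftrightarrow> integrable lborel f"
  using assms by (auto simp: integral_completion integrable_completion)

text \<open>No Fourier inversion is needed: on a test function the two transforms merely exchange the order of integration.\<close>
lemma fourier_mult_inv_fourier:
  assumes m: "even_symbol m" and \<psi>: "rapid \<psi>"
  shows "fourier (\<lambda>\<xi>. complex_of_real (m \<xi>) * inv_fourier \<psi> \<xi>) x = (\<integral>y. complex_of_real (kern m (y - x)) * \<psi> y \<partial>lborel)"
proof -
  note [measurable] = rapid_measurable[OF \<psi>] even_symbol_measurable[OF m]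
  let ?m = "\<lambda>\<xi>. complex_of_real (m \<xi>)"
  let ?c = "complex_of_real ((2 * pi) ^ 3)"
  have c: "?c \<noteq> 0" by simp
  have [measurable]: "oscint \<psi> \<in> borel_measurable borel"
    unfolding oscint_def[abs_def] by measurable
  have inv: "inv_fourier \<psi> \<xi> = oscint \<psi> \<xi> / ?c" for \<xi>
    unfolding inv_fourier_def oscint_def by (subst lebesgue_integral_lborel) (auto simp: field_simps)
  have "fourier (\<lambda>\<xi>. ?m \<xi> * inv_fourier \<psi> \<xi>) x = (\<integral>\<xi>. cis (- (\<xi> \<bullet> x)) * (?m \<xi> * (oscint \<psi> \<xi> / ?c)) \<partial>lborel)"
    unfolding fourier_def inv by (subst lebesgue_integral_lborel) auto
  also have "\<dots> = (\<integral>\<xi>. (\<integral>y. cis (- (\<xi> \<bullet> x)) * ?m \<xi> / ?c * (cis (\<xi> \<bullet> y) * \<psi> y) \<partial>lborel) \<partial>lborel)"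
    unfolding integral_mult_right_zero oscint_def by (simp add: mult.assoc)
  also have "\<dots> = (\<integral>y. (\<integral>\<xi>. cis (- (\<xi> \<bullet> x)) * ?m \<xi> / ?c * (cis (\<xi> \<bullet> y) * \<psi> y) \<partial>lborel) \<partial>lborel)"
  proof (rule lborel_pair.Fubini_integral[symmetric])
    show "integrable (lborel \<Otimes>\<^sub>M lborel) (\<lambda>(\<xi>, y). cis (- (\<xi> \<bullet> x)) * ?m \<xi> / ?c * (cis (\<xi> \<bullet> y) * \<psi> y))"
      by (rule integrable_kernel_product[OF symbolD(3)[OF even_symbol_symbol[OF m]] rapid_integrable[OF \<psi>], where C="1 / (2 * pi) ^ 3"])
         (auto simp: norm_mult norm_divide norm_power)
  qed
  also have "\<dots> = (\<integral>y. complex_of_real (kern m (y - x)) * \<psi> y \<partial>lborel)"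
  proof (rule Bochner_Integration.integral_cong[OF refl])
    fix y
    have "(\<integral>\<xi>. cis (- (\<xi> \<bullet> x)) * ?m \<xi> / ?c * (cis (\<xi> \<bullet> y) * \<psi> y) \<partial>lborel)
      = (\<integral>\<xi>. (\<psi> y / ?c) * (cis ((y - x) \<bullet> \<xi>) * ?m \<xi>) \<partial>lborel)"
    proof (rule Bochner_Integration.integral_cong[OF refl])
      fix \<xi>
      have "cis ((y - x) \<bullet> \<xi>) = cis (- (\<xi> \<bullet> x)) * cis (\<xi> \<bullet> y)"
        by (simp add: cis_mult inner_diff_left inner_commute[of \<xi>])
      then show "cis (- (\<xi> \<bullet> x)) * ?m \<xi> / ?c * (cis (\<xi> \<bullet> y) * \<psi> y) = (\<psi> y / ?c) * (cis ((y - x) \<bullet> \<xi>) * ?m \<xi>)"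
        by (simp add: mult_ac)
    qed
    also have "\<dots> = (\<psi> y / ?c) * oscint ?m (y - x)"
      unfolding oscint_def by (rule integral_mult_right_zero)
    also have "\<dots> = complex_of_real (kern m (y - x)) * \<psi> y"
      unfolding oscint_even_symbol[OF m] using c by (simp del: of_real_power add: of_real_mult)
    finally show "(\<integral>\<xi>. cis (- (\<xi> \<bullet> x)) * ?m \<xi> / ?c * (cis (\<xi> \<bullet> y) * \<psi> y) \<partial>lborel) = complex_of_real (kern m (y - x)) * \<psi> y" .
  qed
  finally show ?thesis .
qed

lemma dist_of_AE_cong:
  assumes "AE x in lebesgue. f x = g x" and [measurable]: "f \<in> borel_measurable lebesgue" "g \<in> borel_measurable lebesgue" 
    and [measurable]: "\<psi> \<in> borel_measurable lebesgue"
  shows "dist_of f \<psi> = dist_of g \<psi>"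
  unfolding dist_of_def using assms(1) by (intro integral_cong_AE) auto

text \<open>By duality the distribution lets f' act on a transform that
  \<open>fourier_mult_inv_fourier\<close> expresses with the kernel; Fubini then moves the kernel to
  f. Two versions of the function occur because the data are Lebesgue measurable while convolutions
  are formed with a Borel version.\<close>

lemma represents_convolve:
  assumes m: "even_symbol m" and f: "slow_growth f"
    and f': "f' \<in> borel_measurable lebesgue" "AE x in lebesgue. f' x = f x"
  shows "represents (convolve (kern m) f) (dist_inv_fourier (dist_mult m (dist_fourier (dist_of f'))))"
  unfolding represents_def
proof (intro allI impI)
  fix \<psi> assume "schwartz \<psi>"
  then have \<psi>: "rapid \<psi>" by (simp add: schwartz_iff_rapid)
  note k = rapid_kern[OF m]
  note [measurable] = slow_growth_measurable[OF f] rapid_measurable[OF k] rapid_measurable[OF \<psi>] convolve_measurable[OF k f]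
  note I = convolve_test_integrable[OF k f \<psi>]
  have inner: "(\<integral>x. complex_of_real (f x) * (complex_of_real (kern m (y - x)) * \<psi> y) \<partial>lborel) = complex_of_real (convolve (kern m) f y) * \<psi> y" for y
  proof -
    have "(\<integral>x. complex_of_real (f x) * (complex_of_real (kern m (y - x)) * \<psi> y) \<partial>lborel)
      = (\<integral>x. complex_of_real (kern m (y - x) * f x) * \<psi> y \<partial>lborel)"
      by (simp add: mult_ac)
    then show ?thesis
      by (simp only: integral_mult_left_zero integral_complex_of_real convolve_def)
  qed
  have "integrable lborel (\<lambda>y. \<integral>x. complex_of_real (f x) * (complex_of_real (kern m (y - x)) * \<psi> y) \<partial>lborel)"
    using lborel_pair.integrable_snd[OF I] by simp
  then have i: "integrable lborel (\<lambda>y. complex_of_real (convolve (kern m) f y) * \<psi> y)"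
    by (simp add: inner)
  then have "integrable lebesgue (\<lambda>y. complex_of_real (convolve (kern m) f y) * \<psi> y)"
    by (subst lebesgue_integral_lborel) auto
  moreover have "dist_of (convolve (kern m) f) \<psi> = dist_inv_fourier (dist_mult m (dist_fourier (dist_of f'))) \<psi>"
  proof -
    have F[measurable]: "fourier (\<lambda>\<xi>. complex_of_real (m \<xi>) * inv_fourier \<psi> \<xi>) \<in> borel_measurable borel"
      unfolding fourier_mult_inv_fourier[OF m \<psi>, abs_def] by measurable
    have "dist_inv_fourier (dist_mult m (dist_fourier (dist_of f'))) \<psi> = dist_of f' (fourier (\<lambda>\<xi>. complex_of_real (m \<xi>) * inv_fourier \<psi> \<xi>))"
      by (simp add: dist_inv_fourier_def dist_mult_def dist_fourier_def)
    also have "\<dots> = dist_of f (fourier (\<lambda>\<xi>. complex_of_real (m \<xi>) * inv_fourier \<psi> \<xi>))"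
      using f' by (intro dist_of_AE_cong) (auto intro!: measurable_completion)
    also have "\<dots> = (\<integral>x. (\<integral>y. complex_of_real (f x) * (complex_of_real (kern m (y - x)) * \<psi> y) \<partial>lborel) \<partial>lborel)"
      unfolding dist_of_def by (subst lebesgue_integral_lborel) (auto simp: fourier_mult_inv_fourier[OF m \<psi>])
    also have "\<dots> = (\<integral>y. (\<integral>x. complex_of_real (f x) * (complex_of_real (kern m (y - x)) * \<psi> y) \<partial>lborel) \<partial>lborel)"
      by (rule lborel_pair.Fubini_integral[OF I, symmetric])
    also have "\<dots> = dist_of (convolve (kern m) f) \<psi>"
      unfolding dist_of_def inner by (subst lebesgue_integral_lborel) auto
    finally show ?thesis by simp
  qed
  ultimately show "integrable lebesgue (\<lambda>y. complex_of_real (convolve (kern m) f y) * \<psi> y)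
    \<and> dist_of (convolve (kern m) f) \<psi> = dist_inv_fourier (dist_mult m (dist_fourier (dist_of f'))) \<psi>"
    by simp
qed

lemma cutoffD:
  assumes "cutoff chi"
  shows "smooth chi" "\<And>\<xi>. 1 \<le> norm \<xi> \<Longrightarrow> chi \<xi> = 0" "\<And>\<xi>. 0 \<le> chi \<xi>"
    "\<And>\<xi> \<eta>. norm \<xi> = norm \<eta> \<Longrightarrow> chi \<xi> = chi \<eta>" "\<And>\<xi>. norm \<xi> \<le> 1/2 \<Longrightarrow> chi \<xi> = 1"
proof -
  have "closure {\<xi>. chi \<xi> \<noteq> 0} \<subseteq> ball 0 1"
    using assms unfolding cutoff_def by (elim conjE)
  then have "{\<xi>. chi \<xi> \<noteq> 0} \<subseteq> ball 0 1"
    using closure_subset by (rule subset_trans[rotated])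
  then show "chi \<xi> = 0" if "1 \<le> norm \<xi>" for \<xi>
    using that by (auto simp: subset_iff)
qed (use assms in \<open>unfold cutoff_def, blast+\<close>)

lemma cutoff_even_symbol:
  assumes "cutoff chi"
  shows "even_symbol chi"
  unfolding even_symbol_def bounded_support_def
proof (intro conjI allI)
  show "\<exists>R>0. \<forall>x. R \<le> norm x \<longrightarrow> chi x = 0"
    using cutoffD(2)[OF assms] by (intro exI[of _ 1]) auto
  show "chi (- \<xi>) = chi \<xi>" for \<xi>
    by (rule cutoffD(4)[OF assms]) simp
qed (rule cutoffD(1)[OF assms])

text \<open>If v and w differ at a, then g = (v(a) - w(a)) (v - w) is positive near a. The cutoff,
  rescaled into that neighbourhood, is a Schwartz function against which g would have to integrate
  to 0.\<close>

lemma represents_unique: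
  assumes chi: "cutoff chi" and v: "continuous_on UNIV v" "represents v T" and w: "continuous_on UNIV w" "represents w T"
  shows "v = w"
proof (rule ccontr)
  assume "v \<noteq> w"
  then obtain a where a: "v a \<noteq> w a" by auto
  define g where "g x = (v a - w a) * (v x - w x)" for x
  have cg: "continuous_on UNIV g"
    unfolding g_def by (intro continuous_intros v w)
  have "g a > 0" using a by (simp add: g_def zero_less_mult_iff) linarith
  moreover have "isCont g a" using cg by (simp add: continuous_on_eq_continuous_at)
  ultimately have "\<forall>\<^sub>F x in nhds a. g x > 0"
    using order_tendstoD(1)[of g "g a" "nhds a" 0] by (simp add: isCont_def tendsto_at_iff_tendsto_nhds)
  then obtain r where r: "r > 0" "\<And>x. dist x a < r \<Longrightarrow> g x > 0"
    by (auto simp: eventually_nhds_metric)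
  define \<psi> where "\<psi> x = chi ((- (1 / r)) *\<^sub>R a + (1 / r) *\<^sub>R x)" for x
  have e: "even_symbol chi" by (rule cutoff_even_symbol[OF chi])
  have arg: "(- (1 / r)) *\<^sub>R a + (1 / r) *\<^sub>R x = (1 / r) *\<^sub>R (x - a)" for x
    by (simp add: scaleR_diff_right)
  have rchi: "rapid chi"
    using e by (intro rapid_bounded_support) (auto simp: even_symbol_def)
  have rp: "rapid \<psi>"
    unfolding \<psi>_def[abs_def] using r by (intro rapid_affine rchi) auto
  have rpc: "rapid (\<lambda>x. complex_of_real (\<psi> x))"
    by (rule rapid_bounded_linear[OF bounded_linear_of_real rp])
  note [measurable] = rapid_measurable[OF rp] borel_measurable_continuous_onI[OF cg]
    borel_measurable_continuous_onI[OF v(1)] borel_measurable_continuous_onI[OF w(1)]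
  have nn: "0 \<le> g x * \<psi> x" for x
  proof (cases "dist x a < r")
    case True
    then show ?thesis using r(2)[OF True] cutoffD(3)[OF chi] by (simp add: \<psi>_def)
  next
    case False
    then have "norm ((1 / r) *\<^sub>R (x - a)) \<ge> 1" using r(1) by (simp add: dist_norm pos_le_divide_eq)
    then have "\<psi> x = 0" unfolding \<psi>_def arg by (rule cutoffD(2)[OF chi])
    then show ?thesis by simp
  qed
  have sch: "schwartz (\<lambda>x. complex_of_real (\<psi> x))" using rpc by (simp add: schwartz_iff_rapid)
  have iv: "integrable lebesgue (\<lambda>x. complex_of_real (v x) * complex_of_real (\<psi> x))"
   and iw: "integrable lebesgue (\<lambda>x. complex_of_real (w x) * complex_of_real (\<psi> x))"
   and eq: "dist_of v (\<lambda>x. complex_of_real (\<psi> x)) = dist_of w (\<lambda>x. complex_of_real (\<psi> x))"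
    using v(2) w(2) sch unfolding represents_def by auto
  have iv': "integrable lborel (\<lambda>x. v x * \<psi> x)" and iw': "integrable lborel (\<lambda>x. w x * \<psi> x)"
    using iv iw by (auto simp: lebesgue_integral_lborel complex_of_real_integrable_eq simp flip: of_real_mult)
  have "complex_of_real (\<integral>x. v x * \<psi> x \<partial>lborel) = complex_of_real (\<integral>x. w x * \<psi> x \<partial>lborel)"
    using eq unfolding dist_of_def by (simp add: lebesgue_integral_lborel flip: of_real_mult)
  then have "(\<integral>x. g x * \<psi> x \<partial>lborel) = 0"
    using iv' iw' by (simp add: g_def mult.assoc left_diff_distrib)
  moreover have ig: "integrable lborel (\<lambda>x. g x * \<psi> x)"
    using iv' iw' by (simp add: g_def mult.assoc left_diff_distrib)
  ultimately have "AE x in lborel. g x * \<psi> x = 0"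
    using integral_nonneg_eq_0_iff_AE[OF ig] nn by auto
  moreover have "g x * \<psi> x \<noteq> 0" if "x \<in> ball a (r / 2)" for x
  proof -
    have "dist x a < r" "norm ((1 / r) *\<^sub>R (x - a)) \<le> 1 / 2"
      using that r(1) by (simp_all add: dist_norm norm_minus_commute pos_divide_le_eq)
    then show ?thesis
      using r(2)[of x] cutoffD(5)[OF chi] unfolding \<psi>_def arg by simp
  qed
  ultimately have "AE x in lborel. x \<notin> ball a (r / 2)"
    by (auto elim!: eventually_mono)
  then have "ball a (r / 2) \<in> null_sets lborel"
    using AE_iff_null_sets[of "ball a (r / 2)" lborel] by simp
  then have "measure lborel (ball a (r / 2)) = 0"
    by (simp add: null_setsD1 measure_def)
  then show False
    using r(1) content_ball_gt_0_iff[of a "r / 2"] by simp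
qed

text \<open>Existence by \<open>represents_convolve\<close> and uniqueness by
  \<open>represents_unique\<close> resolve the definite description in
  \<open>fourier_multiplier\<close>.\<close>

lemma fourier_multiplier_eq_convolve:
  assumes chi: "cutoff chi" and m: "even_symbol m" and f: "slow_growth f"
    and f': "f' \<in> borel_measurable lebesgue" "AE x in lebesgue. f' x = f x"
  shows "fourier_multiplier m f' = convolve (kern m) f"
  unfolding fourier_multiplier_def
proof (rule the_equality)
  show "continuous_on UNIV (convolve (kern m) f) \<and>
    represents (convolve (kern m) f) (dist_inv_fourier (dist_mult m (dist_fourier (dist_of f'))))"
    using convolve_continuous[OF rapid_kern[OF m] f] represents_convolve[OF m f f'] by simp
  then show "v = convolve (kern m) f" if "continuous_on UNIV v \<and> represents v (dist_inv_fourier (dist_mult m (dist_fourier (dist_of f'))))" for v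
    using that represents_unique[OF chi] by blast
qed

section \<open>Approximate identities in the square-integrable functions\<close>

lemma square_add_le: "(a + b)\<^sup>2 \<le> 2 * a\<^sup>2 + 2 * (b\<^sup>2::real)"
  using sum_squares_bound[of a b] by (simp add: power2_sum)

text \<open>As in the cubic case, the tangent line at \<open>t = \<bar>g\<bar> / L\<close> makes optimising unnecessary.\<close>
lemma weighted_Cauchy_Schwarz:
  fixes H w :: "'a \<Rightarrow> real" and g :: real
  assumes [measurable]: "H \<in> borel_measurable M" "w \<in> borel_measurable M"
    and L: "L > 0" "(\<integral>\<^sup>+y. ennreal \<bar>H y\<bar> \<partial>M) \<le> ennreal L"
    and g: "ennreal \<bar>g\<bar> \<le> (\<integral>\<^sup>+y. ennreal (\<bar>H y\<bar> * \<bar>w y\<bar>) \<partial>M)"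
  shows "ennreal (g\<^sup>2) \<le> ennreal L * (\<integral>\<^sup>+y. ennreal (\<bar>H y\<bar> * (w y)\<^sup>2) \<partial>M)"
proof (cases "(\<integral>\<^sup>+y. ennreal (\<bar>H y\<bar> * (w y)\<^sup>2) \<partial>M) = \<infinity>")
  case True
  then show ?thesis using L by (simp add: ennreal_mult_top)
next
  case False
  define t where "t = \<bar>g\<bar> / L"
  have t: "t \<ge> 0" using L by (simp add: t_def)
  obtain r where r: "(\<integral>\<^sup>+y. ennreal (\<bar>H y\<bar> * (w y)\<^sup>2) \<partial>M) = ennreal r" "r \<ge> 0"
    using False by (cases "\<integral>\<^sup>+y. ennreal (\<bar>H y\<bar> * (w y)\<^sup>2) \<partial>M") auto
  have "ennreal (2 * t * \<bar>g\<bar>) = ennreal (2 * t) * ennreal \<bar>g\<bar>"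
    using t by (simp add: ennreal_mult)
  also have "\<dots> \<le> ennreal (2 * t) * (\<integral>\<^sup>+y. ennreal (\<bar>H y\<bar> * \<bar>w y\<bar>) \<partial>M)"
    by (intro mult_left_mono g) auto
  also have "\<dots> = (\<integral>\<^sup>+y. ennreal (2 * t * (\<bar>H y\<bar> * \<bar>w y\<bar>)) \<partial>M)"
    using t by (subst nn_integral_cmult[symmetric]) (auto simp: ennreal_mult)
  also have "\<dots> \<le> (\<integral>\<^sup>+y. ennreal (t\<^sup>2) * ennreal \<bar>H y\<bar> + ennreal (\<bar>H y\<bar> * (w y)\<^sup>2) \<partial>M)"
  proof (rule nn_integral_mono)
    fix y
    have "2 * t * \<bar>w y\<bar> \<le> t\<^sup>2 + (w y)\<^sup>2"
      using sum_squares_bound[of t "\<bar>w y\<bar>"] by simp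
    from mult_left_mono[OF this, of "\<bar>H y\<bar>"]
    show "ennreal (2 * t * (\<bar>H y\<bar> * \<bar>w y\<bar>)) \<le> ennreal (t\<^sup>2) * ennreal \<bar>H y\<bar> + ennreal (\<bar>H y\<bar> * (w y)\<^sup>2)"
      by (simp add: ennreal_mult[symmetric] ennreal_plus[symmetric] ennreal_leI algebra_simps del: ennreal_plus)
  qed
  also have "\<dots> = ennreal (t\<^sup>2) * (\<integral>\<^sup>+y. ennreal \<bar>H y\<bar> \<partial>M) + ennreal r"
    by (simp add: nn_integral_add nn_integral_cmult r)
  also have "\<dots> \<le> ennreal (t\<^sup>2) * ennreal L + ennreal r"
    by (intro add_mono mult_left_mono L) auto
  also have "\<dots> = ennreal (t\<^sup>2 * L + r)"
    using L r by (simp add: ennreal_mult ennreal_plus)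
  finally have "2 * t * \<bar>g\<bar> \<le> t\<^sup>2 * L + r"
    using r L by (simp add: ennreal_plus[symmetric] del: ennreal_plus)
  then have "g\<^sup>2 \<le> L * r"
    using L by (simp add: t_def field_simps power2_eq_square abs_mult_self_eq)
  then show ?thesis
    using r L by (simp add: ennreal_mult[symmetric] ennreal_leI)
qed

text \<open>Truncate u in height and in space, then truncate in the same way continuous functions
  that converge to u almost everywhere. Dominated convergence applies twice: with a multiple of u^2
  as majorant for the first step, with the common height and support for the second.\<close>

lemma L2_approx_continuous:
  fixes u :: "'a::euclidean_space \<Rightarrow> real"
  assumes [measurable]: "u \<in> borel_measurable borel" and u2: "integrable lborel (\<lambda>x. (u x)\<^sup>2)" and e: "e > 0"
  obtains g where "continuous_on UNIV g" "bounded_support g" "integrable lborel (\<lambda>x. (u x - g x)\<^sup>2)"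
    "(\<integral>x. (u x - g x)\<^sup>2 \<partial>lborel) < e"
proof -
  define clip where "clip k t = max (- real k) (min (real k) t)" for k t
  define bump where "bump k x = max 0 (min 1 (real k - norm x))" for k and x :: 'a
  have clip_c: "continuous_on A f \<Longrightarrow> continuous_on A (\<lambda>x. clip k (f x))" for A :: "'a set" and f k
    unfolding clip_def by (intro continuous_intros)
  have bump_c: "continuous_on UNIV (bump k)" for k
    unfolding bump_def by (intro continuous_intros)
  have bump_b: "0 \<le> bump k x" "bump k x \<le> 1" "real k \<le> norm x \<Longrightarrow> bump k x = 0" "norm x \<le> real k - 1 \<Longrightarrow> bump k x = 1" for k x
    by (auto simp: bump_def)
  have clip_b: "\<bar>clip k t\<bar> \<le> real k" "\<bar>clip k t\<bar> \<le> \<bar>t\<bar>" "\<bar>t\<bar> \<le> real k \<Longrightarrow> clip k t = t" for k t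
    by (auto simp: clip_def)
  have [measurable]: "clip k \<in> borel_measurable borel" for k
    unfolding clip_def[abs_def] by measurable
  have [measurable]: "bump k \<in> borel_measurable borel" for k
    using bump_c by (rule borel_measurable_continuous_onI)
  define U where "U k x = clip k (u x) * bump k x" for k x
  have [measurable]: "U k \<in> borel_measurable borel" for k
    unfolding U_def[abs_def] by measurable
  have U_b: "\<bar>U k x\<bar> \<le> \<bar>u x\<bar>" for k x
    using mult_mono[OF clip_b(2)[of k "u x"] bump_b(2)[of k x]] bump_b(1)[of k x] by (simp add: U_def abs_mult)
  have d2: "(u x - U k x)\<^sup>2 \<le> 4 * (u x)\<^sup>2" for k x
  proof -
    have "\<bar>u x - U k x\<bar> \<le> 2 * \<bar>u x\<bar>" using U_b[of k x] by linarith
    then have "\<bar>u x - U k x\<bar>\<^sup>2 \<le> (2 * \<bar>u x\<bar>)\<^sup>2" by (intro power_mono) auto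
    then show ?thesis by (simp add: power_mult_distrib)
  qed
  have iU: "integrable lborel (\<lambda>x. (u x - U k x)\<^sup>2)" for k
    by (rule Bochner_Integration.integrable_bound[OF integrable_mult_right[OF u2, of 4]]) (use d2 in auto)
  have "(\<lambda>k. \<integral>x. (u x - U k x)\<^sup>2 \<partial>lborel) \<longlonglongrightarrow> (\<integral>(x::'a). 0 \<partial>lborel)"
  proof (rule integral_dominated_convergence[where w="\<lambda>x. 4 * (u x)\<^sup>2"])
    have "\<forall>\<^sub>F k in sequentially. (u x - U k x)\<^sup>2 = 0" for x
    proof -
      obtain K where K: "max (\<bar>u x\<bar>) (norm x + 1) \<le> real K" using real_arch_simple by blast
      show ?thesis
        unfolding eventually_sequentially
      proof (intro exI[of _ K] allI impI)
        fix k assume "K \<le> k"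
        then have "\<bar>u x\<bar> \<le> real k" "norm x \<le> real k - 1" using K by auto
        then show "(u x - U k x)\<^sup>2 = 0" by (simp add: U_def clip_b bump_b)
      qed
    qed
    then show "AE x in lborel. (\<lambda>k. (u x - U k x)\<^sup>2) \<longlonglongrightarrow> 0"
      by (intro AE_I2 tendsto_eventually)
  qed (use u2 d2 in auto)
  then have "\<forall>\<^sub>F k in sequentially. (\<integral>x. (u x - U k x)\<^sup>2 \<partial>lborel) < e / 4"
    using e by (intro order_tendstoD(2)[where y = 0]) auto
  then obtain k where k: "(\<integral>x. (u x - U k x)\<^sup>2 \<partial>lborel) < e / 4"
    by (auto simp: eventually_sequentially)
  \<comment> \<open>\<open>measurable_on\<close> is defined through continuous functions that
    converge outside a negligible set; these become the approximants.\<close>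
  have "u measurable_on UNIV"
    using lebesgue_measurable_imp_measurable_on_real[of u] by (simp add: measurable_completion)
  then obtain N g where N: "negligible N" and gc: "\<And>n. continuous_on UNIV (g n)"
      and gl: "\<And>x. x \<notin> N \<Longrightarrow> (\<lambda>n. g n x) \<longlonglongrightarrow> u x"
    unfolding measurable_on_def by auto
  define G where "G n x = clip k (g n x) * bump k x" for n x
  have Gc: "continuous_on UNIV (G n)" for n
    unfolding G_def by (intro continuous_intros clip_c gc bump_c)
  have Gs: "bounded_support (G n)" for n
    unfolding bounded_support_def G_def using bump_b(3)[of k]
    by (auto intro!: exI[of _ "real k + 1"])
  have [measurable]: "G n \<in> borel_measurable borel" for n
    using Gc by (rule borel_measurable_continuous_onI)
  have UG: "(U k x - G n x)\<^sup>2 \<le> 4 * (real k)\<^sup>2 * indicator (cball 0 (real k)) x" for n x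
  proof (cases "norm x \<le> real k")
    case True
    have "\<bar>U k x\<bar> \<le> real k" "\<bar>G n x\<bar> \<le> real k"
      using mult_mono[OF clip_b(1) bump_b(2)[of k x]] bump_b(1)[of k x] by (auto simp: U_def G_def abs_mult)
    then have "\<bar>U k x - G n x\<bar> \<le> 2 * real k" by linarith
    then have "\<bar>U k x - G n x\<bar>\<^sup>2 \<le> (2 * real k)\<^sup>2" by (intro power_mono) auto
    then show ?thesis using True by (simp add: power_mult_distrib)
  qed (simp add: U_def G_def bump_b)
  have i4: "integrable lborel (\<lambda>x::'a. 4 * (real k)\<^sup>2 * indicator (cball 0 (real k)) x)"
    by (intro integrable_mult_right integrable_real_indicator) (use emeasure_lborel_cball_finite in \<open>auto simp: less_top[symmetric]\<close>)
  have iUG: "integrable lborel (\<lambda>x. (U k x - G n x)\<^sup>2)" for n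
    by (rule Bochner_Integration.integrable_bound[OF i4]) (use UG in auto)
  have "AE x in lebesgue. x \<notin> N"
    using N by (simp add: negligible_iff_null_sets AE_not_in)
  then have AEg: "AE x in lborel. (\<lambda>n. G n x) \<longlonglongrightarrow> U k x"
    unfolding AE_completion_iff
  proof (eventually_elim)
    fix x assume "x \<notin> N"
    then show "(\<lambda>n. G n x) \<longlonglongrightarrow> U k x"
      unfolding G_def U_def clip_def by (intro tendsto_intros gl)
  qed
  have "(\<lambda>n. \<integral>x. (U k x - G n x)\<^sup>2 \<partial>lborel) \<longlonglongrightarrow> (\<integral>(x::'a). 0 \<partial>lborel)"
  proof (rule integral_dominated_convergence[OF _ _ i4])
    show "AE x in lborel. (\<lambda>n. (U k x - G n x)\<^sup>2) \<longlonglongrightarrow> 0"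
      using AEg
    proof eventually_elim
      case (elim x)
      have "(\<lambda>n. (U k x - G n x)\<^sup>2) \<longlonglongrightarrow> (U k x - U k x)\<^sup>2"
        by (intro tendsto_intros elim)
      then show ?case by simp
    qed
  qed (use UG in auto)
  then have "\<forall>\<^sub>F n in sequentially. (\<integral>x. (U k x - G n x)\<^sup>2 \<partial>lborel) < e / 4"
    using e by (intro order_tendstoD(2)[where y = 0]) auto
  then obtain n where n: "(\<integral>x. (U k x - G n x)\<^sup>2 \<partial>lborel) < e / 4"
    by (auto simp: eventually_sequentially)
  have le: "(u x - G n x)\<^sup>2 \<le> 2 * (u x - U k x)\<^sup>2 + 2 * (U k x - G n x)\<^sup>2" for x
    using square_add_le[of "u x - U k x" "U k x - G n x"] by simp
  have i2: "integrable lborel (\<lambda>x. 2 * (u x - U k x)\<^sup>2 + 2 * (U k x - G n x)\<^sup>2)"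
    using iU iUG by simp
  have i3: "integrable lborel (\<lambda>x. (u x - G n x)\<^sup>2)"
    by (rule Bochner_Integration.integrable_bound[OF i2]) (use le in auto)
  have "(\<integral>x. (u x - G n x)\<^sup>2 \<partial>lborel) \<le> (\<integral>x. 2 * (u x - U k x)\<^sup>2 + 2 * (U k x - G n x)\<^sup>2 \<partial>lborel)"
    by (rule integral_mono[OF i3 i2 le])
  also have "\<dots> < e" using iU iUG k n by simp
  finally show thesis by (rule that[OF Gc Gs i3])
qed

lemma L2_difference_integrable:
  fixes u :: "'a::euclidean_space \<Rightarrow> real"
  assumes [measurable]: "u \<in> borel_measurable borel" and u2: "integrable lborel (\<lambda>x. (u x)\<^sup>2)"
  shows "integrable lborel (\<lambda>x. (u (x + y) - u x)\<^sup>2)"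
    "(\<integral>x. (u (x + y) - u x)\<^sup>2 \<partial>lborel) \<le> 4 * (\<integral>x. (u x)\<^sup>2 \<partial>lborel)"
proof -
  have i: "integrable lborel (\<lambda>x. 2 * (u (x + y))\<^sup>2 + 2 * (u x)\<^sup>2)"
    using lborel_integrable_shift[OF u2, of y] u2 by simp
  have le: "(u (x + y) - u x)\<^sup>2 \<le> 2 * (u (x + y))\<^sup>2 + 2 * (u x)\<^sup>2" for x
    using square_add_le[of "u (x + y)" "- u x"] by simp
  show i': "integrable lborel (\<lambda>x. (u (x + y) - u x)\<^sup>2)"
    by (rule Bochner_Integration.integrable_bound[OF i]) (use le in auto)
  have "(\<integral>x. (u (x + y) - u x)\<^sup>2 \<partial>lborel) \<le> (\<integral>x. 2 * (u (x + y))\<^sup>2 + 2 * (u x)\<^sup>2 \<partial>lborel)"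
    by (rule integral_mono[OF i' i le])
  also have "\<dots> = 4 * (\<integral>x. (u x)\<^sup>2 \<partial>lborel)"
    using lborel_integrable_shift[OF u2, of y] u2 lborel_integral_shift[of "\<lambda>x. (u x)\<^sup>2" y] by simp
  finally show "(\<integral>x. (u (x + y) - u x)\<^sup>2 \<partial>lborel) \<le> 4 * (\<integral>x. (u x)\<^sup>2 \<partial>lborel)" .
qed

text \<open>Dominated convergence settles continuous functions of bounded support; mean-square
  approximation transfers the result to u.\<close>

lemma L2_translation_continuous:
  fixes u :: "'a::euclidean_space \<Rightarrow> real"
  assumes [measurable]: "u \<in> borel_measurable borel" and u2: "integrable lborel (\<lambda>x. (u x)\<^sup>2)"
    and y: "y \<longlonglongrightarrow> 0"
  shows "(\<lambda>n. \<integral>x. (u (x + y n) - u x)\<^sup>2 \<partial>lborel) \<longlonglongrightarrow> 0"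
proof (rule tendstoI)
  fix e :: real assume e: "e > 0"
  \<comment> \<open>The estimate \<open>le\<close> below has three terms with factor 4: two
    approximation errors and the increment of g. At less than e / 16 each they total less than 12/16
    of e.\<close>
  obtain g where gc: "continuous_on UNIV g" and gs: "bounded_support g" and gi: "integrable lborel (\<lambda>x. (u x - g x)\<^sup>2)"
    and ge: "(\<integral>x. (u x - g x)\<^sup>2 \<partial>lborel) < e / 16"
    using L2_approx_continuous[OF assms(1) u2, of "e / 16"] e by auto
  have [measurable]: "g \<in> borel_measurable borel"
    using gc by (rule borel_measurable_continuous_onI)
  obtain B where B: "\<And>x. norm (g x) \<le> B" using continuous_bounded_support(1)[OF gc gs] by blast
  obtain R where R: "R > 0" "\<And>x. norm x \<ge> R \<Longrightarrow> g x = 0" using gs by (auto simp: bounded_support_def)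
  \<comment> \<open>Dropping long shifts changes only finitely many terms and keeps all translates
    of g inside one ball.\<close>
  define y' where "y' n = (if norm (y n) \<le> 1 then y n else 0)" for n
  have y'1: "norm (y' n) \<le> 1" for n by (simp add: y'_def)
  have evy: "\<forall>\<^sub>F n in sequentially. y' n = y n"
  proof -
    have "\<forall>\<^sub>F n in sequentially. norm (y n) < 1"
      using tendsto_norm[OF y] by (intro order_tendstoD(2)[where y = "norm (0::'a)"]) auto
    then show ?thesis by eventually_elim (simp add: y'_def)
  qed
  have y': "y' \<longlonglongrightarrow> 0"
    by (rule Lim_transform_eventually[OF y]) (use evy in eventually_elim, simp)
  have gb: "(g (x + y' n) - g x)\<^sup>2 \<le> 4 * B\<^sup>2 * indicator (cball 0 (R + 1)) x" for n x
  proof (cases "norm x \<le> R + 1")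
    case True
    have "\<bar>g (x + y' n) - g x\<bar> \<le> 2 * B" using B[of x] B[of "x + y' n"] by simp
    then have "\<bar>g (x + y' n) - g x\<bar>\<^sup>2 \<le> (2 * B)\<^sup>2" by (intro power_mono) auto
    then show ?thesis using True by (simp add: power_mult_distrib)
  next
    case False
    then have "norm (x + y' n) \<ge> R" "norm x \<ge> R" using norm_diff_ineq[of x "y' n"] y'1[of n] by linarith+
    then show ?thesis using R by simp
  qed
  have i4: "integrable lborel (\<lambda>x::'a. 4 * B\<^sup>2 * indicator (cball 0 (R + 1)) x)"
    by (intro integrable_mult_right integrable_real_indicator) (use emeasure_lborel_cball_finite in \<open>auto simp: less_top[symmetric]\<close>)
  have "(\<lambda>n. \<integral>x. (g (x + y' n) - g x)\<^sup>2 \<partial>lborel) \<longlonglongrightarrow> (\<integral>(x::'a). 0 \<partial>lborel)"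
  proof (rule integral_dominated_convergence[OF _ _ i4])
    show "AE x in lborel. (\<lambda>n. (g (x + y' n) - g x)\<^sup>2) \<longlonglongrightarrow> 0"
    proof (rule AE_I2)
      fix x
      have "(\<lambda>n. x + y' n) \<longlonglongrightarrow> x + 0" by (intro tendsto_intros y')
      then have "(\<lambda>n. g (x + y' n)) \<longlonglongrightarrow> g (x + 0)"
        using continuous_on_tendsto_compose[OF gc] by simp
      then have "(\<lambda>n. (g (x + y' n) - g x)\<^sup>2) \<longlonglongrightarrow> (g (x + 0) - g x)\<^sup>2"
        by (intro tendsto_intros)
      then show "(\<lambda>n. (g (x + y' n) - g x)\<^sup>2) \<longlonglongrightarrow> 0" by simp
    qed
  qed (use gb in auto)
  then have "\<forall>\<^sub>F n in sequentially. (\<integral>x. (g (x + y' n) - g x)\<^sup>2 \<partial>lborel) < e / 16"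
    using e by (intro order_tendstoD(2)[where y = 0]) auto
  then show "\<forall>\<^sub>F n in sequentially. dist (\<integral>x. (u (x + y n) - u x)\<^sup>2 \<partial>lborel) 0 < e"
    using evy
  proof eventually_elim
    case (elim n)
    let ?z = "y n"
    have ig: "integrable lborel (\<lambda>x. (g (x + ?z) - g x)\<^sup>2)"
      by (rule Bochner_Integration.integrable_bound[OF i4]) (use gb[of _ n] elim in auto)
    have igs: "integrable lborel (\<lambda>x. (u (x + ?z) - g (x + ?z))\<^sup>2)"
      using lborel_integrable_shift[OF gi] .
    have four: "a \<le> 2 * b + 2 * c \<Longrightarrow> b \<le> 2 * r + 2 * s \<Longrightarrow> 0 \<le> c \<Longrightarrow> a \<le> 4 * r + 4 * s + 4 * c" for a b c r s :: real
      by linarith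
    have le: "(u (x + ?z) - u x)\<^sup>2 \<le> 4 * (u (x + ?z) - g (x + ?z))\<^sup>2 + 4 * (g (x + ?z) - g x)\<^sup>2 + 4 * (u x - g x)\<^sup>2" for x
      unfolding power2_commute[of "u x" "g x"]
      using square_add_le[of "u (x + ?z) - g x" "g x - u x"]
        square_add_le[of "u (x + ?z) - g (x + ?z)" "g (x + ?z) - g x"]
      by (intro four[of _ "(u (x + ?z) - g x)\<^sup>2"]) auto
    have "(\<integral>x. (u (x + ?z) - u x)\<^sup>2 \<partial>lborel) \<le> (\<integral>x. 4 * (u (x + ?z) - g (x + ?z))\<^sup>2 + 4 * (g (x + ?z) - g x)\<^sup>2 + 4 * (u x - g x)\<^sup>2 \<partial>lborel)"
      by (rule integral_mono[OF L2_difference_integrable(1)[OF assms(1) u2] _ le]) (use ig igs gi in simp)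
    also have "\<dots> = 4 * (\<integral>x. (u x - g x)\<^sup>2 \<partial>lborel) + 4 * (\<integral>x. (g (x + ?z) - g x)\<^sup>2 \<partial>lborel) + 4 * (\<integral>x. (u x - g x)\<^sup>2 \<partial>lborel)"
      using ig igs gi lborel_integral_shift[of "\<lambda>x. (u x - g x)\<^sup>2" ?z] by simp
    also have "\<dots> < e" using ge elim e by simp
    finally show ?case by (simp add: dist_real_def integral_nonneg_AE)
  qed
qed

section \<open>Dilated kernels and their convolutions with square-integrable functions\<close>

lemma dilate_measurable [measurable]:
  assumes [measurable]: "h \<in> borel_measurable borel"
  shows "dilate l h \<in> borel_measurable borel"
  unfolding dilate_def[abs_def] by measurable

lemma rapid_dilate: "rapid h \<Longrightarrow> l > 0 \<Longrightarrow> rapid (dilate l h)"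
  unfolding dilate_def[abs_def]
  using rapid_bounded_linear[OF bounded_linear_mult_right rapid_affine[of h l 0], of "l ^ 3"] by simp

lemma nn_integral_dilate:
  assumes [measurable]: "h \<in> borel_measurable borel" "F \<in> borel_measurable borel" and l: "l > 0"
  shows "(\<integral>\<^sup>+y. ennreal \<bar>dilate l h y\<bar> * F y \<partial>lborel) = (\<integral>\<^sup>+y. ennreal \<bar>h y\<bar> * F ((1 / l) *\<^sub>R y) \<partial>lborel)"
proof -
  have "(\<integral>\<^sup>+y. ennreal \<bar>h y\<bar> * F ((1 / l) *\<^sub>R y) \<partial>lborel) = ennreal (l ^ 3) * (\<integral>\<^sup>+y. ennreal \<bar>h (l *\<^sub>R y)\<bar> * F y \<partial>lborel)"
    using lborel_nn_integral_affine[of "\<lambda>y. ennreal \<bar>h y\<bar> * F ((1 / l) *\<^sub>R y)" l 0] l by simp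
  also have "\<dots> = (\<integral>\<^sup>+y. ennreal \<bar>dilate l h y\<bar> * F y \<partial>lborel)"
    using l by (subst nn_integral_cmult[symmetric]) (auto simp: dilate_def abs_mult ennreal_mult mult.assoc)
  finally show ?thesis by simp
qed

lemma integral_dilate:
  fixes F :: "real^3 \<Rightarrow> real"
  assumes [measurable]: "h \<in> borel_measurable borel" "F \<in> borel_measurable borel" and l: "l > 0"
  shows "(\<integral>y. dilate l h y * F y \<partial>lborel) = (\<integral>y. h y * F ((1 / l) *\<^sub>R y) \<partial>lborel)"
proof -
  have "(\<integral>y. h y * F ((1 / l) *\<^sub>R y) \<partial>lborel) = l ^ 3 * (\<integral>y. h (l *\<^sub>R y) * F y \<partial>lborel)"
    using lborel_integral_affine[of "\<lambda>y. h y * F ((1 / l) *\<^sub>R y)" l 0] l by simp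
  also have "\<dots> = (\<integral>y. dilate l h y * F y \<partial>lborel)"
    by (subst integral_mult_right_zero[symmetric]) (simp add: dilate_def mult.assoc)
  finally show ?thesis by simp
qed

lemma dilate_difference_L1:
  fixes h :: "real^3 \<Rightarrow> real"
  assumes [measurable]: "h \<in> borel_measurable borel" and l: "l > 0"
    and C: "\<And>z. (\<integral>\<^sup>+y. ennreal \<bar>h (y + z) - h y\<bar> \<partial>lborel) \<le> ennreal (C * norm z)"
  shows "(\<integral>\<^sup>+y. ennreal \<bar>dilate l h (y + z) - dilate l h y\<bar> \<partial>lborel) \<le> ennreal (C * l * norm z)"
proof -
  have "dilate l h (y + z) - dilate l h y = dilate l (\<lambda>y. h (y + l *\<^sub>R z) - h y) y" for y
    by (simp add: dilate_def scaleR_add_right right_diff_distrib)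
  then have "(\<integral>\<^sup>+y. ennreal \<bar>dilate l h (y + z) - dilate l h y\<bar> \<partial>lborel) = (\<integral>\<^sup>+y. ennreal \<bar>h (y + l *\<^sub>R z) - h y\<bar> \<partial>lborel)"
    using nn_integral_dilate[of "\<lambda>y. h (y + l *\<^sub>R z) - h y" "\<lambda>_. 1" l] l by simp
  also have "\<dots> \<le> ennreal (C * l * norm z)"
    using C[of "l *\<^sub>R z"] l by (simp add: mult.assoc)
  finally show ?thesis .
qed

text \<open>The first claim is Young's inequality, from \<open>weighted_Cauchy_Schwarz\<close> and
  Fubini; the second holds because h is square integrable as well. Together they justify integrating
  the cubic terms of the flux.\<close>

lemma convolve_L2:
  assumes h: "rapid h" and um: "u \<in> borel_measurable borel" and u2: "integrable lborel (\<lambda>x. (u x)\<^sup>2)"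
  shows "integrable lborel (\<lambda>x. (convolve h u x)\<^sup>2)" and "\<exists>B. \<forall>x. \<bar>convolve h u x\<bar> \<le> B"
proof -
  have sg: "slow_growth u" by (rule slow_growth_square_integrable[OF um u2])
  note [measurable] = um rapid_measurable[OF h] convolve_measurable[OF h sg]
  have ih: "integrable lborel (\<lambda>y. \<bar>h y\<bar>)" using rapid_integrable[OF h] by simp
  \<comment> \<open>The added 1 makes L positive, as \<open>weighted_Cauchy_Schwarz\<close>
    demands.\<close>
  define L where "L = (\<integral>y. \<bar>h y\<bar> \<partial>lborel) + 1"
  have L: "L > 0" unfolding L_def by (rule add_nonneg_pos) (auto intro: integral_nonneg_AE)
  have hL: "(\<integral>\<^sup>+y. ennreal \<bar>h y\<bar> \<partial>lborel) \<le> ennreal L"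
    using nn_integral_eq_integral[OF ih] by (simp add: L_def ennreal_leI)
  have pt: "ennreal ((convolve h u x)\<^sup>2) \<le> ennreal L * (\<integral>\<^sup>+y. ennreal (\<bar>h y\<bar> * (u (x - y))\<^sup>2) \<partial>lborel)" for x
  proof (rule weighted_Cauchy_Schwarz[OF _ _ L hL])
    show "ennreal \<bar>convolve h u x\<bar> \<le> (\<integral>\<^sup>+y. ennreal (\<bar>h y\<bar> * \<bar>u (x - y)\<bar>) \<partial>lborel)"
      unfolding convolve_commute(2)[OF h sg] using abs_integral_le_nn[of "\<lambda>y. h y * u (x - y)" lborel] by (simp add: abs_mult)
  qed measurable
  have "(\<integral>\<^sup>+x. ennreal ((convolve h u x)\<^sup>2) \<partial>lborel) \<le> (\<integral>\<^sup>+x. ennreal L * (\<integral>\<^sup>+y. ennreal (\<bar>h y\<bar> * (u (x - y))\<^sup>2) \<partial>lborel) \<partial>lborel)"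
    by (intro nn_integral_mono pt)
  also have "\<dots> = ennreal L * (\<integral>\<^sup>+x. \<integral>\<^sup>+y. ennreal (\<bar>h y\<bar> * (u (x - y))\<^sup>2) \<partial>lborel \<partial>lborel)"
    by (simp add: nn_integral_cmult)
  also have "(\<integral>\<^sup>+x. \<integral>\<^sup>+y. ennreal (\<bar>h y\<bar> * (u (x - y))\<^sup>2) \<partial>lborel \<partial>lborel) = (\<integral>\<^sup>+y. \<integral>\<^sup>+x. ennreal (\<bar>h y\<bar> * (u (x - y))\<^sup>2) \<partial>lborel \<partial>lborel)"
    by (rule lborel_pair.Fubini') measurable
  also have "\<dots> = (\<integral>\<^sup>+y. ennreal \<bar>h y\<bar> * (\<integral>\<^sup>+x. ennreal ((u x)\<^sup>2) \<partial>lborel) \<partial>lborel)"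
  proof (rule nn_integral_cong)
    fix y
    have "(\<integral>\<^sup>+x. ennreal (\<bar>h y\<bar> * (u (x - y))\<^sup>2) \<partial>lborel) = ennreal \<bar>h y\<bar> * (\<integral>\<^sup>+x. ennreal ((u (x - y))\<^sup>2) \<partial>lborel)"
      by (subst nn_integral_cmult[symmetric]) (auto simp: ennreal_mult)
    then show "(\<integral>\<^sup>+x. ennreal (\<bar>h y\<bar> * (u (x - y))\<^sup>2) \<partial>lborel) = ennreal \<bar>h y\<bar> * (\<integral>\<^sup>+x. ennreal ((u x)\<^sup>2) \<partial>lborel)"
      using nn_integral_shift[of "\<lambda>x. ennreal ((u x)\<^sup>2)" "- y"] by simp
  qed
  also have "\<dots> = (\<integral>\<^sup>+y. ennreal \<bar>h y\<bar> \<partial>lborel) * (\<integral>\<^sup>+x. ennreal ((u x)\<^sup>2) \<partial>lborel)"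
    by (simp add: nn_integral_multc)
  also have "ennreal L * \<dots> < \<infinity>"
    using nn_integral_eq_integral[OF ih] nn_integral_eq_integral[OF u2] by (simp add: ennreal_mult_less_top)
  finally show "integrable lborel (\<lambda>x. (convolve h u x)\<^sup>2)"
    by (intro integrableI_bounded) auto
  have h2: "integrable lborel (\<lambda>y. (h y)\<^sup>2)"
  proof -
    obtain B where B: "B > 0" "\<And>x. norm (h x) \<le> B / (1 + norm x) ^ 0" using rapid_decay[OF h] by blast
    show ?thesis
    proof (rule Bochner_Integration.integrable_bound[OF integrable_mult_right[OF ih, of B]])
      show "AE x in lborel. norm ((h x)\<^sup>2) \<le> norm (B * \<bar>h x\<bar>)"
      proof (rule AE_I2)
        fix x
        have "\<bar>h x\<bar> * \<bar>h x\<bar> \<le> B * \<bar>h x\<bar>"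
          using B(2)[of x] by (intro mult_right_mono) auto
        then show "norm ((h x)\<^sup>2) \<le> norm (B * \<bar>h x\<bar>)"
          using B(1) by (simp add: power2_eq_square abs_mult)
      qed
    qed measurable
  qed
  have "\<bar>convolve h u x\<bar> \<le> (\<integral>y. (h y)\<^sup>2 \<partial>lborel) + (\<integral>y. (u y)\<^sup>2 \<partial>lborel)" for x
  proof -
    have i: "integrable lborel (\<lambda>y. (h (x - y))\<^sup>2 + (u y)\<^sup>2)"
      using lborel_integrable_reflect[OF h2, of x] u2 by simp
    have "\<bar>convolve h u x\<bar> \<le> (\<integral>y. \<bar>h (x - y) * u y\<bar> \<partial>lborel)"
      unfolding convolve_def by (rule integral_abs_bound)
    also have "\<dots> \<le> (\<integral>y. (h (x - y))\<^sup>2 + (u y)\<^sup>2 \<partial>lborel)"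
    proof (rule integral_mono[OF integrable_abs[OF convolve_integrable[OF h sg]] i])
      fix y
      show "\<bar>h (x - y) * u y\<bar> \<le> (h (x - y))\<^sup>2 + (u y)\<^sup>2"
        using sum_squares_bound[of "\<bar>h (x - y)\<bar>" "\<bar>u y\<bar>"] mult_nonneg_nonneg[OF abs_ge_zero[of "h (x - y)"] abs_ge_zero[of "u y"]]
        unfolding abs_mult power2_abs by linarith
    qed
    also have "\<dots> = (\<integral>y. (h y)\<^sup>2 \<partial>lborel) + (\<integral>y. (u y)\<^sup>2 \<partial>lborel)"
      using lborel_integrable_reflect[OF h2, of x] u2 lborel_integral_reflect[of "\<lambda>y. (h y)\<^sup>2" x] by simp
    finally show ?thesis .
  qed
  then show "\<exists>B. \<forall>x. \<bar>convolve h u x\<bar> \<le> B" by blast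
qed

text \<open>As h has integral 1, the error is the average of u(x - z / 2^n) - u(x) against h(z). By
  \<open>weighted_Cauchy_Schwarz\<close> its mean square is at most an average of translation
  errors, which tends to 0. A subsequence then converges almost everywhere, which is all that
  Fatou's lemma will ask for.\<close>

lemma approximate_identity_AE:
  assumes h: "rapid h" "(\<integral>y. h y \<partial>lborel) = 1" and um: "u \<in> borel_measurable borel" and u2: "integrable lborel (\<lambda>x. (u x)\<^sup>2)"
  shows "\<exists>r. strict_mono r \<and> (AE x in lborel. (\<lambda>n. convolve (dilate (2 ^ r n) h) u x) \<longlonglongrightarrow> u x)"
proof -
  have sg: "slow_growth u" by (rule slow_growth_square_integrable[OF um u2])
  have rd: "rapid (dilate (2 ^ n) h)" for n by (intro rapid_dilate h) simp
  note [measurable] = um rapid_measurable[OF h(1)] convolve_measurable[OF rd sg]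
  have ih: "integrable lborel (\<lambda>y. \<bar>h y\<bar>)" using rapid_integrable[OF h(1)] by simp
  define L where "L = (\<integral>y. \<bar>h y\<bar> \<partial>lborel) + 1"
  have L: "L > 0" unfolding L_def by (rule add_nonneg_pos) (auto intro: integral_nonneg_AE)
  have hL: "(\<integral>\<^sup>+y. ennreal \<bar>h y\<bar> \<partial>lborel) \<le> ennreal L"
    using nn_integral_eq_integral[OF ih] by (simp add: L_def ennreal_leI)
  define E where "E n x = convolve (dilate (2 ^ n) h) u x - u x" for n x
  have [measurable]: "E n \<in> borel_measurable borel" for n unfolding E_def by measurable
  \<comment> \<open>Mean-square modulus of continuity of u: bounded by four times the squared norm
    of u, and tending to 0 along z / 2^n.\<close>
  define \<tau> where "\<tau> y = (\<integral>x. (u (x + y) - u x)\<^sup>2 \<partial>lborel)" for y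
  have [measurable]: "\<tau> \<in> borel_measurable borel" unfolding \<tau>_def by measurable
  have \<tau>nn: "\<tau> y \<ge> 0" for y unfolding \<tau>_def by (rule integral_nonneg_AE) simp
  have \<tau>b: "\<tau> y \<le> 4 * (\<integral>x. (u x)\<^sup>2 \<partial>lborel)" for y
    unfolding \<tau>_def by (rule L2_difference_integrable[OF um u2])
  define a where "a n z = - ((1 / 2 ^ n) *\<^sub>R z)" for n and z :: "real^3"
  have E_eq: "E n x = (\<integral>z. h z * (u (x + a n z) - u x) \<partial>lborel)" for n x
  proof -
    have i1: "integrable lborel (\<lambda>y. dilate (2 ^ n) h y * u (x - y))"
      by (rule convolve_commute(1)[OF rd sg])
    have i2: "integrable lborel (dilate (2 ^ n) h)" by (rule rapid_integrable[OF rd])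
    have "(\<integral>y. dilate (2 ^ n) h y \<partial>lborel) = 1"
      using integral_dilate[of h "\<lambda>_. 1" "2 ^ n"] h(2) by simp
    then have "E n x = (\<integral>y. dilate (2 ^ n) h y * (u (x - y) - u x) \<partial>lborel)"
      unfolding E_def convolve_commute(2)[OF rd sg] using i1 i2 by (simp add: right_diff_distrib)
    also have "\<dots> = (\<integral>z. h z * (u (x + a n z) - u x) \<partial>lborel)"
      using integral_dilate[of h "\<lambda>y. u (x - y) - u x" "2 ^ n"] by (simp add: a_def)
    finally show ?thesis .
  qed
  have pt: "ennreal ((E n x)\<^sup>2) \<le> ennreal L * (\<integral>\<^sup>+z. ennreal (\<bar>h z\<bar> * (u (x + a n z) - u x)\<^sup>2) \<partial>lborel)" for n x
  proof (rule weighted_Cauchy_Schwarz[OF _ _ L hL])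
    show "ennreal \<bar>E n x\<bar> \<le> (\<integral>\<^sup>+z. ennreal (\<bar>h z\<bar> * \<bar>u (x + a n z) - u x\<bar>) \<partial>lborel)"
      unfolding E_eq using abs_integral_le_nn[of "\<lambda>z. h z * (u (x + a n z) - u x)" lborel] by (simp add: abs_mult a_def)
    show "(\<lambda>z. u (x + a n z) - u x) \<in> borel_measurable lborel" unfolding a_def by measurable
  qed measurable
  have iht: "integrable lborel (\<lambda>z. \<bar>h z\<bar> * \<tau> (a n z))" for n
  proof (rule Bochner_Integration.integrable_bound[OF integrable_mult_left[OF ih, of "4 * (\<integral>x. (u x)\<^sup>2 \<partial>lborel)"]])
    show "(\<lambda>z. \<bar>h z\<bar> * \<tau> (a n z)) \<in> borel_measurable lborel" unfolding a_def by measurable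
    show "AE z in lborel. norm (\<bar>h z\<bar> * \<tau> (a n z)) \<le> norm (\<bar>h z\<bar> * (4 * (\<integral>x. (u x)\<^sup>2 \<partial>lborel)))"
    proof (rule AE_I2)
      fix z
      show "norm (\<bar>h z\<bar> * \<tau> (a n z)) \<le> norm (\<bar>h z\<bar> * (4 * (\<integral>x. (u x)\<^sup>2 \<partial>lborel)))"
        using \<tau>b[of "a n z"] \<tau>nn[of "a n z"] order_trans[OF \<tau>nn \<tau>b]
        by (simp add: abs_mult mult_left_mono)
    qed
  qed
  have nn: "(\<integral>\<^sup>+x. ennreal ((E n x)\<^sup>2) \<partial>lborel) \<le> ennreal (L * (\<integral>z. \<bar>h z\<bar> * \<tau> (a n z) \<partial>lborel))" for n
  proof -
    have [measurable]: "(\<lambda>p. u (fst p + a n (snd p)) - u (fst p)) \<in> borel_measurable (borel \<Otimes>\<^sub>M borel)"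
      unfolding a_def by measurable
    have "(\<integral>\<^sup>+x. ennreal ((E n x)\<^sup>2) \<partial>lborel) \<le> (\<integral>\<^sup>+x. ennreal L * (\<integral>\<^sup>+z. ennreal (\<bar>h z\<bar> * (u (x + a n z) - u x)\<^sup>2) \<partial>lborel) \<partial>lborel)"
      by (intro nn_integral_mono pt)
    also have "\<dots> = ennreal L * (\<integral>\<^sup>+x. \<integral>\<^sup>+z. ennreal (\<bar>h z\<bar> * (u (x + a n z) - u x)\<^sup>2) \<partial>lborel \<partial>lborel)"
      unfolding a_def by (simp add: nn_integral_cmult)
    also have "(\<integral>\<^sup>+x. \<integral>\<^sup>+z. ennreal (\<bar>h z\<bar> * (u (x + a n z) - u x)\<^sup>2) \<partial>lborel \<partial>lborel)
      = (\<integral>\<^sup>+z. \<integral>\<^sup>+x. ennreal (\<bar>h z\<bar> * (u (x + a n z) - u x)\<^sup>2) \<partial>lborel \<partial>lborel)"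
      unfolding a_def by (rule lborel_pair.Fubini') measurable
    also have "\<dots> = (\<integral>\<^sup>+z. ennreal (\<bar>h z\<bar> * \<tau> (a n z)) \<partial>lborel)"
    proof (rule nn_integral_cong)
      fix z
      show "(\<integral>\<^sup>+x. ennreal (\<bar>h z\<bar> * (u (x + a n z) - u x)\<^sup>2) \<partial>lborel) = ennreal (\<bar>h z\<bar> * \<tau> (a n z))"
        unfolding \<tau>_def integral_mult_right_zero[symmetric]
        by (intro nn_integral_eq_integral integrable_mult_right L2_difference_integrable um u2) auto
    qed
    also have "\<dots> = ennreal (\<integral>z. \<bar>h z\<bar> * \<tau> (a n z) \<partial>lborel)"
      using \<tau>nn by (intro nn_integral_eq_integral iht) auto
    finally show ?thesis
      using L \<tau>nn by (simp add: ennreal_mult integral_nonneg_AE)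
  qed
  have iE: "integrable lborel (\<lambda>x. (E n x)\<^sup>2)" for n
    using order.strict_trans1[OF nn[of n] ennreal_less_top] by (intro integrableI_bounded) auto
  have E_le: "(\<integral>x. (E n x)\<^sup>2 \<partial>lborel) \<le> L * (\<integral>z. \<bar>h z\<bar> * \<tau> (a n z) \<partial>lborel)" for n
    using nn[of n] nn_integral_eq_integral[OF iE[of n]] L \<tau>nn
    by (simp add: ennreal_le_iff integral_nonneg_AE)
  have "(\<lambda>n. \<integral>z. \<bar>h z\<bar> * \<tau> (a n z) \<partial>lborel) \<longlonglongrightarrow> (\<integral>(z::real^3). 0 \<partial>lborel)"
  proof (rule integral_dominated_convergence[where w="\<lambda>z. \<bar>h z\<bar> * (4 * (\<integral>x. (u x)\<^sup>2 \<partial>lborel))"])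
    show "AE z in lborel. (\<lambda>n. \<bar>h z\<bar> * \<tau> (a n z)) \<longlonglongrightarrow> 0"
    proof (rule AE_I2)
      fix z :: "real^3"
      have "(\<lambda>n. (1 / 2) ^ n *\<^sub>R z) \<longlonglongrightarrow> 0 *\<^sub>R z"
        by (rule tendsto_scaleR[OF LIMSEQ_power_zero tendsto_const]) simp
      then have "(\<lambda>n. a n z) \<longlonglongrightarrow> 0"
        using tendsto_minus by (fastforce simp: a_def power_one_over)
      then have "(\<lambda>n. \<tau> (a n z)) \<longlonglongrightarrow> 0"
        unfolding \<tau>_def by (rule L2_translation_continuous[OF um u2])
      then show "(\<lambda>n. \<bar>h z\<bar> * \<tau> (a n z)) \<longlonglongrightarrow> 0"
        by (rule tendsto_mult_right_zero)
    qed
    show "(\<lambda>z. \<bar>h z\<bar> * \<tau> (a n z)) \<in> borel_measurable lborel" for n using iht by auto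
    show "integrable lborel (\<lambda>z. \<bar>h z\<bar> * (4 * (\<integral>x. (u x)\<^sup>2 \<partial>lborel)))" by (intro integrable_mult_left ih)
    show "AE z in lborel. norm (\<bar>h z\<bar> * \<tau> (a n z)) \<le> \<bar>h z\<bar> * (4 * (\<integral>x. (u x)\<^sup>2 \<partial>lborel))" for n
      using \<tau>b \<tau>nn by (intro AE_I2) (simp add: abs_mult mult_left_mono)
  qed auto
  from tendsto_mult_right_zero[OF this[simplified], of L]
  have "(\<lambda>n. L * (\<integral>z. \<bar>h z\<bar> * \<tau> (a n z) \<partial>lborel)) \<longlonglongrightarrow> 0" .
  then have "(\<lambda>n. \<integral>x. norm ((E n x)\<^sup>2) \<partial>lborel) \<longlonglongrightarrow> 0"
    by (rule Lim_null_comparison[rotated]) (use E_le in \<open>auto simp: integral_nonneg_AE\<close>)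
  from tendsto_L1_AE_subseq[OF iE this]
  obtain r where r: "strict_mono r" "AE x in lborel. (\<lambda>n. (E (r n) x)\<^sup>2) \<longlonglongrightarrow> 0" by blast
  have "AE x in lborel. (\<lambda>n. convolve (dilate (2 ^ r n) h) u x) \<longlonglongrightarrow> u x"
    using r(2)
  proof eventually_elim
    case (elim x)
    then have "(\<lambda>n. \<bar>E (r n) x\<bar>) \<longlonglongrightarrow> 0"
      using tendsto_real_sqrt[OF elim] by simp
    then have "(\<lambda>n. E (r n) x) \<longlonglongrightarrow> 0"
      by (simp add: tendsto_rabs_zero_iff)
    then show ?case
      unfolding E_def by (rule LIM_zero_cancel)
  qed
  with r(1) show ?thesis by blast
qed

section \<open>Littlewood-Paley estimates\<close>

text \<open>The symbol is chi(\<open>\<xi>\<close> / 2^n), so S_Q corresponds to n = Q + 1.\<close>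

definition lowpass_kern :: "(real^3 \<Rightarrow> real) \<Rightarrow> nat \<Rightarrow> real^3 \<Rightarrow> real" where
  "lowpass_kern chi n = dilate (2 ^ n) (kern chi)"

text \<open>Kernel of the block with frequency index q = n - 1; n = 0 is the low-frequency block q =
  -1.\<close>

definition block_kern :: "(real^3 \<Rightarrow> real) \<Rightarrow> nat \<Rightarrow> real^3 \<Rightarrow> real" where
  "block_kern chi n = (case n of 0 \<Rightarrow> lowpass_kern chi 0 | Suc k \<Rightarrow> (\<lambda>x. lowpass_kern chi (Suc k) x - lowpass_kern chi k x))"

text \<open>The symbol of this kernel is 1 on the support of the symbol of the n-th block, so the kernel reproduces the block.\<close>
definition wide_kern :: "(real^3 \<Rightarrow> real) \<Rightarrow> nat \<Rightarrow> real^3 \<Rightarrow> real" where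
  "wide_kern chi n = dilate (2 ^ n)
     (if n = 0 then dilate 2 (kern chi) else (\<lambda>x. dilate 2 (kern chi) x - dilate (1/4) (kern chi) x))"

section \<open>Reproducing property and scaling of the block kernels\<close>

lemma dilate_dilate: "dilate a (dilate b h) = dilate (a * b) h"
  by (simp add: dilate_def fun_eq_iff power_mult_distrib mult_ac)

lemma dilate_diff: "dilate a (\<lambda>x. h x - k x) = (\<lambda>x. dilate a h x - dilate a k x)"
  by (simp add: dilate_def fun_eq_iff right_diff_distrib)

text \<open>The cutoff is 1 up to radius 1/2 and vanishes from radius 1 on. If 2m <= l, the symbol
  at scale l is therefore 1 wherever the symbol at scale m is nonzero, and their product is the
  latter.\<close>

lemma dilate_kern_reproduce:
  assumes chi: "cutoff chi" and l: "0 < m" "2 * m \<le> l"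
  shows "(\<integral>y. dilate l (kern chi) (x - y) * dilate m (kern chi) y \<partial>lborel) = dilate m (kern chi) x"
proof -
  have e: "even_symbol chi" by (rule cutoff_even_symbol[OF chi])
  have l0: "l > 0" using l by simp
  have "chi ((1 / l) *\<^sub>R \<xi>) * chi ((1 / m) *\<^sub>R \<xi>) = chi ((1 / m) *\<^sub>R \<xi>)" for \<xi>
  proof (cases "norm \<xi> < m")
    case True
    then have "norm ((1 / l) *\<^sub>R \<xi>) \<le> 1 / 2" using l l0 by (simp add: pos_divide_le_eq)
    then show ?thesis using cutoffD(5)[OF chi] by simp
  next
    case False
    then have "1 \<le> norm ((1 / m) *\<^sub>R \<xi>)" using l by (simp add: pos_le_divide_eq)
    then show ?thesis using cutoffD(2)[OF chi] by simp
  qed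
  then have "(\<lambda>\<xi>. chi ((1 / l) *\<^sub>R \<xi>) * chi ((1 / m) *\<^sub>R \<xi>)) = (\<lambda>\<xi>. chi ((1 / m) *\<^sub>R \<xi>))"
    by (rule ext)
  with kern_convolution[OF even_symbol_scale[OF e l0] even_symbol_scale[OF e l(1)], of x]
  show ?thesis
    by (simp only: kern_scale[OF e l0] kern_scale[OF e l(1)])
qed

lemma dilate_kern_reproduce':
  assumes chi: "cutoff chi" and l: "0 < m" "2 * m \<le> l"
  shows "(\<integral>y. dilate m (kern chi) (x - y) * dilate l (kern chi) y \<partial>lborel) = dilate m (kern chi) x"
proof -
  have [measurable]: "kern chi \<in> borel_measurable borel"
    by (rule rapid_measurable[OF rapid_kern[OF cutoff_even_symbol[OF chi]]])
  show ?thesis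
    using dilate_kern_reproduce[OF assms, of x]
      lborel_integral_reflect[of "\<lambda>y. dilate l (kern chi) (x - y) * dilate m (kern chi) y" x]
    by (simp add: mult.commute)
qed

lemma rapid_lowpass_kern: "cutoff chi \<Longrightarrow> rapid (lowpass_kern chi n)"
  unfolding lowpass_kern_def by (intro rapid_dilate rapid_kern cutoff_even_symbol) auto

lemma rapid_block_kern: "cutoff chi \<Longrightarrow> rapid (block_kern chi n)"
  unfolding block_kern_def by (cases n) (auto intro!: rapid_diff rapid_lowpass_kern)

lemma rapid_wide_kern: "cutoff chi \<Longrightarrow> rapid (wide_kern chi n)"
  unfolding wide_kern_def by (auto intro!: rapid_diff rapid_dilate rapid_kern cutoff_even_symbol)

text \<open>For n >= 1 the factor 2 makes the upper cutoff equal to 1 on the support of the block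
  symbol, and the factor 1/4 confines the subtracted cutoff to |\<open>\<xi>\<close>| < 2^(n-2),
  where the block symbol vanishes. The subtraction gives the wide kernel mean zero without affecting
  the reproduction.\<close>

lemma wide_kern_reproduce:
  assumes chi: "cutoff chi"
  shows "(\<integral>y. wide_kern chi n (x - y) * block_kern chi n y \<partial>lborel) = block_kern chi n x"
proof (cases n)
  case 0
  then show ?thesis
    using dilate_kern_reproduce[OF chi, of 1 2 x]
    by (simp add: wide_kern_def block_kern_def lowpass_kern_def dilate_dilate)
next
  case (Suc k)
  let ?K = "\<lambda>l. dilate l (kern chi)"
  have r: "rapid (?K l)" if "l > 0" for l
    using that by (intro rapid_dilate rapid_kern cutoff_even_symbol chi)
  have i: "integrable lborel (\<lambda>y. ?K a (x - y) * ?K b y)" if "a > 0" "b > 0" for a b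
    by (intro convolve_integrable slow_growth_integrable rapid_integrable r that)
  have s: "wide_kern chi n = (\<lambda>x. ?K (2 ^ n * 2) x - ?K (2 ^ n / 4) x)" "block_kern chi n = (\<lambda>x. ?K (2 ^ n) x - ?K (2 ^ k) x)"
    using Suc by (auto simp: wide_kern_def block_kern_def lowpass_kern_def dilate_diff dilate_dilate fun_eq_iff)
  have "(\<integral>y. wide_kern chi n (x - y) * block_kern chi n y \<partial>lborel)
    = (\<integral>y. (?K (2 ^ n * 2) (x - y) * ?K (2 ^ n) y - ?K (2 ^ n * 2) (x - y) * ?K (2 ^ k) y)
          - (?K (2 ^ n / 4) (x - y) * ?K (2 ^ n) y - ?K (2 ^ n / 4) (x - y) * ?K (2 ^ k) y) \<partial>lborel)"
    unfolding s by (simp add: algebra_simps)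
  also have "\<dots> = (?K (2 ^ n) x - ?K (2 ^ k) x) - (?K (2 ^ n / 4) x - ?K (2 ^ n / 4) x)"
    using i Suc by (simp add: dilate_kern_reproduce[OF chi] dilate_kern_reproduce'[OF chi])
  finally show ?thesis by (simp add: s)
qed

text \<open>Associativity of convolution; w stands for the composed kernel, for which a closed form
  is known in the application.\<close>

lemma convolve_convolve:
  assumes h: "rapid h" and k: "rapid k" and f: "slow_growth f"
    and w: "\<And>x. (\<integral>y. h (x - y) * k y \<partial>lborel) = w x"
  shows "(\<integral>y. h (x - y) * convolve k f y \<partial>lborel) = convolve w f x"
proof -
  note [measurable] = rapid_measurable[OF h] rapid_measurable[OF k] slow_growth_measurable[OF f]
  have hx: "rapid (\<lambda>y. complex_of_real (h (x - y)))"
    using rapid_bounded_linear[OF bounded_linear_of_real rapid_affine[OF h, of "-1" x]] by simp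
  have "integrable (lborel \<Otimes>\<^sub>M lborel) (\<lambda>p. complex_of_real (case p of (z, y) \<Rightarrow> f z * (k (y - z) * h (x - y))))"
    using convolve_test_integrable[OF k f hx] by (simp add: case_prod_unfold)
  then have I: "integrable (lborel \<Otimes>\<^sub>M lborel) (\<lambda>(z, y). f z * (k (y - z) * h (x - y)))"
    by (simp only: complex_of_real_integrable_eq)
  have "(\<integral>y. h (x - y) * convolve k f y \<partial>lborel) = (\<integral>y. (\<integral>z. f z * (k (y - z) * h (x - y)) \<partial>lborel) \<partial>lborel)"
    unfolding convolve_def integral_mult_right_zero[symmetric] by (simp add: mult_ac)
  also have "\<dots> = (\<integral>z. (\<integral>y. f z * (k (y - z) * h (x - y)) \<partial>lborel) \<partial>lborel)"
    by (rule lborel_pair.Fubini_integral[OF I])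
  also have "\<dots> = (\<integral>z. w (x - z) * f z \<partial>lborel)"
  proof (rule Bochner_Integration.integral_cong[OF refl])
    fix z
    have "(\<integral>y. f z * (k (y - z) * h (x - y)) \<partial>lborel) = f z * (\<integral>y. k (y - z) * h (x - y) \<partial>lborel)"
      by (rule integral_mult_right_zero)
    also have "(\<integral>y. k (y - z) * h (x - y) \<partial>lborel) = (\<integral>y. h (x - z - y) * k y \<partial>lborel)"
      using lborel_integral_shift[of "\<lambda>y. k (y - z) * h (x - y)" z] by (simp add: mult.commute diff_diff_eq add.commute)
    finally show "(\<integral>y. f z * (k (y - z) * h (x - y)) \<partial>lborel) = w (x - z) * f z"
      by (simp add: w)
  qed
  finally show ?thesis by (simp add: convolve_def)
qed

lemma kern_cutoff_integral:
  assumes "cutoff chi"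
  shows "(\<integral>y. kern chi y \<partial>lborel) = 1"
  using integral_kern[OF cutoff_even_symbol[OF assms]] cutoffD(5)[OF assms, of 0] by simp

lemma integral_dilate_kern:
  assumes "cutoff chi" "l > 0"
  shows "(\<integral>y. dilate l (kern chi) y \<partial>lborel) = 1"
  using integral_dilate[OF rapid_measurable[OF rapid_kern[OF cutoff_even_symbol[OF assms(1)]]], of "\<lambda>_. 1" l] assms
  by (simp add: kern_cutoff_integral)

lemma wide_kern_mean_zero:
  assumes chi: "cutoff chi" and n: "n > 0"
  shows "(\<integral>y. wide_kern chi n y \<partial>lborel) = 0"
proof -
  have i: "integrable lborel (dilate l (kern chi))" if "l > 0" for l
    using that by (intro rapid_integrable rapid_dilate rapid_kern cutoff_even_symbol chi)
  show ?thesis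
    using n i by (simp add: wide_kern_def dilate_diff dilate_dilate integral_dilate_kern[OF chi])
qed

text \<open>Only two profiles occur, \<open>G 0\<close> and \<open>G 1\<close>, so one constant
  serves all n; the powers of 2 come from scaling.\<close>

lemma wide_kern_bounds:
  assumes chi: "cutoff chi"
  obtains B where "B > 0" "\<And>n. (\<integral>\<^sup>+y. ennreal (\<bar>wide_kern chi n y\<bar> * norm y) \<partial>lborel) \<le> ennreal (B / 2 ^ n)"
    "\<And>n z. (\<integral>\<^sup>+y. ennreal \<bar>wide_kern chi n (y + z) - wide_kern chi n y\<bar> \<partial>lborel) \<le> ennreal (B * 2 ^ n * norm z)"
proof -
  define G where "G n = (if n = 0 then dilate 2 (kern chi) else (\<lambda>x. dilate 2 (kern chi) x - dilate (1/4) (kern chi) x))" for n :: nat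
  have Gr: "rapid (G n)" for n
    unfolding G_def by (auto intro!: rapid_diff rapid_dilate rapid_kern cutoff_even_symbol chi)
  note [measurable] = rapid_measurable[OF Gr]
  have wG: "wide_kern chi n = dilate (2 ^ n) (G n)" for n by (simp add: wide_kern_def G_def)
  have "\<exists>C. C > 0 \<and> (\<forall>z. (\<integral>\<^sup>+y. ennreal \<bar>G n (y + z) - G n y\<bar> \<partial>lborel) \<le> ennreal (C * norm z))" for n
    using rapid_difference_L1[OF Gr[of n]] by metis
  then obtain C where C: "\<And>n. C n > 0" "\<And>n z. (\<integral>\<^sup>+y. ennreal \<bar>G n (y + z) - G n y\<bar> \<partial>lborel) \<le> ennreal (C n * norm z)"
    by metis
  define D where "D n = (\<integral>y. \<bar>G n y\<bar> * norm y \<partial>lborel)" for n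
  have Dn: "D n \<ge> 0" for n unfolding D_def by (rule integral_nonneg_AE) simp
  define B where "B = C 0 + C 1 + D 0 + D 1"
  have G1: "G n = G 0 \<or> G n = G 1" for n by (simp add: G_def)
  have CB: "(\<integral>\<^sup>+y. ennreal \<bar>G n (y + z) - G n y\<bar> \<partial>lborel) \<le> ennreal (B * norm z)" for n z
    using G1[of n]
  proof
    assume "G n = G 0"
    then show ?thesis using C(1)[of 1] Dn
      by (simp only:) (intro order_trans[OF C(2)[of 0 z]] ennreal_leI mult_right_mono, auto simp: B_def)
  next
    assume "G n = G 1"
    then show ?thesis using C(1)[of 0] Dn
      by (simp only:) (intro order_trans[OF C(2)[of 1 z]] ennreal_leI mult_right_mono, auto simp: B_def)
  qed
  have DB: "(\<integral>\<^sup>+y. ennreal (\<bar>G n y\<bar> * norm y) \<partial>lborel) \<le> ennreal B" for n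
  proof -
    have i: "integrable lborel (\<lambda>y. \<bar>G n y\<bar> * norm y)" for n
      using rapid_moment_integrable[OF Gr[of n], of 1] by (simp add: mult.commute)
    have "D n \<le> B" using G1[of n] C(1)[of 0] C(1)[of 1] Dn[of 0] Dn[of 1]
      by (auto simp: D_def B_def)
    then show ?thesis
      using nn_integral_eq_integral[OF i[of n]] by (simp add: D_def ennreal_leI)
  qed
  have B: "B > 0" using C(1)[of 0] C(1)[of 1] Dn[of 0] Dn[of 1] by (simp add: B_def)
  have 1: "(\<integral>\<^sup>+y. ennreal (\<bar>wide_kern chi n y\<bar> * norm y) \<partial>lborel) \<le> ennreal (B / 2 ^ n)" for n
  proof -
    have "(\<integral>\<^sup>+y. ennreal (\<bar>wide_kern chi n y\<bar> * norm y) \<partial>lborel) = (\<integral>\<^sup>+y. ennreal (1 / 2 ^ n) * ennreal (\<bar>G n y\<bar> * norm y) \<partial>lborel)"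
      using nn_integral_dilate[of "G n" "\<lambda>y. ennreal (norm y)" "2 ^ n"] unfolding wG
      by (simp add: ennreal_mult[symmetric] mult_ac)
    also have "\<dots> = ennreal (1 / 2 ^ n) * (\<integral>\<^sup>+y. ennreal (\<bar>G n y\<bar> * norm y) \<partial>lborel)"
      by (rule nn_integral_cmult) simp
    also have "\<dots> \<le> ennreal (1 / 2 ^ n) * ennreal B"
      by (intro mult_left_mono DB) simp
    finally show ?thesis using B by (simp add: ennreal_mult[symmetric])
  qed
  have 2: "(\<integral>\<^sup>+y. ennreal \<bar>wide_kern chi n (y + z) - wide_kern chi n y\<bar> \<partial>lborel) \<le> ennreal (B * 2 ^ n * norm z)" for n z
    unfolding wG by (rule dilate_difference_L1[OF _ _ CB]) auto
  show thesis by (rule that[OF B 1 2])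
qed

lemma sum_convolve_block:
  assumes chi: "cutoff chi" and u: "slow_growth u"
  shows "(\<Sum>n\<le>m. convolve (block_kern chi n) u x) = convolve (lowpass_kern chi m) u x"
proof (induction m)
  case (Suc m)
  have "convolve (block_kern chi (Suc m)) u x = convolve (lowpass_kern chi (Suc m)) u x - convolve (lowpass_kern chi m) u x"
    unfolding block_kern_def by (simp add: convolve_diff_left[OF rapid_lowpass_kern[OF chi] rapid_lowpass_kern[OF chi] u])
  then show ?case using Suc by simp
qed (simp add: block_kern_def)

text \<open>Associativity turns reproduction of the kernel into reproduction of the block, the form
  in which \<open>square_function_bound\<close> uses it.\<close>

lemma block_reproduce:
  assumes chi: "cutoff chi" and um: "u \<in> borel_measurable borel" and u2: "integrable lborel (\<lambda>x. (u x)\<^sup>2)"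
  defines "f \<equiv> \<lambda>n. convolve (block_kern chi n) u"
  shows "integrable lborel (\<lambda>y. wide_kern chi n y * f n (x - y))"
    "f n x = (\<integral>y. wide_kern chi n y * f n (x - y) \<partial>lborel)"
proof -
  have sg: "slow_growth u" by (rule slow_growth_square_integrable[OF um u2])
  have sf: "slow_growth (f n)" 
    unfolding f_def by (intro slow_growth_square_integrable convolve_L2[OF _ um u2] convolve_measurable rapid_block_kern chi sg)
  show "integrable lborel (\<lambda>y. wide_kern chi n y * f n (x - y))"
    by (rule convolve_commute(1)[OF rapid_wide_kern[OF chi] sf])
  have "(\<integral>y. wide_kern chi n y * f n (x - y) \<partial>lborel) = (\<integral>y. wide_kern chi n (x - y) * f n y \<partial>lborel)"
    using convolve_commute(2)[OF rapid_wide_kern[OF chi] sf, of n x] by (simp add: convolve_def)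
  also have "\<dots> = f n x"
    unfolding f_def by (rule convolve_convolve[OF rapid_wide_kern[OF chi] rapid_block_kern[OF chi] sg wide_kern_reproduce[OF chi]])
  finally show "f n x = (\<integral>y. wide_kern chi n y * f n (x - y) \<partial>lborel)" by simp
qed

text \<open>A majorises two sums of squares: over the blocks up to m with weights 2^n / 2^m, and
  over the later blocks without weights. \<open>square_function_bound\<close> is used twice, on the
  increments of the blocks up to m, which the same kernels reproduce, and on the blocks beyond m.
  The three conclusions are the factors that occur in the flux.\<close>

lemma littlewood_paley_L3_estimates:
  assumes chi: "cutoff chi"
  shows "\<exists>C>0. \<forall>u a m A. u \<in> borel_measurable borel \<longrightarrow> integrable lborel (\<lambda>x. (u x)\<^sup>2) \<longrightarrow>
       (\<forall>n. L3_bound lborel (convolve (block_kern chi n) u) (a n)) \<longrightarrow> 0 \<le> A \<longrightarrow>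
       (\<Sum>n\<le>m. (2 ^ n / 2 ^ m * a n)\<^sup>2) \<le> A\<^sup>2 \<longrightarrow> (\<forall>N. (\<Sum>n\<le>N. (a (Suc m + n))\<^sup>2) \<le> A\<^sup>2) \<longrightarrow>
       (\<forall>z. L3_bound lborel (\<lambda>x. u (x + z) - u x) (C * (1 + 2 ^ m * norm z) * A)) \<and>
       L3_bound lborel (\<lambda>x. u x - convolve (lowpass_kern chi m) u x) (C * A) \<and>
       (\<forall>i. L3_bound lborel (partial i (convolve (lowpass_kern chi m) u)) (C * 2 ^ m * A))"
proof -
  obtain B where B: "B > 0"
    and moment: "\<And>n. (\<integral>\<^sup>+y. ennreal (\<bar>wide_kern chi n y\<bar> * norm y) \<partial>lborel) \<le> ennreal (B / 2 ^ n)"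
    and diff: "\<And>n z. (\<integral>\<^sup>+y. ennreal \<bar>wide_kern chi n (y + z) - wide_kern chi n y\<bar> \<partial>lborel) \<le> ennreal (B * 2 ^ n * norm z)"
    using wide_kern_bounds[OF chi] by blast
  define R where "R = 6 * B\<^sup>2 + 4"
  have R: "R > 0" by (simp add: R_def add_nonneg_pos)
  define C where "C = R * B + 2 * R"
  have "R * B > 0" using R B by simp
  then have C: "C > 0" "R * B \<le> C" "R \<le> C" "2 * R \<le> C" using R by (auto simp: C_def)
  have iw: "integrable lborel (wide_kern chi n)" for n by (rule rapid_integrable[OF rapid_wide_kern[OF chi]])
  have [measurable]: "wide_kern chi n \<in> borel_measurable borel" for n by (rule rapid_measurable[OF rapid_wide_kern[OF chi]])
  show ?thesis
  proof (rule exI[of _ C], intro conjI[OF C(1)] allI impI)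
    fix u a m A
    assume um[measurable]: "u \<in> borel_measurable borel" and u2: "integrable lborel (\<lambda>x. (u x)\<^sup>2)"
      and L3: "\<forall>n. L3_bound lborel (convolve (block_kern chi n) u) (a n)" and A: "0 \<le> (A::real)"
      and low: "(\<Sum>n\<le>m. (2 ^ n / 2 ^ m * a n)\<^sup>2) \<le> A\<^sup>2" and high: "\<forall>N. (\<Sum>n\<le>N. (a (Suc m + n))\<^sup>2) \<le> A\<^sup>2"
    define f where "f n = convolve (block_kern chi n) u" for n
    define S where "S n = convolve (lowpass_kern chi n) u" for n
    have sg: "slow_growth u" by (rule slow_growth_square_integrable[OF um u2])
    have S_sum: "S n x = (\<Sum>k\<le>n. f k x)" for n x
      by (simp add: S_def f_def sum_convolve_block[OF chi sg])
    note fint = block_reproduce(1)[OF chi um u2, folded f_def]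
    note frep = block_reproduce(2)[OF chi um u2, folded f_def]
    have L3: "L3_bound lborel (f n) (a n)" for n using L3 by (simp add: f_def)
    have S_diff: "S n differentiable (at x)" for n x
      unfolding S_def by (rule convolve_differentiable[OF rapid_lowpass_kern[OF chi] sg])
    have [measurable]: "S n \<in> borel_measurable borel" for n
      unfolding S_def by (rule convolve_measurable[OF rapid_lowpass_kern[OF chi] sg])
    have low_diff: "L3_bound lborel (\<lambda>x. S m (x + z) - S m x) (R * B * (2 ^ m * norm z) * A)" for z
    proof -
      \<comment> \<open>Bound for the increment of the n-th block by z; pulling out B 2^m |z| leaves
        the weights 2^n / 2^m of the hypothesis on A.\<close>
      let ?a = "\<lambda>n. B * 2 ^ n * norm z * a n"
      have "L3_bound lborel (\<lambda>x. \<Sum>n\<le>m. f n (x + z) - f n x) ((6 * B\<^sup>2 + 4) * sqrt (\<Sum>n\<le>m. (?a n)\<^sup>2))"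
      proof (rule square_function_bound[where H="wide_kern chi" and \<mu>=1])
        fix n
        show "L3_bound lborel (\<lambda>x. f n (x + z) - f n x) (?a n)"
          by (rule L3_bound_difference_of_convolution[OF L3 _ _ diff fint frep]) (use B in auto)
        show "integrable lborel (wide_kern chi n)" by (rule iw)
        show "(\<integral>\<^sup>+y. ennreal \<bar>wide_kern chi n (y + z) - wide_kern chi n y\<bar> \<partial>lborel) \<le> ennreal (B * 1 * 2 ^ n * norm z)" for z
          using diff[of n z] by simp
        fix x
        have e: "x - y + z = x + z - y" for y by simp
        show "integrable lborel (\<lambda>y. wide_kern chi n y * (f n (x - y + z) - f n (x - y)))"
          unfolding e right_diff_distrib by (intro Bochner_Integration.integrable_diff fint)
        show "f n (x + z) - f n x = (\<integral>y. wide_kern chi n y * (f n (x - y + z) - f n (x - y)) \<partial>lborel)"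
          unfolding e right_diff_distrib using fint by (subst Bochner_Integration.integral_diff) (auto simp: frep[symmetric])
      qed (use B moment wide_kern_mean_zero[OF chi] in auto)
      then have "L3_bound lborel (\<lambda>x. S m (x + z) - S m x) (R * sqrt (\<Sum>n\<le>m. (?a n)\<^sup>2))"
        by (simp add: S_sum R_def sum_subtractf)
      moreover have "sqrt (\<Sum>n\<le>m. (?a n)\<^sup>2) \<le> B * (2 ^ m * norm z) * A"
      proof (rule real_le_lsqrt)
        have "(\<Sum>n\<le>m. (?a n)\<^sup>2) = (B * (2 ^ m * norm z))\<^sup>2 * (\<Sum>n\<le>m. (2 ^ n / 2 ^ m * a n)\<^sup>2)"
          unfolding sum_distrib_left by (rule sum.cong) (auto simp: power_mult_distrib power_divide)
        also have "\<dots> \<le> (B * (2 ^ m * norm z))\<^sup>2 * A\<^sup>2" by (intro mult_left_mono low) simp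
        finally show "(\<Sum>n\<le>m. (?a n)\<^sup>2) \<le> (B * (2 ^ m * norm z) * A)\<^sup>2"
          by (simp add: power_mult_distrib)
      qed (use B A in \<open>auto intro: sum_nonneg\<close>)
      ultimately show ?thesis
        using R by (elim L3_bound_mono) (simp add: mult.assoc)
    qed
    have tail: "L3_bound lborel (\<lambda>x. S (Suc m + N) x - S m x) (R * A)" for N
    proof -
      have "L3_bound lborel (\<lambda>x. \<Sum>n\<le>N. f (Suc m + n) x) ((6 * B\<^sup>2 + 4) * sqrt (\<Sum>n\<le>N. (a (Suc m + n))\<^sup>2))"
      \<comment> \<open>The scale \<open>\<mu>\<close> = 2^(m+1) lets the sequence start at block m
        + 1 with constants independent of m.\<close>
      proof (rule square_function_bound[where H="\<lambda>n. wide_kern chi (Suc m + n)" and \<mu>="2 ^ Suc m"])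
        fix n
        show "(\<integral>\<^sup>+y. ennreal (\<bar>wide_kern chi (Suc m + n) y\<bar> * norm y) \<partial>lborel) \<le> ennreal (B / (2 ^ Suc m * 2 ^ n))"
          using moment[of "Suc m + n"] by (simp add: power_add mult.assoc)
        show "(\<integral>\<^sup>+y. ennreal \<bar>wide_kern chi (Suc m + n) (y + z) - wide_kern chi (Suc m + n) y\<bar> \<partial>lborel) \<le> ennreal (B * 2 ^ Suc m * 2 ^ n * norm z)" for z
          using diff[of "Suc m + n" z] by (simp add: power_add mult_ac)
        show "(\<integral>y. wide_kern chi (Suc m + n) y \<partial>lborel) = 0" by (rule wide_kern_mean_zero[OF chi]) simp
      qed (rule L3 iw fint frep order_less_imp_le[OF B] | simp)+
      moreover have "(\<Sum>n\<le>N. f (Suc m + n) x) = S (Suc m + N) x - S m x" for x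
        by (induction N) (auto simp: S_sum)
      moreover have "sqrt (\<Sum>n\<le>N. (a (Suc m + n))\<^sup>2) \<le> A"
        using high A by (intro real_le_lsqrt) (auto intro: sum_nonneg)
      ultimately show ?thesis
        using R by (auto simp: R_def[symmetric] elim!: L3_bound_mono)
    qed
    have high_part: "L3_bound lborel (\<lambda>x. u x - S m x) (R * A)"
    proof -
      obtain r where r: "strict_mono r" "AE x in lborel. (\<lambda>n. S (r n) x) \<longlonglongrightarrow> u x"
        using approximate_identity_AE[OF rapid_kern[OF cutoff_even_symbol[OF chi]] kern_cutoff_integral[OF chi] um u2]
        unfolding S_def lowpass_kern_def by blast
      show ?thesis
      proof (rule L3_bound_AE_limit[where f="\<lambda>n x. S (r (Suc m + n)) x - S m x"])
        fix n
        \<comment> \<open>Starting the subsequence at \<open>Suc m\<close> makes every partial sum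
          reach past m, so that each difference is one of the tails bounded above.\<close>
        have "Suc m + n \<le> r (Suc m + n)" by (rule seq_suble[OF r(1)])
        then have "r (Suc m + n) = Suc m + (r (Suc m + n) - Suc m)" by simp
        then show "L3_bound lborel (\<lambda>x. S (r (Suc m + n)) x - S m x) (R * A)"
          using tail by metis
        show "AE x in lborel. (\<lambda>n. S (r (Suc m + n)) x - S m x) \<longlonglongrightarrow> u x - S m x"
          using r(2)
        proof eventually_elim
          case (elim x)
          have "(\<lambda>n. S (r (n + Suc m)) x) \<longlonglongrightarrow> u x"
            using LIMSEQ_ignore_initial_segment[OF elim, of "Suc m"] by simp
          then show ?case by (intro tendsto_intros) (simp add: add.commute)
        qed
      qed measurable
    qed
    have "L3_bound lborel (\<lambda>x. u (x + z) - u x) (C * (1 + 2 ^ m * norm z) * A)" for z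
    proof -
      have "L3_bound lborel (\<lambda>x. (u (x + z) - S m (x + z)) - (u x - S m x)) (R * A + R * A)"
        by (rule L3_bound_diff[OF L3_bound_shift[OF high_part] high_part])
      from L3_bound_add[OF low_diff[of z] this]
      have "L3_bound lborel (\<lambda>x. u (x + z) - u x) (R * B * (2 ^ m * norm z) * A + (R * A + R * A))"
        by (simp add: algebra_simps)
      then show ?thesis
      proof (rule L3_bound_mono)
        have "R * B * (2 ^ m * norm z) \<le> C * (2 ^ m * norm z)"
          by (intro mult_right_mono C) auto
        then have "R * B * (2 ^ m * norm z) + 2 * R \<le> C * (1 + 2 ^ m * norm z)"
          using C(4) unfolding distrib_left mult_1_right by linarith
        from mult_right_mono[OF this A] show "R * B * (2 ^ m * norm z) * A + (R * A + R * A) \<le> C * (1 + 2 ^ m * norm z) * A"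
          unfolding distrib_right[of _ _ A] by (simp add: mult.assoc mult.commute[of A R])
      qed
    qed
    moreover have "L3_bound lborel (\<lambda>x. u x - S m x) (C * A)"
      using high_part by (rule L3_bound_mono) (intro mult_right_mono C A)
    \<comment> \<open>The increment bound is linear in |z|, so the difference quotients have a
      common bound, which survives in the limit.\<close>
    moreover have "L3_bound lborel (partial i (S m)) (C * 2 ^ m * A)" for i
    proof (rule L3_bound_AE_limit)
      fix n
      show "L3_bound lborel (\<lambda>x. real (Suc n) *\<^sub>R (S m (x + (1 / real (Suc n)) *\<^sub>R axis i 1) - S m x)) (C * 2 ^ m * A)"
      proof -
        have "L3_bound lborel (\<lambda>x. real (Suc n) * (S m (x + (1 / real (Suc n)) *\<^sub>R axis i 1) - S m x))
          (\<bar>real (Suc n)\<bar> * (R * B * (2 ^ m * norm ((1 / real (Suc n)) *\<^sub>R axis i (1::real) :: real^3)) * A))"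
          by (rule L3_bound_cmult[OF low_diff])
        also have "\<bar>real (Suc n)\<bar> * (R * B * (2 ^ m * norm ((1 / real (Suc n)) *\<^sub>R axis i (1::real) :: real^3)) * A) = R * B * 2 ^ m * A"
          by (simp add: norm_axis_1 del: of_nat_Suc)
        finally show ?thesis
          by (simp del: of_nat_Suc) (erule L3_bound_mono, intro mult_right_mono C A, auto)
      qed
      show "AE x in lborel. (\<lambda>n. real (Suc n) *\<^sub>R (S m (x + (1 / real (Suc n)) *\<^sub>R axis i 1) - S m x)) \<longlonglongrightarrow> partial i (S m) x"
        by (intro AE_I2 partial_difference_quotient S_diff)
      show "partial i (S m) \<in> borel_measurable lborel"
        unfolding S_def partial_convolve[OF rapid_lowpass_kern[OF chi] sg]
        using convolve_measurable[OF rapid_partial[OF rapid_lowpass_kern[OF chi]] sg] by simp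
    qed
    ultimately show "(\<forall>z. L3_bound lborel (\<lambda>x. u (x + z) - u x) (C * (1 + 2 ^ m * norm z) * A)) \<and>
       L3_bound lborel (\<lambda>x. u x - convolve (lowpass_kern chi m) u x) (C * A) \<and>
       (\<forall>i. L3_bound lborel (partial i (convolve (lowpass_kern chi m) u)) (C * 2 ^ m * A))"
      by (simp add: S_def)
  qed
qed

section \<open>Decomposition of the flux\<close>

lemma cutoff_partial_bounded:
  assumes chi: "cutoff chi"
  obtains B where "B > 0" "\<And>x. \<bar>chi x\<bar> \<le> B" "\<And>i x. \<bar>partial i chi x\<bar> \<le> B"
proof -
  have r: "rapid chi"
    using cutoff_even_symbol[OF chi] by (intro rapid_bounded_support) (auto simp: even_symbol_def)
  obtain B0 where B0: "B0 > 0" "\<And>x. norm (chi x) \<le> B0 / (1 + norm x) ^ 0"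
    using rapid_decay[OF r] by blast
  have "\<forall>i. \<exists>B. B > 0 \<and> (\<forall>x. norm (partial i chi x) \<le> B / (1 + norm x) ^ 0)"
    using rapid_decay[OF rapid_partial[OF r]] by metis
  then obtain B where B: "\<And>i. B i > 0" "\<And>i x. norm (partial i chi x) \<le> B i / (1 + norm x) ^ 0"
    by metis
  have "\<bar>partial i chi x\<bar> \<le> B0 + (\<Sum>i\<in>UNIV. B i)" for i x
  proof -
    have "\<bar>partial i chi x\<bar> \<le> B i" using B(2)[of i x] by simp
    also have "\<dots> \<le> (\<Sum>i\<in>UNIV. B i)" using less_imp_le[OF B(1)] by (intro member_le_sum) auto
    finally show ?thesis using B0(1) by simp
  qed
  moreover have "0 \<le> (\<Sum>i\<in>UNIV. B i)" using less_imp_le[OF B(1)] by (intro sum_nonneg) auto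
  moreover have "\<bar>chi x\<bar> \<le> B0 + (\<Sum>i\<in>UNIV. B i)" for x
    using B0(2)[of x] calculation(2) by simp
  ultimately show thesis using B0(1) by (intro that[of "B0 + (\<Sum>i\<in>UNIV. B i)"]) auto
qed

text \<open>A cutoff at radius n + 1: it tends to 1 pointwise while its gradient is of order 1 / (n
  + 1).\<close>

definition bigcut :: "(real^3 \<Rightarrow> real) \<Rightarrow> nat \<Rightarrow> real^3 \<Rightarrow> real" where
  "bigcut chi n x = chi ((1 / real (Suc n)) *\<^sub>R x)"

lemma bigcut_props:
  assumes chi: "cutoff chi"
  shows "smooth (bigcut chi n)" "bounded_support (bigcut chi n)" "(\<lambda>n. bigcut chi n x) \<longlonglongrightarrow> 1"
    "partial i (bigcut chi n) x = (1 / real (Suc n)) * partial i chi ((1 / real (Suc n)) *\<^sub>R x)"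
proof -
  have e: "even_symbol (bigcut chi n)"
    unfolding bigcut_def by (rule even_symbol_scale[OF cutoff_even_symbol[OF chi]]) simp
  then show "smooth (bigcut chi n)" "bounded_support (bigcut chi n)" by (auto simp: even_symbol_def)
  show "partial i (bigcut chi n) x = (1 / real (Suc n)) * partial i chi ((1 / real (Suc n)) *\<^sub>R x)"
    using partial_affine[of chi 0 "1 / real (Suc n)" x i] smooth_differentiable[OF cutoffD(1)[OF chi]]
    by (simp add: bigcut_def[abs_def] del: of_nat_Suc)
  have "(\<lambda>n. (1 / real (Suc n)) *\<^sub>R x) \<longlonglongrightarrow> 0 *\<^sub>R x"
    using LIMSEQ_inverse_real_of_nat by (intro tendsto_scaleR tendsto_const) (simp add: inverse_eq_divide)
  then have "(\<lambda>n. chi ((1 / real (Suc n)) *\<^sub>R x)) \<longlonglongrightarrow> chi (0 *\<^sub>R x)"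
    by (intro continuous_on_tendsto_compose[OF smooth_continuous[OF cutoffD(1)[OF chi]]]) auto
  then show "(\<lambda>n. bigcut chi n x) \<longlonglongrightarrow> 1"
    using cutoffD(5)[OF chi, of 0] by (simp add: bigcut_def)
qed

text \<open>Bounded support is traded for boundedness and integrability: multiply by
  \<open>bigcut\<close>, whose gradient tends to 0, and pass to the limit by dominated
  convergence.\<close>

lemma integral_partial_eq_0_integrable:
  fixes g :: "real^3 \<Rightarrow> real"
  assumes chi: "cutoff chi" and g: "\<And>x. g differentiable (at x)" and gi: "integrable lborel g"
    and pi: "integrable lborel (partial i g)" and gb: "\<And>x. \<bar>g x\<bar> \<le> b" and pb: "\<And>x. \<bar>partial i g x\<bar> \<le> b"
  shows "(\<integral>x. partial i g x \<partial>lborel) = 0"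
proof -
  obtain B where B: "B > 0" "\<And>x. \<bar>chi x\<bar> \<le> B" "\<And>i x. \<bar>partial i chi x\<bar> \<le> B"
    using cutoff_partial_bounded[OF chi] by blast
  have b: "b \<ge> 0" using order_trans[OF abs_ge_zero gb] .
  have cb: "\<bar>bigcut chi n x\<bar> \<le> B" for n x by (simp add: bigcut_def B)
  have pcb: "\<bar>partial i (bigcut chi n) x\<bar> \<le> (1 / real (Suc n)) * B" for n x
    unfolding bigcut_props(4)[OF chi] abs_mult by (intro mult_mono B) auto
  have pcb': "\<bar>partial i (bigcut chi n) x\<bar> \<le> B" for n x
    using pcb[of n x] B(1) mult_right_mono[of "1 / real (Suc n)" 1 B] by (auto simp del: of_nat_Suc intro: order_trans)
  define f where "f n x = bigcut chi n x * g x" for n x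
  have cd: "bigcut chi n differentiable (at x)" for n x
    by (rule smooth_differentiable[OF bigcut_props(1)[OF chi]])
  have pf: "partial i (f n) x = bigcut chi n x * partial i g x + partial i (bigcut chi n) x * g x" for n x
    unfolding f_def[abs_def] by (rule partial_mult[OF cd g])
  have [measurable]: "g \<in> borel_measurable borel" "partial i g \<in> borel_measurable borel" using gi pi by auto
  have [measurable]: "bigcut chi n \<in> borel_measurable borel" "partial i (bigcut chi n) \<in> borel_measurable borel" for n
    by (intro borel_measurable_continuous_onI smooth_continuous smooth_partial bigcut_props[OF chi])+
  have zero: "(\<integral>x. partial i (f n) x \<partial>lborel) = 0" for n
  proof (rule integral_partial_eq_0)
    show "f n differentiable (at x)" for x unfolding f_def by (intro differentiable_mult cd g)
    show "bounded_support (f n)" unfolding f_def by (intro bounded_support_mult bigcut_props(2)[OF chi])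
    fix x
    have "\<bar>bigcut chi n x * partial i g x + partial i (bigcut chi n) x * g x\<bar> \<le> \<bar>bigcut chi n x\<bar> * \<bar>partial i g x\<bar> + \<bar>partial i (bigcut chi n) x\<bar> * \<bar>g x\<bar>"
      by (rule order_trans[OF abs_triangle_ineq]) (simp add: abs_mult)
    also have "\<dots> \<le> B * b + B * b"
      using B(1) by (intro add_mono mult_mono cb pb pcb' gb) auto
    finally show "norm (partial i (f n) x) \<le> B * b + B * b" by (simp add: pf)
  qed
  have "(\<lambda>n. \<integral>x. partial i (f n) x \<partial>lborel) \<longlonglongrightarrow> (\<integral>x. partial i g x \<partial>lborel)"
  proof (rule integral_dominated_convergence[where w="\<lambda>x. B * \<bar>partial i g x\<bar> + B * \<bar>g x\<bar>"])
    show "AE x in lborel. (\<lambda>n. partial i (f n) x) \<longlonglongrightarrow> partial i g x"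
    proof (rule AE_I2)
      fix x
      have inv0: "(\<lambda>n. (1 / real (Suc n)) * B) \<longlonglongrightarrow> 0"
        using tendsto_mult_left_zero[OF LIMSEQ_inverse_real_of_nat, of B] by (simp add: inverse_eq_divide)
      have "(\<lambda>n. partial i (bigcut chi n) x) \<longlonglongrightarrow> 0"
        by (rule Lim_null_comparison[OF _ inv0]) (use pcb in auto)
      then have "(\<lambda>n. partial i (f n) x) \<longlonglongrightarrow> 1 * partial i g x + 0 * g x"
        unfolding pf by (intro tendsto_intros bigcut_props(3)[OF chi])
      then show "(\<lambda>n. partial i (f n) x) \<longlonglongrightarrow> partial i g x" by simp
    qed
    show "AE x in lborel. norm (partial i (f n) x) \<le> B * \<bar>partial i g x\<bar> + B * \<bar>g x\<bar>" for n
    proof (rule AE_I2)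
      fix x
      have "\<bar>bigcut chi n x * partial i g x + partial i (bigcut chi n) x * g x\<bar> \<le> \<bar>bigcut chi n x\<bar> * \<bar>partial i g x\<bar> + \<bar>partial i (bigcut chi n) x\<bar> * \<bar>g x\<bar>"
        by (rule order_trans[OF abs_triangle_ineq]) (simp add: abs_mult)
      also have "\<dots> \<le> B * \<bar>partial i g x\<bar> + B * \<bar>g x\<bar>"
        by (intro add_mono mult_right_mono cb pcb') auto
      finally show "norm (partial i (f n) x) \<le> B * \<bar>partial i g x\<bar> + B * \<bar>g x\<bar>" by (simp add: pf)
    qed
    show "partial i (f n) \<in> borel_measurable lborel" for n
      unfolding pf[abs_def] by measurable
  qed (use gi pi in auto)
  then show ?thesis by (simp add: zero LIMSEQ_const_iff)
qed

text \<open>The distributional condition is tested with y |-> h(x - y), which \<open>bigcut\<close>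
  turns into a test function; the cutoff is then removed by dominated convergence.\<close>

lemma divergence_free_convolve:
  fixes v :: "3 \<Rightarrow> real^3 \<Rightarrow> real"
  assumes chi: "cutoff chi" and h: "rapid h" and v: "\<And>i. slow_growth (v i)"
    and div: "\<And>\<psi>. test_function \<psi> \<Longrightarrow> (\<integral>y. (\<Sum>i\<in>UNIV. v i y * partial i \<psi> y) \<partial>lborel) = 0"
  shows "(\<Sum>i\<in>UNIV. convolve (partial i h) (v i) x) = 0"
proof -
  obtain B where B: "B > 0" "\<And>x. \<bar>chi x\<bar> \<le> B" "\<And>i x. \<bar>partial i chi x\<bar> \<le> B"
    using cutoff_partial_bounded[OF chi] by blast
  note ph = rapid_partial[OF h]
  note [measurable] = slow_growth_measurable[OF v] rapid_measurable[OF h] rapid_measurable[OF ph]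
  have cb: "\<bar>bigcut chi n x\<bar> \<le> B" for n x by (simp add: bigcut_def B)
  have pcb: "\<bar>partial i (bigcut chi n) x\<bar> \<le> (1 / real (Suc n)) * B" for i n x
    unfolding bigcut_props(4)[OF chi] abs_mult by (intro mult_mono B) auto
  have pcb': "\<bar>partial i (bigcut chi n) x\<bar> \<le> B" for i n x
    using pcb[of i n x] B(1) mult_right_mono[of "1 / real (Suc n)" 1 B] by (auto simp del: of_nat_Suc intro: order_trans)
  have [measurable]: "bigcut chi n \<in> borel_measurable borel" "partial i (bigcut chi n) \<in> borel_measurable borel" for n i
    by (intro borel_measurable_continuous_onI smooth_continuous smooth_partial bigcut_props[OF chi])+
  define \<psi> where "\<psi> n y = bigcut chi n y * h (x - y)" for n y
  have hs: "smooth (\<lambda>y. h (x - y))"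
    using smooth_affine[OF rapid_smooth[OF h], of x "-1"] by simp
  have tf: "test_function (\<psi> n)" for n
    unfolding test_function_def
  proof
    show "smooth (\<psi> n)" unfolding \<psi>_def by (intro smooth_mult bigcut_props(1)[OF chi] hs)
    have "bounded_support (\<psi> n)" unfolding \<psi>_def by (intro bounded_support_mult bigcut_props(2)[OF chi])
    then obtain R where R: "\<And>y. norm y \<ge> R \<Longrightarrow> \<psi> n y = 0" by (auto simp: bounded_support_def)
    have "{y. \<psi> n y \<noteq> 0} \<subseteq> cball 0 R"
      using R by (auto simp: not_le[symmetric] intro: less_imp_le) (meson R linear)
    then show "compact (closure {y. \<psi> n y \<noteq> 0})"
      using bounded_subset[OF bounded_cball] by (auto simp: compact_closure)
  qed
  have ph': "partial i (\<lambda>y. h (x - y)) y = - partial i h (x - y)" for i y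
    using partial_affine[of h x "-1" y i] smooth_differentiable[OF rapid_smooth[OF h]] by simp
  have p\<psi>: "partial i (\<psi> n) y = - bigcut chi n y * partial i h (x - y) + partial i (bigcut chi n) y * h (x - y)" for i n y
    unfolding \<psi>_def[abs_def]
    using partial_mult[OF smooth_differentiable[OF bigcut_props(1)[OF chi]] smooth_differentiable[OF hs]] by (simp add: ph')
  let ?w = "\<lambda>y. \<Sum>i\<in>UNIV. B * \<bar>partial i h (x - y) * v i y\<bar> + B * \<bar>h (x - y) * v i y\<bar>"
  have "(\<lambda>n. \<integral>y. (\<Sum>i\<in>UNIV. v i y * partial i (\<psi> n) y) \<partial>lborel) \<longlonglongrightarrow> (\<integral>y. (\<Sum>i\<in>UNIV. - (partial i h (x - y) * v i y)) \<partial>lborel)"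
  proof (rule integral_dominated_convergence[where w="?w"])
    show "integrable lborel ?w"
      by (intro Bochner_Integration.integrable_sum Bochner_Integration.integrable_add integrable_mult_right integrable_abs convolve_integrable h ph v)
    show "AE y in lborel. (\<lambda>n. \<Sum>i\<in>UNIV. v i y * partial i (\<psi> n) y) \<longlonglongrightarrow> (\<Sum>i\<in>UNIV. - (partial i h (x - y) * v i y))"
    proof (intro AE_I2 tendsto_sum)
      fix y i
      have inv0: "(\<lambda>n. (1 / real (Suc n)) * B) \<longlonglongrightarrow> 0"
        using tendsto_mult_left_zero[OF LIMSEQ_inverse_real_of_nat, of B] by (simp add: inverse_eq_divide)
      have "(\<lambda>n. partial i (bigcut chi n) y) \<longlonglongrightarrow> 0"
        by (rule Lim_null_comparison[OF _ inv0]) (use pcb in auto)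
      then have "(\<lambda>n. v i y * partial i (\<psi> n) y) \<longlonglongrightarrow> v i y * (- 1 * partial i h (x - y) + 0 * h (x - y))"
        unfolding p\<psi> by (intro tendsto_intros bigcut_props(3)[OF chi])
      then show "(\<lambda>n. v i y * partial i (\<psi> n) y) \<longlonglongrightarrow> - (partial i h (x - y) * v i y)" by (simp add: mult.commute)
    qed
    show "AE y in lborel. norm (\<Sum>i\<in>UNIV. v i y * partial i (\<psi> n) y) \<le> ?w y" for n
    proof (rule AE_I2)
      fix y
      have "norm (\<Sum>i\<in>UNIV. v i y * partial i (\<psi> n) y) \<le> (\<Sum>i\<in>UNIV. norm (v i y * partial i (\<psi> n) y))"
        by (rule norm_sum)
      also have "\<dots> \<le> ?w y"
      proof (rule sum_mono)
        fix i
        have "norm (v i y * partial i (\<psi> n) y) \<le> \<bar>v i y\<bar> * (\<bar>bigcut chi n y\<bar> * \<bar>partial i h (x - y)\<bar> + \<bar>partial i (bigcut chi n) y\<bar> * \<bar>h (x - y)\<bar>)"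
          unfolding p\<psi> real_norm_def abs_mult
          by (intro mult_left_mono order_trans[OF abs_triangle_ineq]) (auto simp: abs_mult)
        also have "\<dots> \<le> \<bar>v i y\<bar> * (B * \<bar>partial i h (x - y)\<bar> + B * \<bar>h (x - y)\<bar>)"
          by (intro mult_left_mono add_mono mult_right_mono cb pcb') auto
        also have "\<dots> = B * \<bar>partial i h (x - y) * v i y\<bar> + B * \<bar>h (x - y) * v i y\<bar>"
          by (simp add: abs_mult algebra_simps)
        finally show "norm (v i y * partial i (\<psi> n) y) \<le> B * \<bar>partial i h (x - y) * v i y\<bar> + B * \<bar>h (x - y) * v i y\<bar>" .
      qed
      finally show "norm (\<Sum>i\<in>UNIV. v i y * partial i (\<psi> n) y) \<le> ?w y" .
    qed
    show "(\<lambda>y. \<Sum>i\<in>UNIV. v i y * partial i (\<psi> n) y) \<in> borel_measurable lborel" for n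
      unfolding p\<psi> by measurable
  qed measurable
  then have "(\<integral>y. (\<Sum>i\<in>UNIV. - (partial i h (x - y) * v i y)) \<partial>lborel) = 0"
    using div[OF tf] by (simp add: LIMSEQ_const_iff)
  moreover have "(\<integral>y. (\<Sum>i\<in>UNIV. - (partial i h (x - y) * v i y)) \<partial>lborel) = (\<Sum>i\<in>UNIV. - convolve (partial i h) (v i) x)"
    unfolding convolve_def
    by (subst Bochner_Integration.integral_sum) (auto intro!: convolve_integrable ph v)
  ultimately show ?thesis by (simp add: sum_negf)
qed

section \<open>The cubic term in the low-pass field and its cancellation\<close>

lemma integrable_mult_square_integrable:
  fixes f g :: "'a \<Rightarrow> real"
  assumes [measurable]: "f \<in> borel_measurable M" "g \<in> borel_measurable M"
    and i: "integrable M (\<lambda>x. (f x)\<^sup>2)" "integrable M (\<lambda>x. (g x)\<^sup>2)"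
  shows "integrable M (\<lambda>x. f x * g x)"
proof (rule Bochner_Integration.integrable_bound[of M "\<lambda>x. (f x)\<^sup>2 + (g x)\<^sup>2"])
  show "AE x in M. norm (f x * g x) \<le> norm ((f x)\<^sup>2 + (g x)\<^sup>2)"
  proof (rule AE_I2)
    fix x
    have "\<bar>f x\<bar> * \<bar>g x\<bar> \<le> (f x)\<^sup>2 + (g x)\<^sup>2"
      using sum_squares_bound[of "\<bar>f x\<bar>" "\<bar>g x\<bar>"] mult_nonneg_nonneg[OF abs_ge_zero[of "f x"] abs_ge_zero[of "g x"]]
      unfolding power2_abs by linarith
    then show "norm (f x * g x) \<le> norm ((f x)\<^sup>2 + (g x)\<^sup>2)" by (simp add: abs_mult)
  qed
qed (use i in auto)

lemma integrable_mult_bounded: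
  fixes f g :: "'a \<Rightarrow> real"
  assumes f: "integrable M f" and [measurable]: "g \<in> borel_measurable M" and g: "\<And>x. \<bar>g x\<bar> \<le> b"
  shows "integrable M (\<lambda>x. f x * g x)"
proof (rule Bochner_Integration.integrable_bound[OF integrable_mult_right[OF f, of b]])
  have [measurable]: "f \<in> borel_measurable M" using f by auto
  show "(\<lambda>x. f x * g x) \<in> borel_measurable M" by measurable
  show "AE x in M. norm (f x * g x) \<le> norm (b * f x)"
  proof (rule AE_I2)
    fix x
    have "\<bar>f x\<bar> * \<bar>g x\<bar> \<le> \<bar>f x\<bar> * \<bar>b\<bar>" using order_trans[OF g abs_ge_self] by (intro mult_left_mono) auto
    then show "norm (f x * g x) \<le> norm (b * f x)" by (simp add: abs_mult mult.commute)
  qed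
qed

text \<open>The integrand is the divergence of \<open>\<bar>S\<bar>\<^sup>2 S / 2\<close>.\<close>
lemma trilinear_cancellation:
  fixes S :: "3 \<Rightarrow> real^3 \<Rightarrow> real"
  assumes chi: "cutoff chi" and S: "\<And>i x. S i differentiable (at x)"
    and S2: "\<And>i. integrable lborel (\<lambda>x. (S i x)\<^sup>2)"
    and Sm: "\<And>i. S i \<in> borel_measurable borel" and pm: "\<And>i j. partial i (S j) \<in> borel_measurable borel"
    and Sb: "\<And>i x. \<bar>S i x\<bar> \<le> b" and pb: "\<And>i j x. \<bar>partial i (S j) x\<bar> \<le> b"
    and div: "\<And>x. (\<Sum>i\<in>UNIV. partial i (S i) x) = 0"
  shows "(\<integral>x. (\<Sum>i\<in>UNIV. \<Sum>j\<in>UNIV. S i x * S j x * partial i (S j) x) \<partial>lborel) = 0"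
proof -
  note [measurable] = Sm pm
  have b: "b \<ge> 0" using order_trans[OF abs_ge_zero Sb] .
  define E where "E x = (\<Sum>j\<in>UNIV. S j x * S j x / 2)" for x
  define g where "g i x = S i x * E x" for i x
  have SSd: "(\<lambda>x. S j x * S j x / 2) differentiable (at x)" for j x
    using differentiable_mult[OF differentiable_const[of "1/2"] differentiable_mult[OF S S]] by simp
  have pSS: "partial i (\<lambda>x. S j x * S j x / 2) x = S j x * partial i (S j) x" for i j x
  proof -
    have "partial i (\<lambda>x. (1/2) * (S j x * S j x)) x = (1/2) * partial i (\<lambda>x. S j x * S j x) x"
      by (rule partial_bounded_linear[OF bounded_linear_mult_right]) (intro derivative_intros S)
    then show ?thesis by (simp add: partial_mult[OF S S])
  qed
  have ED: "(E has_derivative (\<lambda>v. \<Sum>j\<in>UNIV. frechet_derivative (\<lambda>x. S j x * S j x / 2) (at x) v)) (at x)" for x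
    unfolding E_def[abs_def] using SSd by (intro has_derivative_sum) (simp add: frechet_derivative_works)
  have Ed: "E differentiable (at x)" for x by (rule differentiableI[OF ED])
  have pE: "partial i E x = (\<Sum>j\<in>UNIV. S j x * partial i (S j) x)" for i x
    using partial_eq[OF ED, of i x] pSS by (simp add: partial_def)
  have pg: "partial i (g i) x = (\<Sum>j\<in>UNIV. S i x * S j x * partial i (S j) x) + partial i (S i) x * E x" for i x
    unfolding g_def[abs_def] by (simp add: partial_mult[OF S Ed] pE sum_distrib_left mult.assoc)
  have [measurable]: "E \<in> borel_measurable borel" unfolding E_def[abs_def] by measurable
  have Eint: "integrable lborel E"
    unfolding E_def[abs_def] using S2 by (auto simp: power2_eq_square)
  have SS: "integrable lborel (\<lambda>x. S i x * S j x)" for i j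
    by (rule integrable_mult_square_integrable) (use S2 in auto)
  have Eb: "\<bar>E x\<bar> \<le> 3 * b\<^sup>2" for x
  proof -
    have "\<bar>E x\<bar> \<le> (\<Sum>j\<in>(UNIV::3 set). \<bar>S j x * S j x / 2\<bar>)" unfolding E_def by (rule sum_abs)
    also have "\<dots> \<le> (\<Sum>j\<in>(UNIV::3 set). b\<^sup>2)"
    proof (rule sum_mono)
      fix j :: 3
      have "\<bar>S j x\<bar> * \<bar>S j x\<bar> \<le> b * b" by (intro mult_mono Sb b) auto
      moreover have "0 \<le> b * b" using b by simp
      ultimately show "\<bar>S j x * S j x / 2\<bar> \<le> b\<^sup>2"
        unfolding power2_eq_square abs_mult abs_divide abs_numeral by linarith
    qed
    finally show ?thesis by simp
  qed
  have iT: "integrable lborel (\<lambda>x. S i x * S j x * partial i (S j) x)" for i j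
    by (rule integrable_mult_bounded[OF SS _ pb]) simp
  have iD: "integrable lborel (\<lambda>x. partial i (S i) x * E x)" for i
    using integrable_mult_bounded[OF Eint, of "partial i (S i)" b] pb by (simp add: mult.commute)
  have ipg: "integrable lborel (partial i (g i))" for i
    unfolding pg[abs_def] by (intro Bochner_Integration.integrable_add Bochner_Integration.integrable_sum iT iD)
  have ig: "integrable lborel (g i)" for i
    unfolding g_def[abs_def] using integrable_mult_bounded[OF Eint, of "S i" b] Sb by (simp add: mult.commute)
  have gb: "\<bar>g i x\<bar> \<le> b * (3 * b\<^sup>2)" for i x
    unfolding g_def abs_mult by (intro mult_mono Sb Eb b) auto
  have pgb: "\<bar>partial i (g i) x\<bar> \<le> 6 * (b * b\<^sup>2)" for i x
  proof -
    have "\<bar>\<Sum>j\<in>UNIV. S i x * S j x * partial i (S j) x\<bar> \<le> (\<Sum>j\<in>UNIV. \<bar>S i x * S j x * partial i (S j) x\<bar>)"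
      by (rule sum_abs)
    also have "\<dots> \<le> (\<Sum>j\<in>(UNIV::3 set). b * b * b)"
      unfolding abs_mult by (intro sum_mono mult_mono Sb pb b mult_nonneg_nonneg abs_ge_zero)
    finally have 1: "\<bar>\<Sum>j\<in>UNIV. S i x * S j x * partial i (S j) x\<bar> \<le> 3 * (b * b * b)" by simp
    have "\<bar>partial i (S i) x * E x\<bar> \<le> b * (3 * b\<^sup>2)"
      unfolding abs_mult by (intro mult_mono pb Eb b) auto
    with 1 show ?thesis unfolding pg by (simp add: power2_eq_square)
  qed
  have "b * (3 * b\<^sup>2) \<le> 6 * (b * b\<^sup>2)" using b by simp
  then have zero: "(\<integral>x. partial i (g i) x \<partial>lborel) = 0" for i
    using order_trans[OF gb] pgb
    by (intro integral_partial_eq_0_integrable[OF chi _ ig ipg, where b="6 * (b * b\<^sup>2)"])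
       (auto simp: g_def[abs_def] intro!: differentiable_mult S Ed)
  \<comment> \<open>The second parts of \<open>pg\<close> sum to E times the divergence of S, which
    is 0.\<close>
  have "(\<Sum>i\<in>UNIV. \<Sum>j\<in>UNIV. S i x * S j x * partial i (S j) x) = (\<Sum>i\<in>UNIV. partial i (g i) x)" for x
    unfolding pg sum.distrib sum_distrib_right[symmetric] div by simp
  then have "(\<integral>x. (\<Sum>i\<in>UNIV. \<Sum>j\<in>UNIV. S i x * S j x * partial i (S j) x) \<partial>lborel) = (\<Sum>i\<in>UNIV. (\<integral>x. partial i (g i) x \<partial>lborel))"
    using ipg by simp
  then show ?thesis by (simp add: zero)
qed

section \<open>Kernel averages of products of increments\<close>

definition increment_product :: "(real^3 \<Rightarrow> real) \<Rightarrow> (real^3 \<Rightarrow> real) \<Rightarrow> (real^3 \<Rightarrow> real) \<Rightarrow> real^3 \<Rightarrow> real" where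
  "increment_product h f g x = (\<integral>y. h y * ((f (x - y) - f x) * (g (x - y) - g x)) \<partial>lborel)"

text \<open>Expand the product of increments under the integral: since h has integral 1, the term
  f(x) g(x) returns unchanged. Completing the product of f - \<open>convolve h f\<close> and g -
  \<open>convolve h g\<close> leaves the product of the two averages.\<close>

lemma convolve_product_decomposition:
  assumes h: "rapid h" "(\<integral>y. h y \<partial>lborel) = 1" and f: "slow_growth f" and g: "slow_growth g" and fg: "slow_growth (\<lambda>x. f x * g x)"
  shows "convolve h (\<lambda>x. f x * g x) x = increment_product h f g x
    - (f x - convolve h f x) * (g x - convolve h g x) + convolve h f x * convolve h g x"
proof -
  note i = convolve_commute(1)[OF h(1) f, of x] convolve_commute(1)[OF h(1) g, of x] convolve_commute(1)[OF h(1) fg, of x] rapid_integrable[OF h(1)]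
  have "increment_product h f g x
    = (\<integral>y. h y * (f (x - y) * g (x - y)) - h y * f (x - y) * g x - h y * g (x - y) * f x + h y * (f x * g x) \<partial>lborel)"
    unfolding increment_product_def by (rule Bochner_Integration.integral_cong) (auto simp: algebra_simps)
  also have "\<dots> = convolve h (\<lambda>x. f x * g x) x - convolve h f x * g x - convolve h g x * f x + f x * g x"
    using i h(2) by (simp add: convolve_commute(2)[OF h(1) f] convolve_commute(2)[OF h(1) g] convolve_commute(2)[OF h(1) fg])
  finally show ?thesis by (simp add: algebra_simps)
qed

text \<open>For fixed y Hoelder's inequality is applied in x; integrating over y against the dilated
  kernel rescales 2^m |y| to |y|, so the constant is a moment of the undilated kernel
  \<open>\<kappa>\<close> and does not depend on m.\<close>

lemma increment_product_bound:
  assumes h: "rapid \<kappa>" and fm: "f \<in> borel_measurable borel" and gm: "g \<in> borel_measurable borel"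
    and f: "\<And>z. L3_bound lborel (\<lambda>x. f (x + z) - f x) (a * (1 + 2 ^ m * norm z))"
    and g: "\<And>z. L3_bound lborel (\<lambda>x. g (x + z) - g x) (a * (1 + 2 ^ m * norm z))"
    and w: "L3_bound lborel w c" and a: "0 \<le> a"
  shows "(\<integral>\<^sup>+x. ennreal \<bar>increment_product (dilate (2 ^ m) \<kappa>) f g x * w x\<bar> \<partial>lborel)
     \<le> ennreal (a\<^sup>2 * c * (\<integral>y. \<bar>\<kappa> y\<bar> * (1 + norm y)\<^sup>2 \<partial>lborel))"
proof -
  let ?h = "dilate (2 ^ m) \<kappa>"
  have wm: "w \<in> borel_measurable borel" using L3_boundD(1)[OF w] by simp
  note [measurable] = fm gm wm rapid_measurable[OF h]
  have c: "c \<ge> 0" by (rule L3_boundD(2)[OF w])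
  have i: "integrable lborel (\<lambda>y. \<bar>\<kappa> y\<bar> * (1 + norm y)\<^sup>2)"
  proof -
    have "integrable lborel (\<lambda>y. norm y ^ 0 * norm (\<kappa> y) + 2 * (norm y ^ 1 * norm (\<kappa> y)) + norm y ^ 2 * norm (\<kappa> y))"
      by (intro Bochner_Integration.integrable_add integrable_mult_right rapid_moment_integrable h)
    then show ?thesis by (simp add: power2_sum algebra_simps)
  qed
  have "(\<integral>\<^sup>+x. ennreal \<bar>increment_product ?h f g x * w x\<bar> \<partial>lborel)
    \<le> (\<integral>\<^sup>+x. (\<integral>\<^sup>+y. ennreal (\<bar>?h y\<bar> * (\<bar>f (x - y) - f x\<bar> * \<bar>g (x - y) - g x\<bar> * \<bar>w x\<bar>)) \<partial>lborel) \<partial>lborel)"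
  proof (rule nn_integral_mono)
    fix x
    have "ennreal \<bar>increment_product ?h f g x * w x\<bar> = ennreal \<bar>\<integral>y. ?h y * ((f (x - y) - f x) * (g (x - y) - g x)) * w x \<partial>lborel\<bar>"
      by (simp add: increment_product_def)
    also have "\<dots> \<le> (\<integral>\<^sup>+y. ennreal \<bar>?h y * ((f (x - y) - f x) * (g (x - y) - g x)) * w x\<bar> \<partial>lborel)"
      by (rule abs_integral_le_nn) measurable
    finally show "ennreal \<bar>increment_product ?h f g x * w x\<bar> \<le> (\<integral>\<^sup>+y. ennreal (\<bar>?h y\<bar> * (\<bar>f (x - y) - f x\<bar> * \<bar>g (x - y) - g x\<bar> * \<bar>w x\<bar>)) \<partial>lborel)"
      by (simp add: abs_mult mult.assoc)
  qed
  also have "\<dots> = (\<integral>\<^sup>+y. (\<integral>\<^sup>+x. ennreal (\<bar>?h y\<bar> * (\<bar>f (x - y) - f x\<bar> * \<bar>g (x - y) - g x\<bar> * \<bar>w x\<bar>)) \<partial>lborel) \<partial>lborel)"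
    by (rule lborel_pair.Fubini') measurable
  also have "\<dots> \<le> (\<integral>\<^sup>+y. ennreal \<bar>?h y\<bar> * ennreal (a\<^sup>2 * c * (1 + 2 ^ m * norm y)\<^sup>2) \<partial>lborel)"
  proof (rule nn_integral_mono)
    fix y
    have "(\<integral>\<^sup>+x. ennreal (\<bar>?h y\<bar> * (\<bar>f (x - y) - f x\<bar> * \<bar>g (x - y) - g x\<bar> * \<bar>w x\<bar>)) \<partial>lborel)
      = ennreal \<bar>?h y\<bar> * (\<integral>\<^sup>+x. ennreal (\<bar>f (x - y) - f x\<bar> * \<bar>g (x - y) - g x\<bar> * \<bar>w x\<bar>) \<partial>lborel)"
      by (subst nn_integral_cmult[symmetric]) (auto simp: ennreal_mult)
    also have "(\<integral>\<^sup>+x. ennreal (\<bar>f (x - y) - f x\<bar> * \<bar>g (x - y) - g x\<bar> * \<bar>w x\<bar>) \<partial>lborel)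
      \<le> ennreal ((a * (1 + 2 ^ m * norm y)) * (a * (1 + 2 ^ m * norm y)) * c)"
      using L3_Holder[OF f[of "- y"] g[of "- y"] w] by simp
    also have "(a * (1 + 2 ^ m * norm y)) * (a * (1 + 2 ^ m * norm y)) * c = a\<^sup>2 * c * (1 + 2 ^ m * norm y)\<^sup>2"
      by (simp add: power2_eq_square mult_ac)
    finally show "(\<integral>\<^sup>+x. ennreal (\<bar>?h y\<bar> * (\<bar>f (x - y) - f x\<bar> * \<bar>g (x - y) - g x\<bar> * \<bar>w x\<bar>)) \<partial>lborel)
        \<le> ennreal \<bar>?h y\<bar> * ennreal (a\<^sup>2 * c * (1 + 2 ^ m * norm y)\<^sup>2)"
      by (simp add: mult_left_mono)
  qed
  also have "\<dots> = (\<integral>\<^sup>+y. ennreal \<bar>\<kappa> y\<bar> * ennreal (a\<^sup>2 * c * (1 + norm y)\<^sup>2) \<partial>lborel)"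
    using nn_integral_dilate[of \<kappa> "\<lambda>y. ennreal (a\<^sup>2 * c * (1 + 2 ^ m * norm y)\<^sup>2)" "2 ^ m"] by simp
  also have "\<dots> = (\<integral>\<^sup>+y. ennreal (a\<^sup>2 * c * (\<bar>\<kappa> y\<bar> * (1 + norm y)\<^sup>2)) \<partial>lborel)"
    using c by (intro nn_integral_cong) (simp add: ennreal_mult[symmetric] mult_ac)
  also have "\<dots> = ennreal (\<integral>y. a\<^sup>2 * c * (\<bar>\<kappa> y\<bar> * (1 + norm y)\<^sup>2) \<partial>lborel)"
    using c by (intro nn_integral_eq_integral integrable_mult_right i) auto
  also have "(\<integral>y. a\<^sup>2 * c * (\<bar>\<kappa> y\<bar> * (1 + norm y)\<^sup>2) \<partial>lborel) = a\<^sup>2 * c * (\<integral>y. \<bar>\<kappa> y\<bar> * (1 + norm y)\<^sup>2 \<partial>lborel)"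
    by (rule integral_mult_right_zero)
  finally show ?thesis .
qed

section \<open>The flux estimate\<close>

lemma lam_nat: "lam (int n) = 2 ^ n"
  by (simp add: lam_def powr_realpow)

lemma LP_symbol_low: "LP_symbol chi (- 1) = chi"
  by (simp add: LP_symbol_def fun_eq_iff)

lemma LP_symbol_high: "LP_symbol chi (int k) = (\<lambda>\<xi>. chi ((1 / 2 ^ Suc k) *\<^sub>R \<xi>) - chi ((1 / 2 ^ k) *\<^sub>R \<xi>))"
  by (simp add: LP_symbol_def phi_def fun_eq_iff lam_nat inverse_eq_divide)

text \<open>The dilated phi is a difference of two cutoffs at neighbouring dyadic scales, each of
  which has a dilate of \<open>kern chi\<close> as its kernel.\<close>

lemma LP_symbol_kern:
  assumes chi: "cutoff chi"
  shows "even_symbol (LP_symbol chi (int n - 1))" "kern (LP_symbol chi (int n - 1)) = block_kern chi n"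
proof -
  have e: "even_symbol chi" by (rule cutoff_even_symbol[OF chi])
  have es: "even_symbol (\<lambda>\<xi>. chi ((1 / 2 ^ k) *\<^sub>R \<xi>))" for k
    by (rule even_symbol_scale[OF e]) simp
  have ks: "kern (\<lambda>\<xi>. chi ((1 / 2 ^ k) *\<^sub>R \<xi>)) = lowpass_kern chi k" for k
    unfolding lowpass_kern_def by (rule kern_scale[OF e]) simp
  have "even_symbol (LP_symbol chi (int n - 1)) \<and> kern (LP_symbol chi (int n - 1)) = block_kern chi n"
  proof (cases n)
    case 0
    then show ?thesis
      using e by (simp add: LP_symbol_low block_kern_def lowpass_kern_def dilate_def fun_eq_iff)
  next
    case (Suc k)
    have "LP_symbol chi (int n - 1) = (\<lambda>\<xi>. chi ((1 / 2 ^ Suc k) *\<^sub>R \<xi>) - chi ((1 / 2 ^ k) *\<^sub>R \<xi>))"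
      unfolding LP_symbol_high[symmetric] Suc by simp
    then show ?thesis
      using Suc even_symbol_diff[OF es es] kern_diff[OF es es] by (simp add: ks block_kern_def del: power_Suc)
  qed
  then show "even_symbol (LP_symbol chi (int n - 1))" "kern (LP_symbol chi (int n - 1)) = block_kern chi n" by auto
qed

lemma LP_block_eq:
  assumes chi: "cutoff chi" and f: "slow_growth f" "f' \<in> borel_measurable lebesgue" "AE x in lebesgue. f' x = f x"
  shows "LP_block chi (int n - 1) f' = convolve (block_kern chi n) f"
  unfolding LP_block_def fourier_multiplier_eq_convolve[OF chi LP_symbol_kern(1)[OF chi] f] LP_symbol_kern(2)[OF chi] ..

lemma LP_sum_eq:
  assumes chi: "cutoff chi" and f: "slow_growth f" "f' \<in> borel_measurable lebesgue" "AE x in lebesgue. f' x = f x"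
  shows "LP_sum chi (int Q) f' = convolve (lowpass_kern chi (Suc Q)) f"
proof
  fix x
  have "LP_sum chi (int Q) f' x = (\<Sum>n\<le>Suc Q. LP_block chi (int n - 1) f' x)"
    unfolding LP_sum_def
    by (rule sum.reindex_bij_witness[of _ "\<lambda>n. int n - 1" "\<lambda>q. nat (q + 1)"]) auto
  then show "LP_sum chi (int Q) f' x = convolve (lowpass_kern chi (Suc Q)) f x"
    by (simp add: LP_block_eq[OF chi f] sum_convolve_block[OF chi f(1)] del: sum.atMost_Suc)
qed

text \<open>Each of the nine index pairs contributes two products of three factors, of sizes C A, C
  A and C 2^m A. The increments bring in addition the moment M of the kernel, from the average over
  shifts. The product of low-pass fields in the decomposition drops out by
  \<open>trilinear_cancellation\<close>.\<close>

lemma flux_bound: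
  assumes chi: "cutoff chi"
  shows "\<exists>C>0. \<forall>v a m A. (\<forall>i::3. v i \<in> borel_measurable borel) \<longrightarrow> (\<forall>i. integrable lborel (\<lambda>x. (v i x)\<^sup>2)) \<longrightarrow>
       (\<forall>\<psi>. test_function \<psi> \<longrightarrow> (\<integral>y. (\<Sum>i\<in>UNIV. v i y * partial i \<psi> y) \<partial>lborel) = 0) \<longrightarrow>
       (\<forall>i n. L3_bound lborel (convolve (block_kern chi n) (v i)) (a n)) \<longrightarrow> 0 \<le> A \<longrightarrow>
       (\<Sum>n\<le>m. (2 ^ n / 2 ^ m * a n)\<^sup>2) \<le> A\<^sup>2 \<longrightarrow> (\<forall>N. (\<Sum>n\<le>N. (a (Suc m + n))\<^sup>2) \<le> A\<^sup>2) \<longrightarrow>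
       \<bar>\<integral>x. (\<Sum>i\<in>UNIV. \<Sum>j\<in>UNIV. convolve (lowpass_kern chi m) (\<lambda>y. v i y * v j y) x
          * partial i (convolve (lowpass_kern chi m) (v j)) x) \<partial>lborel\<bar> \<le> C * 2 ^ m * A ^ 3"
proof -
  obtain C where C: "C > 0" and E: "\<forall>u a m A. u \<in> borel_measurable borel \<longrightarrow> integrable lborel (\<lambda>x. (u x)\<^sup>2) \<longrightarrow>
       (\<forall>n. L3_bound lborel (convolve (block_kern chi n) u) (a n)) \<longrightarrow> 0 \<le> A \<longrightarrow>
       (\<Sum>n\<le>m. (2 ^ n / 2 ^ m * a n)\<^sup>2) \<le> A\<^sup>2 \<longrightarrow> (\<forall>N. (\<Sum>n\<le>N. (a (Suc m + n))\<^sup>2) \<le> A\<^sup>2) \<longrightarrow>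
       (\<forall>z. L3_bound lborel (\<lambda>x. u (x + z) - u x) (C * (1 + 2 ^ m * norm z) * A)) \<and>
       L3_bound lborel (\<lambda>x. u x - convolve (lowpass_kern chi m) u x) (C * A) \<and>
       (\<forall>i. L3_bound lborel (partial i (convolve (lowpass_kern chi m) u)) (C * 2 ^ m * A))"
    using littlewood_paley_L3_estimates[OF chi] by blast
  define M where "M = (\<integral>y. \<bar>kern chi y\<bar> * (1 + norm y)\<^sup>2 \<partial>lborel)"
  have M: "M \<ge> 0" unfolding M_def by (rule integral_nonneg_AE) simp
  define C' where "C' = 9 * (C ^ 3 * M + C ^ 3)"
  have C': "C' > 0" using C M by (simp add: C'_def add_nonneg_pos)
  show ?thesis
  proof (rule exI[of _ C'], intro conjI[OF C'] allI impI)
    fix v :: "3 \<Rightarrow> real^3 \<Rightarrow> real" and a m A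
    assume "\<forall>i. v i \<in> borel_measurable borel" "\<forall>i. integrable lborel (\<lambda>x. (v i x)\<^sup>2)"
      and div: "\<forall>\<psi>. test_function \<psi> \<longrightarrow> (\<integral>y. (\<Sum>i\<in>UNIV. v i y * partial i \<psi> y) \<partial>lborel) = 0"
      and L3: "\<forall>i n. L3_bound lborel (convolve (block_kern chi n) (v i)) (a n)" and A: "0 \<le> A"
      and low: "(\<Sum>n\<le>m. (2 ^ n / 2 ^ m * a n)\<^sup>2) \<le> A\<^sup>2" and high: "\<forall>N. (\<Sum>n\<le>N. (a (Suc m + n))\<^sup>2) \<le> A\<^sup>2"
    then have vm: "v i \<in> borel_measurable borel" and v2: "integrable lborel (\<lambda>x. (v i x)\<^sup>2)" for i by auto
    define h where "h = lowpass_kern chi m"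
    define S where "S i = convolve h (v i)" for i
    define P where "P i j = convolve h (\<lambda>y. v i y * v j y)" for i j
    define r where "r i j = increment_product h (v i) (v j)" for i j
    have est: "\<forall>z. L3_bound lborel (\<lambda>x. v i (x + z) - v i x) (C * (1 + 2 ^ m * norm z) * A)"
      "L3_bound lborel (\<lambda>x. v i x - S i x) (C * A)" "L3_bound lborel (partial j (S i)) (C * 2 ^ m * A)" for i j
      using E[rule_format, of "v i" a A m] vm v2 L3 A low high by (auto simp: S_def h_def)
    have hr: "rapid h" unfolding h_def by (rule rapid_lowpass_kern[OF chi])
    have h1: "(\<integral>y. h y \<partial>lborel) = 1" unfolding h_def lowpass_kern_def by (rule integral_dilate_kern[OF chi]) simp
    have sg: "slow_growth (v i)" for i by (rule slow_growth_square_integrable[OF vm v2])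
    have ivv: "integrable lborel (\<lambda>x. v i x * v j x)" for i j
      by (rule integrable_mult_square_integrable) (use vm v2 in auto)
    have sgv: "slow_growth (\<lambda>x. v i x * v j x)" for i j by (rule slow_growth_integrable[OF ivv])
    have Sd: "S i differentiable (at x)" for i x unfolding S_def by (rule convolve_differentiable[OF hr sg])
    have pS: "partial i (S j) = convolve (partial i h) (v j)" for i j unfolding S_def by (rule partial_convolve[OF hr sg])
    have Sm: "S i \<in> borel_measurable borel" for i unfolding S_def by (rule convolve_measurable[OF hr sg])
    have pm: "partial i (S j) \<in> borel_measurable borel" for i j unfolding pS by (rule convolve_measurable[OF rapid_partial[OF hr] sg])
    have Pm: "P i j \<in> borel_measurable borel" for i j unfolding P_def by (rule convolve_measurable[OF hr sgv])
    have rm: "r i j \<in> borel_measurable borel" for i j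
    proof -
      note [measurable] = vm rapid_measurable[OF hr]
      show ?thesis unfolding r_def increment_product_def by measurable
    qed
    note [measurable] = vm Sm pm Pm rm
    have S2: "integrable lborel (\<lambda>x. (S i x)\<^sup>2)" for i unfolding S_def by (rule convolve_L2(1)[OF hr vm v2])
    have "\<forall>i. \<exists>b. \<forall>x. \<bar>S i x\<bar> \<le> b" unfolding S_def using convolve_L2(2)[OF hr vm v2] by blast
    then obtain bS where bS: "\<And>i x. \<bar>S i x\<bar> \<le> bS i" by metis
    have "\<forall>i j. \<exists>b. \<forall>x. \<bar>partial i (S j) x\<bar> \<le> b" unfolding pS using convolve_L2(2)[OF rapid_partial[OF hr] vm v2] by blast
    then obtain bP where bP: "\<And>i j x. \<bar>partial i (S j) x\<bar> \<le> bP i j" by metis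
    \<comment> \<open>One bound for all components and all derivatives, as
      \<open>trilinear_cancellation\<close> expects; its size does not enter the final
      constant.\<close>
    define b where "b = (\<Sum>i\<in>UNIV. \<bar>bS i\<bar>) + (\<Sum>i\<in>UNIV. \<Sum>j\<in>UNIV. \<bar>bP i j\<bar>)"
    have Sb: "\<bar>S i x\<bar> \<le> b" for i x
    proof -
      have "\<bar>bS i\<bar> \<le> (\<Sum>i\<in>UNIV. \<bar>bS i\<bar>)" by (rule member_le_sum) auto
      moreover have "0 \<le> (\<Sum>i\<in>UNIV. \<Sum>j\<in>UNIV. \<bar>bP i j\<bar>)" by (intro sum_nonneg) auto
      ultimately show ?thesis using bS[of i x] unfolding b_def by linarith
    qed
    have pb: "\<bar>partial i (S j) x\<bar> \<le> b" for i j x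
    proof -
      have "\<bar>bP i j\<bar> \<le> (\<Sum>j\<in>UNIV. \<bar>bP i j\<bar>)" by (rule member_le_sum) auto
      also have "\<dots> \<le> (\<Sum>i\<in>UNIV. \<Sum>j\<in>UNIV. \<bar>bP i j\<bar>)" by (rule member_le_sum) (auto intro: sum_nonneg)
      finally have "\<bar>bP i j\<bar> \<le> (\<Sum>i\<in>UNIV. \<Sum>j\<in>UNIV. \<bar>bP i j\<bar>)" .
      moreover have "0 \<le> (\<Sum>i\<in>UNIV. \<bar>bS i\<bar>)" by (intro sum_nonneg) auto
      ultimately show ?thesis using bP[of i j x] unfolding b_def by linarith
    qed
    have divS: "(\<Sum>i\<in>UNIV. partial i (S i) x) = 0" for x
      unfolding pS by (rule divergence_free_convolve[OF chi hr sg div[rule_format]])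
    have cancel: "(\<integral>x. (\<Sum>i\<in>UNIV. \<Sum>j\<in>UNIV. S i x * S j x * partial i (S j) x) \<partial>lborel) = 0"
      by (rule trilinear_cancellation[OF chi Sd S2 Sm pm Sb pb divS])
    have iSS: "integrable lborel (\<lambda>x. S i x * S j x * partial i (S j) x)" for i j
      by (rule integrable_mult_bounded[OF integrable_mult_square_integrable[OF _ _ S2 S2] _ pb]) auto
    let ?D = "\<lambda>i x. v i x - S i x"
    have DD: "(\<integral>\<^sup>+x. ennreal \<bar>?D i x * ?D j x * partial i (S j) x\<bar> \<partial>lborel) \<le> ennreal (C ^ 3 * 2 ^ m * A ^ 3)" for i j
      using L3_Holder[of lborel "?D i" "C * A" "?D j" "C * A" "partial i (S j)" "C * 2 ^ m * A"] est
      by (simp add: abs_mult power3_eq_cube mult_ac)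
    have iDD: "integrable lborel (\<lambda>x. ?D i x * ?D j x * partial i (S j) x)" for i j
      using order.strict_trans1[OF DD[of i j] ennreal_less_top] by (intro integrableI_bounded) auto
    have RR: "(\<integral>\<^sup>+x. ennreal \<bar>r i j x * partial i (S j) x\<bar> \<partial>lborel) \<le> ennreal (C ^ 3 * M * 2 ^ m * A ^ 3)" for i j
    proof -
      have "(\<integral>\<^sup>+x. ennreal \<bar>increment_product (dilate (2 ^ m) (kern chi)) (v i) (v j) x * partial i (S j) x\<bar> \<partial>lborel)
        \<le> ennreal ((C * A)\<^sup>2 * (C * 2 ^ m * A) * (\<integral>y. \<bar>kern chi y\<bar> * (1 + norm y)\<^sup>2 \<partial>lborel))"
        using est C A
        by (intro increment_product_bound rapid_kern cutoff_even_symbol chi vm) (auto simp: mult_ac)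
      moreover have "(C * A)\<^sup>2 * (C * 2 ^ m * A) * M = C ^ 3 * M * 2 ^ m * A ^ 3"
        by (simp add: power2_eq_square power3_eq_cube mult_ac)
      ultimately show ?thesis
        by (simp only: r_def h_def lowpass_kern_def M_def[symmetric])
    qed
    have iRR: "integrable lborel (\<lambda>x. r i j x * partial i (S j) x)" for i j
      using order.strict_trans1[OF RR[of i j] ennreal_less_top] by (intro integrableI_bounded) auto
    have P_eq: "P i j x = r i j x - ?D i x * ?D j x + S i x * S j x" for i j x
      unfolding P_def r_def S_def by (rule convolve_product_decomposition[OF hr h1 sg sg sgv])
    have abs_le: "\<bar>\<integral>x. f x \<partial>lborel\<bar> \<le> c" if "(\<integral>\<^sup>+x. ennreal \<bar>f x\<bar> \<partial>lborel) \<le> ennreal c" "0 \<le> c" "f \<in> borel_measurable borel" for f :: "real^3 \<Rightarrow> real" and c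
      using order_trans[OF abs_integral_le_nn[of f lborel] that(1)] that by simp
    have "(\<integral>x. (\<Sum>i\<in>UNIV. \<Sum>j\<in>UNIV. P i j x * partial i (S j) x) \<partial>lborel)
      = (\<integral>x. (\<Sum>i\<in>UNIV. \<Sum>j\<in>UNIV. r i j x * partial i (S j) x - ?D i x * ?D j x * partial i (S j) x)
           + (\<Sum>i\<in>UNIV. \<Sum>j\<in>UNIV. S i x * S j x * partial i (S j) x) \<partial>lborel)"
      unfolding P_eq sum.distrib[symmetric] by (simp only: left_diff_distrib distrib_right)
    also have "\<dots> = (\<integral>x. (\<Sum>i\<in>UNIV. \<Sum>j\<in>UNIV. r i j x * partial i (S j) x - ?D i x * ?D j x * partial i (S j) x) \<partial>lborel)"
      by (subst Bochner_Integration.integral_add)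
         (auto intro!: Bochner_Integration.integrable_sum Bochner_Integration.integrable_diff iRR iDD iSS simp: cancel)
    also have "\<dots> = (\<Sum>i\<in>UNIV. \<Sum>j\<in>UNIV. (\<integral>x. r i j x * partial i (S j) x \<partial>lborel) - (\<integral>x. ?D i x * ?D j x * partial i (S j) x \<partial>lborel))"
      using iRR iDD by (simp add: Bochner_Integration.integral_sum)
    finally have split: "(\<integral>x. (\<Sum>i\<in>UNIV. \<Sum>j\<in>UNIV. P i j x * partial i (S j) x) \<partial>lborel)
      = (\<Sum>i\<in>UNIV. \<Sum>j\<in>UNIV. (\<integral>x. r i j x * partial i (S j) x \<partial>lborel) - (\<integral>x. ?D i x * ?D j x * partial i (S j) x \<partial>lborel))" .
    have "\<bar>\<integral>x. (\<Sum>i\<in>UNIV. \<Sum>j\<in>UNIV. P i j x * partial i (S j) x) \<partial>lborel\<bar>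
        \<le> (\<Sum>i\<in>(UNIV::3 set). \<Sum>j\<in>(UNIV::3 set). C ^ 3 * M * 2 ^ m * A ^ 3 + C ^ 3 * 2 ^ m * A ^ 3)"
      unfolding split
    proof (intro order_trans[OF sum_abs] sum_mono)
      fix i j :: 3
      have "\<bar>\<integral>x. r i j x * partial i (S j) x \<partial>lborel\<bar> \<le> C ^ 3 * M * 2 ^ m * A ^ 3"
        using C M A by (intro abs_le[OF RR]) auto
      moreover have "\<bar>\<integral>x. ?D i x * ?D j x * partial i (S j) x \<partial>lborel\<bar> \<le> C ^ 3 * 2 ^ m * A ^ 3"
        using C A by (intro abs_le[OF DD]) auto
      ultimately show "\<bar>(\<integral>x. r i j x * partial i (S j) x \<partial>lborel) - (\<integral>x. ?D i x * ?D j x * partial i (S j) x \<partial>lborel)\<bar> \<le> C ^ 3 * M * 2 ^ m * A ^ 3 + C ^ 3 * 2 ^ m * A ^ 3"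
        by linarith
    qed
    also have "\<dots> = C' * 2 ^ m * A ^ 3" 
    proof -
      have nine: "(\<Sum>i\<in>(UNIV::3 set). \<Sum>j\<in>(UNIV::3 set). T) = 9 * T" for T :: real by simp
      show ?thesis
        unfolding nine C'_def distrib_left distrib_right by (simp only: mult.assoc)
    qed
    finally show "\<bar>\<integral>x. (\<Sum>i\<in>UNIV. \<Sum>j\<in>UNIV. convolve (lowpass_kern chi m) (\<lambda>y. v i y * v j y) x
          * partial i (convolve (lowpass_kern chi m) (v j)) x) \<partial>lborel\<bar> \<le> C' * 2 ^ m * A ^ 3"
      by (simp add: P_def S_def h_def)
  qed
qed

text \<open>Measured in units of lambda_Q^(2/3), the weights are 1 above Q and (lambda_q /
  lambda_Q)^2 up to Q, exactly the squared weights of the two sums in \<open>flux_bound\<close>. At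
  q = Q, that is n = Q + 1, both rules give 1.\<close>

lemma K_weight:
  "K (int Q - (int n - 1)) * lam (int n - 1) powr (2/3)
    = lam (int Q) powr (2/3) * (if n \<le> Suc Q then (2 ^ n / 2 ^ Suc Q)\<^sup>2 else 1)"
proof -
  let ?q = "real n - 1" and ?Q = "real Q"
  have lam1: "lam (int n - 1) = 2 powr ?q" "lam (int Q) = 2 powr ?Q" "lam (int Q - (int n - 1)) = 2 powr (?Q - ?q)"
    by (simp_all add: lam_def)
  have two: "(2 ^ n / 2 ^ Suc Q :: real)\<^sup>2 = 2 powr (2 * (?q - ?Q))"
  proof -
    have "(2 ^ n / 2 ^ Suc Q :: real) = 2 powr (?q - ?Q)"
      by (simp add: powr_diff powr_realpow)
    then show ?thesis by (simp add: powr_power mult.commute)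
  qed
  consider "n < Suc Q" | "n = Suc Q" | "n > Suc Q" by linarith
  then show ?thesis
  proof cases
    case 1
    then have "K (int Q - (int n - 1)) = 2 powr ((?Q - ?q) * (- 4 / 3))"
      by (simp add: K_def lam1 powr_powr)
    moreover have "(?Q - ?q) * (- 4 / 3) + ?q * (2/3) = ?Q * (2/3) + 2 * (?q - ?Q)"
      by (simp add: field_simps)
    moreover have "n \<le> Suc Q" using 1 by simp
    ultimately show ?thesis
      by (simp only: two lam1 powr_powr powr_add[symmetric] if_True)
  next
    case 2
    then show ?thesis by (simp add: K_def lam_def)
  next
    case 3
    then have "K (int Q - (int n - 1)) = 2 powr ((?Q - ?q) * (2 / 3))"
      by (simp add: K_def lam1 powr_powr)
    then show ?thesis
      using 3 unfolding lam1 by (simp add: powr_powr powr_add[symmetric] field_simps)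
  qed
qed

section \<open>From extended sums to the real bounds and the conclusion\<close>

lemma epowr_third:
  assumes "x \<noteq> \<infinity>"
  shows "epowr x (1/3) = ennreal (enn2real (epowr x (1/3)))" "x = ennreal (enn2real (epowr x (1/3)) ^ 3)"
proof -
  show "epowr x (1/3) = ennreal (enn2real (epowr x (1/3)))"
    using assms by (simp add: epowr_def)
  have "(enn2real x powr (1/3)) ^ 3 = enn2real x"
    by (cases "enn2real x = 0") (auto simp: powr_power)
  then show "x = ennreal (enn2real (epowr x (1/3)) ^ 3)"
    using assms by (simp add: epowr_def less_top)
qed

theorem proposition3p2:
  fixes chi :: "real^3 \<Rightarrow> real"
  assumes "cutoff chi"
  shows "\<exists>C::real. C > 0 \<and> (\<forall>(u :: real^3 \<Rightarrow> real^3) (Q :: nat).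
    L2_field u \<longrightarrow> divergence_free u \<longrightarrow>
    ennreal \<bar>energy_flux chi (int Q) u\<bar> \<le> ennreal C * epowr (K_conv_d2 chi u (int Q)) (3/2))"
proof -
  note chi = assms
  obtain C where C: "C > 0" and flux: "\<forall>v a m A. (\<forall>i::3. v i \<in> borel_measurable borel) \<longrightarrow> (\<forall>i. integrable lborel (\<lambda>x. (v i x)\<^sup>2)) \<longrightarrow>
       (\<forall>\<psi>. test_function \<psi> \<longrightarrow> (\<integral>y. (\<Sum>i\<in>UNIV. v i y * partial i \<psi> y) \<partial>lborel) = 0) \<longrightarrow>
       (\<forall>i n. L3_bound lborel (convolve (block_kern chi n) (v i)) (a n)) \<longrightarrow> 0 \<le> A \<longrightarrow>
       (\<Sum>n\<le>m. (2 ^ n / 2 ^ m * a n)\<^sup>2) \<le> A\<^sup>2 \<longrightarrow> (\<forall>N. (\<Sum>n\<le>N. (a (Suc m + n))\<^sup>2) \<le> A\<^sup>2) \<longrightarrow>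
       \<bar>\<integral>x. (\<Sum>i\<in>UNIV. \<Sum>j\<in>UNIV. convolve (lowpass_kern chi m) (\<lambda>y. v i y * v j y) x
          * partial i (convolve (lowpass_kern chi m) (v j)) x) \<partial>lborel\<bar> \<le> C * 2 ^ m * A ^ 3"
    using flux_bound[OF chi] by blast
  show ?thesis
  \<comment> \<open>The factor 2 comes from 2^(Q+1) = 2 lambda_Q, the low-pass index being Q +
    1.\<close>
  proof (intro exI[of _ "2 * C"] conjI allI impI)
    show "2 * C > 0" using C by simp
    fix u :: "real^3 \<Rightarrow> real^3" and Q :: nat
    assume L2: "L2_field u" and div: "divergence_free u"
    have um: "(\<lambda>x. u x $ i) \<in> borel_measurable lebesgue" for i
      using L2 unfolding L2_field_def cart_eq_inner_axis by (intro borel_measurable_inner) auto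
    \<comment> \<open>Borel versions of the components: u is given as a Lebesgue measurable field,
      while the convolution estimates are for Borel functions.\<close>
    have "\<forall>i. \<exists>g\<in>borel_measurable lborel. AE x in lborel. u x $ i = g x"
      using completion_ex_borel_measurable_real[OF um] by blast
    then obtain v where v: "\<And>i. v i \<in> borel_measurable lborel" "\<And>i. AE x in lborel. u x $ i = v i x"
      by metis
    have vm[measurable]: "v i \<in> borel_measurable borel" for i using v(1)[of i] by simp
    have vl[measurable]: "v i \<in> borel_measurable lebesgue" for i by (rule measurable_completion[OF v(1)])
    have uv: "AE x in lebesgue. u x $ i = v i x" for i by (rule AE_completion[OF v(2)])
    have uv_all: "AE x in lebesgue. \<forall>i. u x $ i = v i x" by (rule eventually_all_finite[OF uv])
    note [measurable] = um
    have v2: "integrable lborel (\<lambda>x. (v i x)\<^sup>2)" for i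
    proof -
      have "integrable lebesgue (\<lambda>x. (u x $ i)\<^sup>2)"
      proof (rule Bochner_Integration.integrable_bound)
        show "integrable lebesgue (\<lambda>x. (norm (u x))\<^sup>2)" using L2 by (simp add: L2_field_def)
        show "AE x in lebesgue. norm ((u x $ i)\<^sup>2) \<le> norm ((norm (u x))\<^sup>2)"
          using component_le_norm_cart by (auto simp: abs_le_square_iff[symmetric])
      qed measurable
      then have "integrable lebesgue (\<lambda>x. (v i x)\<^sup>2)"
        using uv[of i] by (subst integrable_cong_AE[of _ _ "\<lambda>x. (u x $ i)\<^sup>2"]) auto
      then show ?thesis by (subst (asm) lebesgue_integral_lborel(2)) auto
    qed
    have divv: "(\<integral>y. (\<Sum>i\<in>UNIV. v i y * partial i \<psi> y) \<partial>lborel) = 0" if t: "test_function \<psi>" for \<psi>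
    proof -
      have [measurable]: "partial i \<psi> \<in> borel_measurable borel" for i
        using t by (intro borel_measurable_continuous_onI smooth_continuous smooth_partial) (simp add: test_function_def)
      have [measurable]: "partial i \<psi> \<in> borel_measurable lebesgue" for i
        by (rule measurable_completion) simp
      have "0 = (\<integral>x. (\<Sum>i\<in>UNIV. u x $ i * partial i \<psi> x) \<partial>lebesgue)"
        using div t by (simp add: divergence_free_def)
      also have "\<dots> = (\<integral>x. (\<Sum>i\<in>UNIV. v i x * partial i \<psi> x) \<partial>lebesgue)"
        using uv_all by (intro integral_cong_AE) auto
      also have "\<dots> = (\<integral>x. (\<Sum>i\<in>UNIV. v i x * partial i \<psi> x) \<partial>lborel)"
        by (rule lebesgue_integral_lborel(1)) measurable
      finally show ?thesis by simp
    qed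
    have sg: "slow_growth (v i)" for i by (rule slow_growth_square_integrable[OF vm v2])
    have ivv: "integrable lborel (\<lambda>x. v i x * v j x)" for i j
      by (rule integrable_mult_square_integrable) (use v2 in auto)
    have blocks: "LP_block_vec chi (int n - 1) u x = (\<chi> j. convolve (block_kern chi n) (v j) x)" for n x
      unfolding LP_block_vec_def by (simp add: LP_block_eq[OF chi sg um uv])
    have sum1: "LP_sum chi (int Q) (\<lambda>y. u y $ j) = convolve (lowpass_kern chi (Suc Q)) (v j)" for j
      by (rule LP_sum_eq[OF chi sg um uv])
    have sum2: "LP_sum chi (int Q) (\<lambda>y. u y $ i * u y $ j) = convolve (lowpass_kern chi (Suc Q)) (\<lambda>y. v i y * v j y)" for i j
      using uv_all by (intro LP_sum_eq[OF chi slow_growth_integrable[OF ivv]]) auto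
    have flux_eq: "energy_flux chi (int Q) u = (\<integral>x. (\<Sum>i\<in>UNIV. \<Sum>j\<in>UNIV. convolve (lowpass_kern chi (Suc Q)) (\<lambda>y. v i y * v j y) x
          * partial i (convolve (lowpass_kern chi (Suc Q)) (v j)) x) \<partial>lborel)"
      unfolding energy_flux_def sum1 sum2 partial_convolve[OF rapid_lowpass_kern[OF chi] sg]
      by (intro lebesgue_integral_lborel(1) borel_measurable_sum borel_measurable_times convolve_measurable
          rapid_lowpass_kern[OF chi] rapid_partial slow_growth_integrable[OF ivv] sg)
    show "ennreal \<bar>energy_flux chi (int Q) u\<bar> \<le> ennreal (2 * C) * epowr (K_conv_d2 chi u (int Q)) (3/2)"
    proof (cases "K_conv_d2 chi u (int Q) = \<infinity>")
      case True
      then show ?thesis using C by (simp add: epowr_def ennreal_mult_top)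
    next
      case False
      define k where "k = enn2real (K_conv_d2 chi u (int Q))"
      have k: "K_conv_d2 chi u (int Q) = ennreal k" "k \<ge> 0"
        using False by (simp_all add: k_def less_top)
      define t where "t q = ennreal (K (int Q - q)) * (d chi u q)\<^sup>2" for q
      \<comment> \<open>The extended sum is the supremum of its finite partial sums; all later
        bounds are drawn from these.\<close>
      have t_sum: "sum t F \<le> ennreal k" if "finite F" "F \<subseteq> {-1..}" for F
      proof -
        have "sum t F \<le> (SUP F\<in>{F. finite F \<and> F \<subseteq> {-1..}}. sum t F)"
          using that by (intro SUP_upper) auto
        also have "\<dots> = K_conv_d2 chi u (int Q)"
          unfolding K_conv_d2_def t_def by (rule nonneg_infsum_complete[symmetric]) simp
        finally show ?thesis by (simp add: k)
      qed
      have Kpos: "K q > 0" for q by (simp add: K_def lam_def)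
      define X where "X n = (\<integral>\<^sup>+x. ennreal (norm (LP_block_vec chi (int n - 1) u x) ^ 3) \<partial>lebesgue)" for n
      define a where "a n = enn2real (epowr (X n) (1/3))" for n
      have a0: "a n \<ge> 0" for n by (simp add: a_def)
      have d_eq: "d chi u (int n - 1) = ennreal (lam (int n - 1) powr (1/3)) * epowr (X n) (1/3)" for n
        by (simp add: d_def L3_norm_def X_def)
      \<comment> \<open>All values of K are positive, so one infinite block norm would make the
        whole sum infinite.\<close>
      have Xfin: "X n \<noteq> \<infinity>" for n
      proof
        assume "X n = \<infinity>"
        then have "t (int n - 1) = \<infinity>"
          using Kpos[of "int Q - (int n - 1)"] unfolding t_def d_eq
          by (simp add: epowr_def ennreal_mult_top lam_def power2_eq_square)
        moreover have "t (int n - 1) \<le> ennreal k"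
          using t_sum[of "{int n - 1}"] by simp
        ultimately show False by (simp add: top_unique)
      qed
      note a_eq = epowr_third[OF Xfin, folded a_def]
      have t_eq: "t (int n - 1) = ennreal (lam (int Q) powr (2/3) * (if n \<le> Suc Q then (2 ^ n / 2 ^ Suc Q)\<^sup>2 else 1) * (a n)\<^sup>2)" for n
      proof -
        have "lam (int n - 1) powr (1/3) * lam (int n - 1) powr (1/3) = lam (int n - 1) powr (2/3)"
          by (simp flip: powr_add)
        then have "(d chi u (int n - 1))\<^sup>2 = ennreal (lam (int n - 1) powr (2/3) * (a n)\<^sup>2)"
          unfolding d_eq a_eq(1) using a0[of n]
          by (simp add: power2_eq_square ennreal_mult[symmetric] mult_ac)
        then show ?thesis
          unfolding t_def K_weight[symmetric] using Kpos[of "int Q - (int n - 1)"]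
          by (simp add: ennreal_mult[symmetric] mult.assoc)
      qed
      define L where "L = lam (int Q) powr (2/3)"
      have L: "L > 0" by (simp add: L_def lam_def)
      have w_sum: "(\<Sum>n\<in>I. (if n \<le> Suc Q then (2 ^ n / 2 ^ Suc Q)\<^sup>2 else 1) * (a n)\<^sup>2) \<le> k / L" if I: "finite I" for I
      proof -
        have "sum t ((\<lambda>n. int n - 1) ` I) = (\<Sum>n\<in>I. t (int n - 1))"
          by (subst sum.reindex) (auto simp: inj_on_def)
        also have "\<dots> = ennreal (\<Sum>n\<in>I. L * (if n \<le> Suc Q then (2 ^ n / 2 ^ Suc Q)\<^sup>2 else 1) * (a n)\<^sup>2)"
          unfolding t_eq L_def[symmetric] using L by (intro sum_ennreal) auto
        finally have "ennreal (\<Sum>n\<in>I. L * (if n \<le> Suc Q then (2 ^ n / 2 ^ Suc Q)\<^sup>2 else 1) * (a n)\<^sup>2) \<le> ennreal k"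
          using t_sum[of "(\<lambda>n. int n - 1) ` I"] I by (simp add: image_subset_iff)
        then have "(\<Sum>n\<in>I. L * (if n \<le> Suc Q then (2 ^ n / 2 ^ Suc Q)\<^sup>2 else 1) * (a n)\<^sup>2) \<le> k"
          using k by simp
        then show ?thesis
          using L unfolding mult.assoc sum_distrib_left[symmetric] by (simp add: pos_le_divide_eq mult.commute)
      qed
      \<comment> \<open>L^(3/2) is lambda_Q, so lambda_Q A^3 = k^(3/2), the target.\<close>
      define A where "A = sqrt (k / L)"
      have A: "A \<ge> 0" "A\<^sup>2 = k / L" using k L by (auto simp: A_def)
      \<comment> \<open>The norm of the vector-valued block dominates each of its components, so a
        single sequence a serves all three.\<close>
      have L3: "L3_bound lborel (convolve (block_kern chi n) (v i)) (a n)" for i n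
      proof -
        have cm: "convolve (block_kern chi n) (v i) \<in> borel_measurable borel"
          by (rule convolve_measurable[OF rapid_block_kern[OF chi] sg])
        then have "(\<integral>\<^sup>+x. ennreal (\<bar>convolve (block_kern chi n) (v i) x\<bar> ^ 3) \<partial>lborel) = (\<integral>\<^sup>+x. ennreal (\<bar>convolve (block_kern chi n) (v i) x\<bar> ^ 3) \<partial>lebesgue)"
          by (subst nn_integral_completion) auto
        also have "\<dots> \<le> X n"
          unfolding X_def
        proof (intro nn_integral_mono ennreal_leI power_mono)
          fix x
          show "\<bar>convolve (block_kern chi n) (v i) x\<bar> \<le> norm (LP_block_vec chi (int n - 1) u x)"
            using component_le_norm_cart[of "LP_block_vec chi (int n - 1) u x" i] by (simp add: blocks)
        qed auto
        finally show ?thesis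
          using cm a0[of n] a_eq(2)[of n] by (simp add: L3_bound_def)
      qed
      have "\<bar>energy_flux chi (int Q) u\<bar> \<le> C * 2 ^ Suc Q * A ^ 3"
        unfolding flux_eq
      proof (rule flux[rule_format, OF vm v2 divv L3 A(1)])
        have "(\<Sum>n\<le>Suc Q. (2 ^ n / 2 ^ Suc Q * a n)\<^sup>2) = (\<Sum>n\<in>{..Suc Q}. (if n \<le> Suc Q then (2 ^ n / 2 ^ Suc Q)\<^sup>2 else 1) * (a n)\<^sup>2)"
          by (intro sum.cong) (auto simp: power_mult_distrib power_divide)
        then show "(\<Sum>n\<le>Suc Q. (2 ^ n / 2 ^ Suc Q * a n)\<^sup>2) \<le> A\<^sup>2"
          using w_sum[of "{..Suc Q}"] by (simp only: A finite_atMost)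
        fix N
        have "(\<Sum>n\<le>N. (a (Suc (Suc Q) + n))\<^sup>2) = (\<Sum>n\<in>(\<lambda>n. Suc (Suc Q) + n) ` {..N}. (if n \<le> Suc Q then (2 ^ n / 2 ^ Suc Q)\<^sup>2 else 1) * (a n)\<^sup>2)"
          by (subst sum.reindex) (auto simp: inj_on_def)
        then show "(\<Sum>n\<le>N. (a (Suc (Suc Q) + n))\<^sup>2) \<le> A\<^sup>2"
          using w_sum[of "(\<lambda>n. Suc (Suc Q) + n) ` {..N}"] by (simp only: A finite_imageI finite_atMost)
      qed
      also have "C * 2 ^ Suc Q * A ^ 3 = 2 * C * k powr (3/2)"
      proof -
        have "A ^ 3 = ((k / L) powr (1/2)) ^ 3"
          using k L by (simp add: A_def powr_half_sqrt)
        also have "\<dots> = (k / L) powr (3/2)"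
          by (cases "k / L = 0") (auto simp: powr_power)
        also have "\<dots> = k powr (3/2) / L powr (3/2)" using k L by (simp add: powr_divide)
        also have "L powr (3/2) = 2 ^ Q" by (simp add: L_def powr_powr lam_nat)
        finally show ?thesis by simp
      qed
      finally show ?thesis
        using C k by (simp add: epowr_def ennreal_mult[symmetric] ennreal_leI)
    qed
  qed
qed

end
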